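(* Let $B_n$ be a homogeneous G-algebra. The induced functors $D^b(Q):D^b(\mathrm{gr}_{B_n})\to D^b(\mathrm{gr}_{(B_n)_Z})$ and $D^b(\psi):D^b(\mathrm{Qgr}_{B_n})\to D^b(\mathrm{gr}_{(B_n)_Z})$ are dense (essentially surjective).
   Context: Let $\Bbbk$ be a field of characteristic zero and $n\ge 1$. A G-algebra is an algebra $A_n=\Bbbk\langle X_1,\dots,X_n\rangle/\langle X_iX_j-b_{ij}X_jX_i+\sum_{k=1}^n c_{ij}^kX_k+d_{ij}\mid i>j\rangle$ with $b_{ij}\in\Bbbk\setminus\{0\}$, $c_{ij}^k,d_{ij}\in\Bbbk$, having a Poincaré–Birkhoff–Witt basis (the monomials $X_1^{a_1}\cdots X_n^{a_n}$ form a $\Bbbk$-basis). The associated homogeneous G-algebra is the graded algebra (all generators in degree one) $B_n=\Bbbk\langle X_1,\dots,X_n,Z\rangle/\langle X_iX_j-b_{ij}X_jX_i+\sum_k c_{ij}^kZX_k+d_{ij}Z^2\ (i>j),\ X_iZ-ZX_i\rangle$. It is noetherian with a PBW basis and $Z$ is central. $\mathrm{gr}_{R}$ denotes the category of finitely generated graded left $R$-modules with degree-zero maps. $(B_n)_Z$ is the graded localization of $B_n$ at the powers of $Z$, and $Q=(B_n)_Z\otimes_{B_n}-:\mathrm{gr}_{B_n}\to\mathrm{gr}_{(B_n)_Z}$, an exact functor. $\mathrm{Qgr}_{B_n}$ is the quotient abelian category of $\mathrm{gr}_{B_n}$ by the Serre subcategory of modules of finite dimension over $\Bbbk$, with quotient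 functor $\pi$. There is a unique functor $\psi:\mathrm{Qgr}_{B_n}\to\mathrm{gr}_{(B_n)_Z}$ with $\psi\pi=Q$; it is exact. *)

theory Defs
  imports "HOL-Algebra.QuotRing" "HOL-Algebra.Module" "HOL-Library.Poly_Mapping"
begin

section \<open>Categories\<close>

record ('o, 'a) cat =
  obj :: "'o set"
  arr :: "'a set"
  src :: "'a \<Rightarrow> 'o"
  tgt :: "'a \<Rightarrow> 'o"
  idt :: "'o \<Rightarrow> 'a"
  cmp :: "'a \<Rightarrow> 'a \<Rightarrow> 'a"  \<comment> \<open>\<open>cmp C g f\<close> is \<open>g\<close> after \<open>f\<close>\<close>

record ('o, 'a, 'p, 'b) ftor =
  fob :: "'o \<Rightarrow> 'p"
  far :: "'a \<Rightarrow> 'b"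

definition is_functor :: "('o, 'a) cat \<Rightarrow> ('p, 'b) cat \<Rightarrow> ('o, 'a, 'p, 'b) ftor \<Rightarrow> bool" where
  "is_functor C D F \<longleftrightarrow>
     (\<forall>x\<in>obj C. fob F x \<in> obj D \<and> far F (idt C x) = idt D (fob F x)) \<and>
     (\<forall>f\<in>arr C. far F f \<in> arr D \<and> src D (far F f) = fob F (src C f)
                \<and> tgt D (far F f) = fob F (tgt C f)) \<and>
     (\<forall>f\<in>arr C. \<forall>g\<in>arr C. tgt C f = src C g \<longrightarrow>
        far F (cmp C g f) = cmp D (far F g) (far F f))"

definition ftor_comp :: "('p, 'b, 'q, 'c) ftor \<Rightarrow> ('o, 'a, 'p, 'b) ftor \<Rightarrow> ('o, 'a, 'q, 'c) ftor" where
  "ftor_comp G F = \<lparr>fob = fob G \<circ> fob F, far = far G \<circ> far F\<rparr>"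

definition ftor_eq_on :: "('o, 'a) cat \<Rightarrow> ('o, 'a, 'p, 'b) ftor \<Rightarrow> ('o, 'a, 'p, 'b) ftor \<Rightarrow> bool" where
  "ftor_eq_on C F G \<longleftrightarrow> (\<forall>x\<in>obj C. fob F x = fob G x) \<and> (\<forall>f\<in>arr C. far F f = far G f)"

definition is_iso :: "('o, 'a) cat \<Rightarrow> 'a \<Rightarrow> bool" where
  "is_iso C f \<longleftrightarrow> f \<in> arr C \<and>
     (\<exists>g\<in>arr C. src C g = tgt C f \<and> tgt C g = src C f \<and>
        cmp C g f = idt C (src C f) \<and> cmp C f g = idt C (tgt C f))"

definition isomorphic :: "('o, 'a) cat \<Rightarrow> 'o \<Rightarrow> 'o \<Rightarrow> bool" where
  "isomorphic C x y \<longleftrightarrow> (\<exists>f. is_iso C f \<and> src C f = x \<and> tgt C f = y)"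

definition dense :: "('o, 'a) cat \<Rightarrow> ('p, 'b) cat \<Rightarrow> ('o, 'a, 'p, 'b) ftor \<Rightarrow> bool" where
  "dense C D F \<longleftrightarrow> (\<forall>y\<in>obj D. \<exists>x\<in>obj C. isomorphic D (fob F x) y)"

definition zero_obj :: "('o, 'a) cat \<Rightarrow> 'o \<Rightarrow> bool" where
  "zero_obj C z \<longleftrightarrow> z \<in> obj C \<and>
     (\<forall>x\<in>obj C. (\<exists>!f. f \<in> arr C \<and> src C f = z \<and> tgt C f = x) \<and>
                (\<exists>!f. f \<in> arr C \<and> src C f = x \<and> tgt C f = z))"

definition zero_arr :: "('o, 'a) cat \<Rightarrow> 'a \<Rightarrow> bool" where
  "zero_arr C f \<longleftrightarrow> (\<exists>z. zero_obj C z \<and>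
     (\<exists>g\<in>arr C. \<exists>h\<in>arr C. tgt C g = z \<and> src C h = z \<and> f = cmp C h g))"

definition is_kernel :: "('o, 'a) cat \<Rightarrow> 'a \<Rightarrow> 'a \<Rightarrow> bool" where
  "is_kernel C f k \<longleftrightarrow> k \<in> arr C \<and> tgt C k = src C f \<and> zero_arr C (cmp C f k) \<and>
     (\<forall>g\<in>arr C. tgt C g = src C f \<and> zero_arr C (cmp C f g) \<longrightarrow>
        (\<exists>!h. h \<in> arr C \<and> src C h = src C g \<and> tgt C h = src C k \<and> cmp C k h = g))"

definition is_cokernel :: "('o, 'a) cat \<Rightarrow> 'a \<Rightarrow> 'a \<Rightarrow> bool" where
  "is_cokernel C f q \<longleftrightarrow> q \<in> arr C \<and> src C q = tgt C f \<and> zero_arr C (cmp C q f) \<and>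
     (\<forall>g\<in>arr C. src C g = tgt C f \<and> zero_arr C (cmp C g f) \<longrightarrow>
        (\<exists>!h. h \<in> arr C \<and> src C h = tgt C q \<and> tgt C h = tgt C g \<and> cmp C h q = g))"

section \<open>Localization of a category at a class of arrows\<close>

text \<open>Gabriel-Zisman localization: arrows are zigzags (listed from source to target) of arrows
  of \<open>C\<close> and formal inverses of arrows in \<open>W\<close>, modulo the congruence generated by \<open>zmove\<close>.\<close>

datatype 'a zig = Fwd 'a | Inv 'a

primrec zpath :: "('o, 'a) cat \<Rightarrow> 'a set \<Rightarrow> 'a zig list \<Rightarrow> 'o \<Rightarrow> 'o \<Rightarrow> bool" where
  "zpath C W [] x y \<longleftrightarrow> x \<in> obj C \<and> x = y"
| "zpath C W (s # l) x y \<longleftrightarrow>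
     (case s of
        Fwd f \<Rightarrow> f \<in> arr C \<and> src C f = x \<and> zpath C W l (tgt C f) y
      | Inv f \<Rightarrow> f \<in> W \<and> f \<in> arr C \<and> tgt C f = x \<and> zpath C W l (src C f) y)"

inductive zmove :: "('o, 'a) cat \<Rightarrow> 'a set \<Rightarrow> 'a zig list \<Rightarrow> 'a zig list \<Rightarrow> bool" for C W where
  comp: "f \<in> arr C \<Longrightarrow> g \<in> arr C \<Longrightarrow> tgt C f = src C g \<Longrightarrow> zmove C W [Fwd f, Fwd g] [Fwd (cmp C g f)]"
| idt: "x \<in> obj C \<Longrightarrow> zmove C W [Fwd (idt C x)] []"
| inv_right: "s \<in> W \<Longrightarrow> zmove C W [Fwd s, Inv s] []"
| inv_left: "s \<in> W \<Longrightarrow> zmove C W [Inv s, Fwd s] []"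

inductive zeq :: "('o, 'a) cat \<Rightarrow> 'a set \<Rightarrow> 'o \<Rightarrow> 'o \<Rightarrow> 'a zig list \<Rightarrow> 'a zig list \<Rightarrow> bool"
  for C W x y where
  refl: "zpath C W l x y \<Longrightarrow> zeq C W x y l l"
| move: "zmove C W u v \<Longrightarrow> zpath C W (p @ u @ q) x y \<Longrightarrow> zpath C W (p @ v @ q) x y \<Longrightarrow>
         zeq C W x y (p @ u @ q) (p @ v @ q)"
| sym: "zeq C W x y l l' \<Longrightarrow> zeq C W x y l' l"
| trans: "zeq C W x y l l' \<Longrightarrow> zeq C W x y l' l'' \<Longrightarrow> zeq C W x y l l''"

definition zcls :: "('o, 'a) cat \<Rightarrow> 'a set \<Rightarrow> 'o \<Rightarrow> 'o \<Rightarrow> 'a zig list \<Rightarrow> 'a zig list set" where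
  "zcls C W x y l = {l'. zeq C W x y l l'}"

type_synonym ('o, 'a) zarr = "'o \<times> 'a zig list set \<times> 'o"

definition loc_cat :: "('o, 'a) cat \<Rightarrow> 'a set \<Rightarrow> ('o, ('o, 'a) zarr) cat" where
  "loc_cat C W =
     \<lparr>obj = obj C,
      arr = {(x, zcls C W x y l, y) | x y l. zpath C W l x y},
      src = (\<lambda>(x, A, y). x),
      tgt = (\<lambda>(x, A, y). y),
      idt = (\<lambda>x. (x, zcls C W x x [], x)),
      cmp = (\<lambda>(y', B, z) (x, A, y). (x, \<Union>a\<in>A. \<Union>b\<in>B. zcls C W x z (a @ b), z))\<rparr>"

definition loc_functor :: "('o, 'a) cat \<Rightarrow> 'a set \<Rightarrow> ('o, 'a, 'o, ('o, 'a) zarr) ftor" where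
  "loc_functor C W =
     \<lparr>fob = (\<lambda>x. x), far = (\<lambda>f. (src C f, zcls C W (src C f) (tgt C f) [Fwd f], tgt C f))\<rparr>"

text \<open>The functor between localizations induced by a functor \<open>F\<close>, intended for \<open>F\<close> sending the
  localized arrows of the source into \<open>V\<close>.  The union is over equal classes.\<close>

definition loc_induced ::
    "('p, 'b) cat \<Rightarrow> 'b set \<Rightarrow> ('o, 'a, 'p, 'b) ftor \<Rightarrow> ('o, ('o, 'a) zarr, 'p, ('p, 'b) zarr) ftor" where
  "loc_induced D V F =
     \<lparr>fob = fob F,
      far = (\<lambda>(x, A, y).
        (fob F x, \<Union>l\<in>A. zcls D V (fob F x) (fob F y) (map (map_zig (far F)) l), fob F y))\<rparr>"

section \<open>Serre quotients\<close>

text \<open>The quotient by a Serre subcategory with objects \<open>S\<close>, as localization at the arrows whose kernel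
  and cokernel lie in \<open>S\<close>.\<close>

definition serre_arrows :: "('o, 'a) cat \<Rightarrow> 'o set \<Rightarrow> 'a set" where
  "serre_arrows C S = {f \<in> arr C. (\<exists>k. is_kernel C f k \<and> src C k \<in> S) \<and>
                                  (\<exists>q. is_cokernel C f q \<and> tgt C q \<in> S)}"

definition serre_quotient :: "('o, 'a) cat \<Rightarrow> 'o set \<Rightarrow> ('o, ('o, 'a) zarr) cat" where
  "serre_quotient C S = loc_cat C (serre_arrows C S)"

definition serre_functor :: "('o, 'a) cat \<Rightarrow> 'o set \<Rightarrow> ('o, 'a, 'o, ('o, 'a) zarr) ftor" where
  "serre_functor C S = loc_functor C (serre_arrows C S)"

section \<open>Bounded derived categories\<close>

record ('o, 'a) cplx =
  cob :: "int \<Rightarrow> 'o"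
  cdf :: "int \<Rightarrow> 'a"  \<comment> \<open>\<open>cdf X i\<close> goes from degree \<open>i\<close> to degree \<open>i + 1\<close>\<close>

type_synonym ('o, 'a) carr = "('o, 'a) cplx \<times> (int \<Rightarrow> 'a) \<times> ('o, 'a) cplx"

definition is_bounded_complex :: "('o, 'a) cat \<Rightarrow> ('o, 'a) cplx \<Rightarrow> bool" where
  "is_bounded_complex C X \<longleftrightarrow>
     (\<forall>i. cob X i \<in> obj C \<and> cdf X i \<in> arr C \<and>
          src C (cdf X i) = cob X i \<and> tgt C (cdf X i) = cob X (i + 1) \<and>
          zero_arr C (cmp C (cdf X (i + 1)) (cdf X i))) \<and>
     (\<exists>N. \<forall>i. \<bar>i\<bar> > N \<longrightarrow> zero_obj C (cob X i))"

definition is_chain_map ::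
    "('o, 'a) cat \<Rightarrow> ('o, 'a) cplx \<Rightarrow> (int \<Rightarrow> 'a) \<Rightarrow> ('o, 'a) cplx \<Rightarrow> bool" where
  "is_chain_map C X \<phi> Y \<longleftrightarrow>
     (\<forall>i. \<phi> i \<in> arr C \<and> src C (\<phi> i) = cob X i \<and> tgt C (\<phi> i) = cob Y i \<and>
          cmp C (cdf Y i) (\<phi> i) = cmp C (\<phi> (i + 1)) (cdf X i))"

definition complexes :: "('o, 'a) cat \<Rightarrow> (('o, 'a) cplx, ('o, 'a) carr) cat" where
  "complexes C =
     \<lparr>obj = {X. is_bounded_complex C X},
      arr = {(X, \<phi>, Y). is_bounded_complex C X \<and> is_bounded_complex C Y \<and> is_chain_map C X \<phi> Y},
      src = (\<lambda>(X, \<phi>, Y). X),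
      tgt = (\<lambda>(X, \<phi>, Y). Y),
      idt = (\<lambda>X. (X, \<lambda>i. idt C (cob X i), X)),
      cmp = (\<lambda>(Y', \<chi>, Z) (X, \<phi>, Y). (X, \<lambda>i. cmp C (\<chi> i) (\<phi> i), Z))\<rparr>"

text \<open>\<open>is_cohomology C X i k q\<close>: the target of \<open>q\<close> is the \<open>i\<close>-th cohomology object of \<open>X\<close>, where \<open>k\<close>
  is the inclusion of the cocycles and \<open>q\<close> is the projection from the cocycles.\<close>

definition is_cohomology :: "('o, 'a) cat \<Rightarrow> ('o, 'a) cplx \<Rightarrow> int \<Rightarrow> 'a \<Rightarrow> 'a \<Rightarrow> bool" where
  "is_cohomology C X i k q \<longleftrightarrow> is_kernel C (cdf X i) k \<and>
     (\<exists>e\<in>arr C. src C e = cob X (i - 1) \<and> tgt C e = src C k \<and>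
        cmp C k e = cdf X (i - 1) \<and> is_cokernel C e q)"

definition quasi_isos :: "('o, 'a) cat \<Rightarrow> ('o, 'a) carr set" where
  "quasi_isos C = {(X, \<phi>, Y) \<in> arr (complexes C).
     \<forall>i. \<exists>k q k' q' u h.
       is_cohomology C X i k q \<and> is_cohomology C Y i k' q' \<and>
       u \<in> arr C \<and> src C u = src C k \<and> tgt C u = src C k' \<and> cmp C k' u = cmp C (\<phi> i) k \<and>
       src C h = tgt C q \<and> tgt C h = tgt C q' \<and> cmp C h q = cmp C q' u \<and> is_iso C h}"

text \<open>The derived category as localization of the category of bounded complexes at the
  quasi-isomorphisms; homotopic chain maps become equal in it.\<close>

definition Db :: "('o, 'a) cat \<Rightarrow> (('o, 'a) cplx, (('o, 'a) cplx, ('o, 'a) carr) zarr) cat" where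
  "Db C = loc_cat (complexes C) (quasi_isos C)"

definition complexes_map ::
    "('o, 'a, 'p, 'b) ftor \<Rightarrow> (('o, 'a) cplx, ('o, 'a) carr, ('p, 'b) cplx, ('p, 'b) carr) ftor" where
  "complexes_map F =
     (let FX = (\<lambda>X. \<lparr>cob = (\<lambda>i. fob F (cob X i)), cdf = (\<lambda>i. far F (cdf X i))\<rparr>)
      in \<lparr>fob = FX, far = (\<lambda>(X, \<phi>, Y). (FX X, \<lambda>i. far F (\<phi> i), FX Y))\<rparr>)"

text \<open>For an exact functor \<open>F\<close> with target \<open>D\<close>.\<close>

definition Db_map ::
    "('p, 'b) cat \<Rightarrow> ('o, 'a, 'p, 'b) ftor \<Rightarrow>
     (('o, 'a) cplx, (('o, 'a) cplx, ('o, 'a) carr) zarr,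
      ('p, 'b) cplx, (('p, 'b) cplx, ('p, 'b) carr) zarr) ftor" where
  "Db_map D F = loc_induced (complexes D) (quasi_isos D) (complexes_map F)"

section \<open>Graded algebras and finitely generated graded modules\<close>

text \<open>A \<open>'k\<close>-algebra with a \<open>\<int>\<close>-grading: \<open>scal\<close> is the structure map from the field and \<open>hpart R d\<close> the
  component of degree \<open>d\<close>.\<close>

record ('k, 'r) galg = "'r ring" +
  scal :: "'k \<Rightarrow> 'r"
  hpart :: "int \<Rightarrow> 'r set"

text \<open>The fields \<open>mult\<close> and \<open>one\<close> that module records inherit from \<open>ring\<close> carry no meaning.\<close>

record ('r, 'u) gmod = "('r, 'u) module" +
  mpart :: "int \<Rightarrow> 'u set"

definition left_module :: "('r, 'z) ring_scheme \<Rightarrow> ('r, 'u, 'y) module_scheme \<Rightarrow> bool" where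
  "left_module R M \<longleftrightarrow> abelian_group M \<and>
     (\<forall>a\<in>carrier R. \<forall>x\<in>carrier M. a \<odot>\<^bsub>M\<^esub> x \<in> carrier M) \<and>
     (\<forall>a\<in>carrier R. \<forall>b\<in>carrier R. \<forall>x\<in>carrier M.
        (a \<oplus>\<^bsub>R\<^esub> b) \<odot>\<^bsub>M\<^esub> x = a \<odot>\<^bsub>M\<^esub> x \<oplus>\<^bsub>M\<^esub> b \<odot>\<^bsub>M\<^esub> x) \<and>
     (\<forall>a\<in>carrier R. \<forall>x\<in>carrier M. \<forall>y\<in>carrier M.
        a \<odot>\<^bsub>M\<^esub> (x \<oplus>\<^bsub>M\<^esub> y) = a \<odot>\<^bsub>M\<^esub> x \<oplus>\<^bsub>M\<^esub> a \<odot>\<^bsub>M\<^esub> y) \<and>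
     (\<forall>a\<in>carrier R. \<forall>b\<in>carrier R. \<forall>x\<in>carrier M.
        (a \<otimes>\<^bsub>R\<^esub> b) \<odot>\<^bsub>M\<^esub> x = a \<odot>\<^bsub>M\<^esub> (b \<odot>\<^bsub>M\<^esub> x)) \<and>
     (\<forall>x\<in>carrier M. \<one>\<^bsub>R\<^esub> \<odot>\<^bsub>M\<^esub> x = x)"

definition graded_module :: "('k, 'r) galg \<Rightarrow> ('r, 'u) gmod \<Rightarrow> bool" where
  "graded_module R M \<longleftrightarrow> left_module R M \<and>
     (\<forall>d. additive_subgroup (mpart M d) M) \<and>
     (\<forall>x\<in>carrier M. \<exists>!c. (\<forall>d. c d \<in> mpart M d) \<and> finite {d. c d \<noteq> \<zero>\<^bsub>M\<^esub>} \<and>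
                          x = (\<Oplus>\<^bsub>M\<^esub>d\<in>{d. c d \<noteq> \<zero>\<^bsub>M\<^esub>}. c d)) \<and>
     (\<forall>i j. \<forall>a\<in>hpart R i. \<forall>x\<in>mpart M j. a \<odot>\<^bsub>M\<^esub> x \<in> mpart M (i + j))"

definition left_submodule :: "('r, 'z) ring_scheme \<Rightarrow> ('r, 'u, 'y) module_scheme \<Rightarrow> 'u set \<Rightarrow> bool" where
  "left_submodule R M N \<longleftrightarrow> additive_subgroup N M \<and> (\<forall>a\<in>carrier R. \<forall>x\<in>N. a \<odot>\<^bsub>M\<^esub> x \<in> N)"

definition fin_gen :: "('r, 'z) ring_scheme \<Rightarrow> ('r, 'u, 'y) module_scheme \<Rightarrow> bool" where
  "fin_gen R M \<longleftrightarrow> (\<exists>S. finite S \<and> S \<subseteq> carrier M \<and>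
     (\<forall>N. left_submodule R M N \<and> S \<subseteq> N \<longrightarrow> N = carrier M))"

definition fin_dim :: "('k, 'r) galg \<Rightarrow> ('r, 'u) gmod \<Rightarrow> bool" where
  "fin_dim R M \<longleftrightarrow> (\<exists>S. finite S \<and> S \<subseteq> carrier M \<and>
     (\<forall>x\<in>carrier M. \<exists>\<gamma>. x = (\<Oplus>\<^bsub>M\<^esub>s\<in>S. scal R (\<gamma> s) \<odot>\<^bsub>M\<^esub> s)))"

type_synonym ('r, 'u) garr = "('r, 'u) gmod \<times> ('u \<Rightarrow> 'u) \<times> ('r, 'u) gmod"

definition gmod_hom :: "('k, 'r) galg \<Rightarrow> ('r, 'u) gmod \<Rightarrow> ('r, 'u) gmod \<Rightarrow> ('u \<Rightarrow> 'u) set" where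
  "gmod_hom R M N = {f. f \<in> carrier M \<rightarrow>\<^sub>E carrier N \<and>
     (\<forall>x\<in>carrier M. \<forall>y\<in>carrier M. f (x \<oplus>\<^bsub>M\<^esub> y) = f x \<oplus>\<^bsub>N\<^esub> f y) \<and>
     (\<forall>a\<in>carrier R. \<forall>x\<in>carrier M. f (a \<odot>\<^bsub>M\<^esub> x) = a \<odot>\<^bsub>N\<^esub> f x) \<and>
     (\<forall>d. f ` mpart M d \<subseteq> mpart N d)}"

text \<open>The type \<open>'u\<close> plays the role of a universe: all modules have a subset of it as carrier.  If \<open>R\<close>
  has countable dimension over an infinite field \<open>'k\<close>, every finitely generated module has at most as
  many elements as \<open>'k\<close>, so it has an isomorphic copy in any \<open>'u\<close> into which \<open>'k\<close> embeds.\<close>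

definition gr :: "('k, 'r) galg \<Rightarrow> (('r, 'u) gmod, ('r, 'u) garr) cat" where
  "gr R =
     \<lparr>obj = {M. graded_module R M \<and> fin_gen R M},
      arr = {(M, f, N). graded_module R M \<and> fin_gen R M \<and> graded_module R N \<and> fin_gen R N \<and>
                        f \<in> gmod_hom R M N},
      src = (\<lambda>(M, f, N). M),
      tgt = (\<lambda>(M, f, N). N),
      idt = (\<lambda>M. (M, \<lambda>x\<in>carrier M. x, M)),
      cmp = (\<lambda>(N', g, P) (M, f, N). (M, compose (carrier M) g f, P))\<rparr>"

definition torsion_objs :: "('k, 'r) galg \<Rightarrow> ('r, 'u) gmod set" where
  "torsion_objs R = {M \<in> obj (gr R). fin_dim R M}"

definition Qgr :: "('k, 'r) galg \<Rightarrow> (('r, 'u) gmod, (('r, 'u) gmod, ('r, 'u) garr) zarr) cat" where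
  "Qgr R = serre_quotient (gr R) (torsion_objs R)"

definition Qgr_proj ::
    "('k, 'r) galg \<Rightarrow> (('r, 'u) gmod, ('r, 'u) garr, ('r, 'u) gmod, (('r, 'u) gmod, ('r, 'u) garr) zarr) ftor" where
  "Qgr_proj R = serre_functor (gr R) (torsion_objs R)"

section \<open>Extension of scalars\<close>

text \<open>\<open>S \<otimes>\<^sub>R M\<close> for a homomorphism \<open>h\<close> from \<open>R\<close> to \<open>S\<close>: the free abelian group on \<open>S \<times> M\<close> modulo the
  bilinearity and balancing relators.\<close>

inductive_set tensor_rel ::
    "('k, 'r) galg \<Rightarrow> ('k, 's) galg \<Rightarrow> ('r \<Rightarrow> 's) \<Rightarrow> ('r, 'u) gmod \<Rightarrow> ('s \<times> 'u \<Rightarrow>\<^sub>0 int) set"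
  for R S h M where
  zero: "0 \<in> tensor_rel R S h M"
| diff: "\<phi> \<in> tensor_rel R S h M \<Longrightarrow> \<psi> \<in> tensor_rel R S h M \<Longrightarrow> \<phi> - \<psi> \<in> tensor_rel R S h M"
| add_left: "s \<in> carrier S \<Longrightarrow> t \<in> carrier S \<Longrightarrow> x \<in> carrier M \<Longrightarrow>
    frag_of (s \<oplus>\<^bsub>S\<^esub> t, x) - frag_of (s, x) - frag_of (t, x) \<in> tensor_rel R S h M"
| add_right: "s \<in> carrier S \<Longrightarrow> x \<in> carrier M \<Longrightarrow> y \<in> carrier M \<Longrightarrow>
    frag_of (s, x \<oplus>\<^bsub>M\<^esub> y) - frag_of (s, x) - frag_of (s, y) \<in> tensor_rel R S h M"
| balanced: "s \<in> carrier S \<Longrightarrow> r \<in> carrier R \<Longrightarrow> x \<in> carrier M \<Longrightarrow>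
    frag_of (s \<otimes>\<^bsub>S\<^esub> h r, x) - frag_of (s, r \<odot>\<^bsub>M\<^esub> x) \<in> tensor_rel R S h M"

definition tensor_pre :: "('k, 's) galg \<Rightarrow> ('r, 'u) gmod \<Rightarrow> ('s \<times> 'u \<Rightarrow>\<^sub>0 int) set" where
  "tensor_pre S M = {\<phi>. Poly_Mapping.keys \<phi> \<subseteq> carrier S \<times> carrier M}"

definition tensor_cls ::
    "('k, 'r) galg \<Rightarrow> ('k, 's) galg \<Rightarrow> ('r \<Rightarrow> 's) \<Rightarrow> ('r, 'u) gmod \<Rightarrow>
     ('s \<times> 'u \<Rightarrow>\<^sub>0 int) \<Rightarrow> ('s \<times> 'u \<Rightarrow>\<^sub>0 int) set" where
  "tensor_cls R S h M \<phi> = {\<psi> \<in> tensor_pre S M. \<psi> - \<phi> \<in> tensor_rel R S h M}"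

text \<open>The unions below are over equal classes.\<close>

definition ext_scalars_obj ::
    "('k, 'r) galg \<Rightarrow> ('k, 's) galg \<Rightarrow> ('r \<Rightarrow> 's) \<Rightarrow> ('r, 'u) gmod \<Rightarrow> ('s, ('s \<times> 'u \<Rightarrow>\<^sub>0 int) set) gmod" where
  "ext_scalars_obj R S h M =
     \<lparr>carrier = tensor_cls R S h M ` tensor_pre S M,
      mult = (\<lambda>_ _. tensor_cls R S h M 0),
      one = tensor_cls R S h M 0,
      zero = tensor_cls R S h M 0,
      add = (\<lambda>A B. \<Union>\<phi>\<in>A. \<Union>\<psi>\<in>B. tensor_cls R S h M (\<phi> + \<psi>)),
      smult = (\<lambda>t A. \<Union>\<phi>\<in>A. tensor_cls R S h M (frag_extend (\<lambda>(s, x). frag_of (t \<otimes>\<^bsub>S\<^esub> s, x)) \<phi>)),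
      mpart = (\<lambda>d. tensor_cls R S h M `
        {\<phi>. \<forall>(s, x) \<in> Poly_Mapping.keys \<phi>. \<exists>i j. i + j = d \<and> s \<in> hpart S i \<and> x \<in> mpart M j})\<rparr>"

definition ext_scalars ::
    "('k, 'r) galg \<Rightarrow> ('k, 's) galg \<Rightarrow> ('r \<Rightarrow> 's) \<Rightarrow>
     (('r, 'u) gmod, ('r, 'u) garr,
      ('s, ('s \<times> 'u \<Rightarrow>\<^sub>0 int) set) gmod, ('s, ('s \<times> 'u \<Rightarrow>\<^sub>0 int) set) garr) ftor" where
  "ext_scalars R S h =
     \<lparr>fob = ext_scalars_obj R S h,
      far = (\<lambda>(M, f, N).
        (ext_scalars_obj R S h M,
         \<lambda>A\<in>carrier (ext_scalars_obj R S h M).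
           \<Union>\<phi>\<in>A. tensor_cls R S h N (frag_extend (\<lambda>(s, x). frag_of (s, f x)) \<phi>),
         ext_scalars_obj R S h N))\<rparr>"

section \<open>Graded localization at a central element\<close>

text \<open>\<open>frac R z a m\<close> is the fraction \<open>a / z^m\<close> for a central \<open>z\<close>.  In \<open>loc_alg\<close> the element \<open>z\<close> is
  homogeneous of degree one.\<close>

definition frac :: "('k, 'r) galg \<Rightarrow> 'r \<Rightarrow> 'r \<Rightarrow> nat \<Rightarrow> ('r \<times> nat) set" where
  "frac R z a m = {(b, l). b \<in> carrier R \<and>
     (\<exists>k. (z [^]\<^bsub>R\<^esub> (k::nat)) \<otimes>\<^bsub>R\<^esub> ((z [^]\<^bsub>R\<^esub> l) \<otimes>\<^bsub>R\<^esub> a) =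
          (z [^]\<^bsub>R\<^esub> k) \<otimes>\<^bsub>R\<^esub> ((z [^]\<^bsub>R\<^esub> m) \<otimes>\<^bsub>R\<^esub> b))}"

definition loc_alg :: "('k, 'r) galg \<Rightarrow> 'r \<Rightarrow> ('k, ('r \<times> nat) set) galg" where
  "loc_alg R z =
     \<lparr>carrier = {frac R z a m | a m. a \<in> carrier R},
      mult = (\<lambda>A B. \<Union>(a, m)\<in>A. \<Union>(b, l)\<in>B. frac R z (a \<otimes>\<^bsub>R\<^esub> b) (m + l)),
      one = frac R z \<one>\<^bsub>R\<^esub> 0,
      zero = frac R z \<zero>\<^bsub>R\<^esub> 0,
      add = (\<lambda>A B. \<Union>(a, m)\<in>A. \<Union>(b, l)\<in>B.
        frac R z (((z [^]\<^bsub>R\<^esub> l) \<otimes>\<^bsub>R\<^esub> a) \<oplus>\<^bsub>R\<^esub> ((z [^]\<^bsub>R\<^esub> m) \<otimes>\<^bsub>R\<^esub> b)) (m + l)),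
      scal = (\<lambda>c. frac R z (scal R c) 0),
      hpart = (\<lambda>d. {frac R z a m | a m. a \<in> hpart R (d + int m)})\<rparr>"

section \<open>G-algebras\<close>

text \<open>The free algebra on the letters in \<open>L\<close>: finitely supported functions on words, graded by word
  length.\<close>

definition wmon :: "'x list \<Rightarrow> 'x list \<Rightarrow> 'k::field" where
  "wmon w = (\<lambda>v. if v = w then 1 else 0)"

definition free_alg :: "'x set \<Rightarrow> ('k::field, 'x list \<Rightarrow> 'k) galg" where
  "free_alg L =
     (let F = {f. finite {w. f w \<noteq> 0} \<and> {w. f w \<noteq> 0} \<subseteq> lists L}
      in \<lparr>carrier = F,
          mult = (\<lambda>f g w. \<Sum>i\<le>length w. f (take i w) * g (drop i w)),
          one = wmon [],
          zero = (\<lambda>_. 0),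
          add = (\<lambda>f g w. f w + g w),
          scal = (\<lambda>c w. c * wmon [] w),
          hpart = (\<lambda>d. {f \<in> F. \<forall>w. f w \<noteq> 0 \<longrightarrow> int (length w) = d})\<rparr>)"

text \<open>The grading is the image grading, which is a grading of the quotient only for homogeneous
  \<open>I\<close>; it is not used for the inhomogeneous \<open>A_alg\<close> below.\<close>

definition quot_alg :: "('k, 'r) galg \<Rightarrow> 'r set \<Rightarrow> ('k, 'r set) galg" where
  "quot_alg R I = ring.extend (R Quot I)
     (galg.fields (\<lambda>c. I +>\<^bsub>R\<^esub> scal R c) (\<lambda>d. (\<lambda>a. I +>\<^bsub>R\<^esub> a) ` hpart R d))"

datatype gvar = X nat | Z

definition A_rels ::
    "nat \<Rightarrow> (nat \<Rightarrow> nat \<Rightarrow> 'k) \<Rightarrow> (nat \<Rightarrow> nat \<Rightarrow> nat \<Rightarrow> 'k) \<Rightarrow> (nat \<Rightarrow> nat \<Rightarrow> 'k) \<Rightarrow>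
     (gvar list \<Rightarrow> 'k::field) set" where
  "A_rels n b c d =
     {(\<lambda>w. wmon [X i, X j] w - b i j * wmon [X j, X i] w
           + (\<Sum>k=1..n. c i j k * wmon [X k] w) + d i j * wmon [] w)
      | i j. 1 \<le> j \<and> j < i \<and> i \<le> n}"

definition B_rels ::
    "nat \<Rightarrow> (nat \<Rightarrow> nat \<Rightarrow> 'k) \<Rightarrow> (nat \<Rightarrow> nat \<Rightarrow> nat \<Rightarrow> 'k) \<Rightarrow> (nat \<Rightarrow> nat \<Rightarrow> 'k) \<Rightarrow>
     (gvar list \<Rightarrow> 'k::field) set" where
  "B_rels n b c d =
     {(\<lambda>w. wmon [X i, X j] w - b i j * wmon [X j, X i] w
           + (\<Sum>k=1..n. c i j k * wmon [Z, X k] w) + d i j * wmon [Z, Z] w)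
      | i j. 1 \<le> j \<and> j < i \<and> i \<le> n} \<union>
     {(\<lambda>w. wmon [X i, Z] w - wmon [Z, X i] w) | i. 1 \<le> i \<and> i \<le> n}"

definition A_ideal where
  "A_ideal n b c d = Idl\<^bsub>free_alg (X ` {1..n})\<^esub> (A_rels n b c d)"

definition A_alg ::
    "nat \<Rightarrow> (nat \<Rightarrow> nat \<Rightarrow> 'k) \<Rightarrow> (nat \<Rightarrow> nat \<Rightarrow> nat \<Rightarrow> 'k) \<Rightarrow> (nat \<Rightarrow> nat \<Rightarrow> 'k) \<Rightarrow>
     ('k::field, (gvar list \<Rightarrow> 'k) set) galg" where
  "A_alg n b c d = quot_alg (free_alg (X ` {1..n})) (A_ideal n b c d)"

definition A_var where
  "A_var n b c d i = A_ideal n b c d +>\<^bsub>free_alg (X ` {1..n})\<^esub> wmon [X i]"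

primrec ordered_monomial :: "('r, 'z) monoid_scheme \<Rightarrow> (nat \<Rightarrow> 'r) \<Rightarrow> nat \<Rightarrow> (nat \<Rightarrow> nat) \<Rightarrow> 'r" where
  "ordered_monomial R x 0 a = \<one>\<^bsub>R\<^esub>"
| "ordered_monomial R x (Suc m) a = ordered_monomial R x m a \<otimes>\<^bsub>R\<^esub> (x (Suc m) [^]\<^bsub>R\<^esub> a (Suc m))"

definition has_pbw_basis :: "('k::field, 'r) galg \<Rightarrow> (nat \<Rightarrow> 'r) \<Rightarrow> nat \<Rightarrow> bool" where
  "has_pbw_basis R x n \<longleftrightarrow>
     (\<forall>y\<in>carrier R. \<exists>!\<gamma>::(nat \<Rightarrow> nat) \<Rightarrow> 'k.
        finite {a. \<gamma> a \<noteq> 0} \<and> (\<forall>a. \<gamma> a \<noteq> 0 \<longrightarrow> {i. a i \<noteq> 0} \<subseteq> {1..n}) \<and>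
        y = (\<Oplus>\<^bsub>R\<^esub>a\<in>{a. \<gamma> a \<noteq> 0}. scal R (\<gamma> a) \<otimes>\<^bsub>R\<^esub> ordered_monomial R x n a))"

definition g_algebra ::
    "nat \<Rightarrow> (nat \<Rightarrow> nat \<Rightarrow> 'k::field) \<Rightarrow> (nat \<Rightarrow> nat \<Rightarrow> nat \<Rightarrow> 'k) \<Rightarrow> (nat \<Rightarrow> nat \<Rightarrow> 'k) \<Rightarrow> bool" where
  "g_algebra n b c d \<longleftrightarrow>
     (\<forall>i j. 1 \<le> j \<and> j < i \<and> i \<le> n \<longrightarrow> b i j \<noteq> 0) \<and>
     has_pbw_basis (A_alg n b c d) (A_var n b c d) n"

definition B_ideal where
  "B_ideal n b c d = Idl\<^bsub>free_alg (insert Z (X ` {1..n}))\<^esub> (B_rels n b c d)"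

definition B_alg ::
    "nat \<Rightarrow> (nat \<Rightarrow> nat \<Rightarrow> 'k) \<Rightarrow> (nat \<Rightarrow> nat \<Rightarrow> nat \<Rightarrow> 'k) \<Rightarrow> (nat \<Rightarrow> nat \<Rightarrow> 'k) \<Rightarrow>
     ('k::field, (gvar list \<Rightarrow> 'k) set) galg" where
  "B_alg n b c d = quot_alg (free_alg (insert Z (X ` {1..n}))) (B_ideal n b c d)"

definition B_Z where
  "B_Z n b c d = B_ideal n b c d +>\<^bsub>free_alg (insert Z (X ` {1..n}))\<^esub> wmon [Z]"

definition B_loc ::
    "nat \<Rightarrow> (nat \<Rightarrow> nat \<Rightarrow> 'k) \<Rightarrow> (nat \<Rightarrow> nat \<Rightarrow> nat \<Rightarrow> 'k) \<Rightarrow> (nat \<Rightarrow> nat \<Rightarrow> 'k) \<Rightarrow>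
     ('k::field, ((gvar list \<Rightarrow> 'k) set \<times> nat) set) galg" where
  "B_loc n b c d = loc_alg (B_alg n b c d) (B_Z n b c d)"

definition Q_functor where
  "Q_functor n b c d =
     ext_scalars (B_alg n b c d) (B_loc n b c d) (\<lambda>r. frac (B_alg n b c d) (B_Z n b c d) r 0)"

end

theory Submission
  imports Defs "HOL-Algebra.Free_Abelian_Groups"
begin

text \<open>Write \<open>R\<close> for the algebra \<open>B\<^sub>n\<close>, \<open>z\<close> for the central element \<open>Z\<close> and \<open>L\<close> for the localization of \<open>R\<close> at
  the powers of \<open>z\<close>.  Every bounded complex \<open>K\<close> of finitely generated graded \<open>L\<close>-modules is isomorphic,
  already as a complex, to \<open>Q\<close> applied to a subcomplex of finitely generated graded \<open>R\<close>-modules, and this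
  isomorphism persists in the derived category.

  The subcomplex is a lattice.  Let \<open>H\<^sub>i\<close> be a finite set of homogeneous generators of \<open>K\<^sup>i\<close>, put
  \<open>G\<^sub>i = H\<^sub>i \<union> \<delta>(H\<^sub>i\<^sub>-\<^sub>1)\<close> and let \<open>P\<^sub>i\<close> be the \<open>R\<close>-submodule of \<open>K\<^sup>i\<close> spanned by \<open>G\<^sub>i\<close>.  Since \<open>\<delta>\<delta> = 0\<close>, the differential
  maps \<open>P\<^sub>i\<close> into \<open>P\<^sub>i\<^sub>+\<^sub>1\<close>; no induction along the complex is needed.  The elements of \<open>K\<^sup>i\<close> that some power of
  \<open>z\<close> moves into \<open>P\<^sub>i\<close> form an \<open>L\<close>-submodule containing the generators \<open>H\<^sub>i\<close>, so they are all of \<open>K\<^sup>i\<close>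
  (\<open>P_absorbing\<close>), and hence the multiplication map \<open>L \<otimes> P\<^sub>i \<rightarrow> K\<^sup>i\<close> is onto.  It is one-to-one because every
  tensor equals some \<open>z\<^sup>-\<^sup>m \<otimes> x\<close> (\<open>normal_form\<close>) and \<open>z\<^sup>-\<^sup>m\<close> acts injectively on \<open>K\<^sup>i\<close> (\<open>rel_iff\<close>).  As \<open>P\<^sub>i\<close> has at
  most as many elements as the ground field (\<open>P_lepoll\<close>), it has a copy with carrier in the given
  universe (\<open>ex_lattice\<close>).

  For \<open>\<psi>\<close>, the complex \<open>\<pi>(P)\<close> does the same service: \<open>\<psi>(\<pi>(P)) = Q(P)\<close> by assumption, and \<open>\<pi>(P)\<close> is a
  bounded complex because localization preserves zero objects (\<open>zero_obj_loc_cat\<close>).\<close>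

section \<open>Localization of categories\<close>

locale category =
  fixes C :: "('o, 'a) cat"
  assumes src_obj: "f \<in> arr C \<Longrightarrow> src C f \<in> obj C"
    and tgt_obj: "f \<in> arr C \<Longrightarrow> tgt C f \<in> obj C"
    and idt_arr: "x \<in> obj C \<Longrightarrow> idt C x \<in> arr C"
    and src_idt: "x \<in> obj C \<Longrightarrow> src C (idt C x) = x"
    and tgt_idt: "x \<in> obj C \<Longrightarrow> tgt C (idt C x) = x"
    and cmp_arr: "f \<in> arr C \<Longrightarrow> g \<in> arr C \<Longrightarrow> tgt C f = src C g \<Longrightarrow> cmp C g f \<in> arr C"
    and src_cmp: "f \<in> arr C \<Longrightarrow> g \<in> arr C \<Longrightarrow> tgt C f = src C g \<Longrightarrow> src C (cmp C g f) = src C f"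
    and tgt_cmp: "f \<in> arr C \<Longrightarrow> g \<in> arr C \<Longrightarrow> tgt C f = src C g \<Longrightarrow> tgt C (cmp C g f) = tgt C g"
    and cmp_idt_left: "f \<in> arr C \<Longrightarrow> cmp C (idt C (tgt C f)) f = f"
    and cmp_idt_right: "f \<in> arr C \<Longrightarrow> cmp C f (idt C (src C f)) = f"
    and cmp_assoc: "f \<in> arr C \<Longrightarrow> g \<in> arr C \<Longrightarrow> h \<in> arr C \<Longrightarrow> tgt C f = src C g \<Longrightarrow>
        tgt C g = src C h \<Longrightarrow> cmp C h (cmp C g f) = cmp C (cmp C h g) f"
begin

lemma zpath_objs: "zpath C W l x y \<Longrightarrow> x \<in> obj C \<and> y \<in> obj C"
  by (induction l arbitrary: x) (auto split: zig.splits intro: src_obj tgt_obj)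

lemma zpath_append:
  "zpath C W (p @ q) x y \<longleftrightarrow> (\<exists>u. zpath C W p x u \<and> zpath C W q u y)"
  by (induction p arbitrary: x) (auto split: zig.splits dest: zpath_objs)

lemma zeq_zpath:
  assumes "zeq C W x y l l'" shows "zpath C W l x y \<and> zpath C W l' x y"
  using assms by induction auto

lemma zeq_in_context:
  assumes "zeq C W x y l l'" "zpath C W p u x" "zpath C W q y v"
  shows "zeq C W u v (p @ l @ q) (p @ l' @ q)"
  using assms
proof (induction rule: zeq.induct)
  case (refl l)
  then show ?case by (intro zeq.refl) (auto simp: zpath_append)
next
  case (move m m' r s)
  have "zeq C W u v ((p @ r) @ m @ (s @ q)) ((p @ r) @ m' @ (s @ q))"
    using move by (intro zeq.move) (auto simp: zpath_append)
  then show ?case by simp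
qed (blast intro: zeq.sym zeq.trans)+

lemma zeq_append:
  assumes "zeq C W x y l l'" "zeq C W y v m m'"
  shows "zeq C W x v (l @ m) (l' @ m')"
proof -
  have "zeq C W x v ([] @ l @ m) ([] @ l' @ m)"
    using assms zeq_zpath zpath_objs by (intro zeq_in_context) (auto, blast+)
  moreover have "zeq C W x v (l' @ m @ []) (l' @ m' @ [])"
    using assms zeq_zpath zpath_objs by (intro zeq_in_context) (auto, blast+)
  ultimately show ?thesis by (auto intro: zeq.trans)
qed

lemma zcls_eq: "zeq C W x y l l' \<Longrightarrow> zcls C W x y l = zcls C W x y l'"
  unfolding zcls_def by (auto intro: zeq.trans zeq.sym)

lemma cmp_loc_cat:
  assumes "zpath C W l x y" "zpath C W m y v"
  shows "cmp (loc_cat C W) (y, zcls C W y v m, v) (x, zcls C W x y l, y) = (x, zcls C W x v (l @ m), v)"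
proof -
  have "zcls C W x v (a @ b) = zcls C W x v (l @ m)"
    if "a \<in> zcls C W x y l" "b \<in> zcls C W y v m" for a b
    using that zcls_eq zeq_append by (metis mem_Collect_eq zcls_def)
  moreover have "l \<in> zcls C W x y l" "m \<in> zcls C W y v m"
    using assms by (auto simp: zcls_def intro: zeq.refl)
  ultimately have "(\<Union>a\<in>zcls C W x y l. \<Union>b\<in>zcls C W y v m. zcls C W x v (a @ b)) = zcls C W x v (l @ m)"
    by blast
  then show ?thesis by (simp add: loc_cat_def)
qed

lemma zpath_Fwd: "f \<in> arr C \<Longrightarrow> zpath C W [Fwd f] (src C f) (tgt C f)"
  by (simp add: tgt_obj)

lemma zeq_Fwd_Fwd:
  assumes "f \<in> arr C" "g \<in> arr C" "tgt C f = src C g"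
  shows "zeq C W (src C f) (tgt C g) [Fwd f, Fwd g] [Fwd (cmp C g f)]"
  using zeq.move[of C W "[Fwd f, Fwd g]" "[Fwd (cmp C g f)]" "[]" "[]"] assms
  by (auto simp: zmove.comp cmp_arr src_cmp tgt_cmp tgt_obj)

lemma zeq_Fwd_idt:
  assumes "x \<in> obj C"
  shows "zeq C W x x [Fwd (idt C x)] []"
  using zeq.move[of C W "[Fwd (idt C x)]" "[]" "[]" "[]" x x] assms
  by (auto simp: zmove.idt idt_arr src_idt tgt_idt)

lemma loc_functor_arr: 
  assumes "f \<in> arr C"
  shows "far (loc_functor C W) f \<in> arr (loc_cat C W)"
    "src (loc_cat C W) (far (loc_functor C W) f) = src C f"
    "tgt (loc_cat C W) (far (loc_functor C W) f) = tgt C f"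
  using zpath_Fwd[OF assms] unfolding loc_cat_def loc_functor_def by auto

lemma loc_functor_cmp:
  assumes "f \<in> arr C" "g \<in> arr C" "tgt C f = src C g"
  shows "far (loc_functor C W) (cmp C g f) =
    cmp (loc_cat C W) (far (loc_functor C W) g) (far (loc_functor C W) f)"
proof -
  have "cmp (loc_cat C W) (far (loc_functor C W) g) (far (loc_functor C W) f)
      = (src C f, zcls C W (src C f) (tgt C g) ([Fwd f] @ [Fwd g]), tgt C g)"
    unfolding loc_functor_def using cmp_loc_cat assms zpath_Fwd by (simp add: assms(3)[symmetric])
  then show ?thesis
    using zcls_eq[OF zeq_Fwd_Fwd[OF assms]] assms by (simp add: loc_functor_def src_cmp tgt_cmp)
qed

lemma loc_functor_idt:
  "x \<in> obj C \<Longrightarrow> far (loc_functor C W) (idt C x) = idt (loc_cat C W) x"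
  unfolding loc_cat_def loc_functor_def by (simp add: src_idt tgt_idt zcls_eq[OF zeq_Fwd_idt])

lemma is_iso_loc_functor:
  assumes "is_iso C f"
  shows "is_iso (loc_cat C W) (far (loc_functor C W) f)"
proof -
  obtain g where g: "f \<in> arr C" "g \<in> arr C" "src C g = tgt C f" "tgt C g = src C f"
     "cmp C g f = idt C (src C f)" "cmp C f g = idt C (tgt C f)"
    using assms by (auto simp: is_iso_def)
  let ?F = "far (loc_functor C W)"
  have "cmp (loc_cat C W) (?F g) (?F f) = idt (loc_cat C W) (src C f)"
    "cmp (loc_cat C W) (?F f) (?F g) = idt (loc_cat C W) (tgt C f)"
    using g by (simp_all flip: loc_functor_cmp loc_functor_idt add: src_obj tgt_obj)
  then show ?thesis
    unfolding is_iso_def using g loc_functor_arr[of f] loc_functor_arr[of g]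
    by (auto intro!: bexI[of _ "?F g"])
qed

text \<open>A zigzag out of an initial object can be contracted from its source end: the unique arrow
  into the current vertex absorbs the next arrow, and it factors through the next formal inverse.\<close>

lemma zeq_from_initial:
  assumes init: "\<And>x. x \<in> obj C \<Longrightarrow> \<exists>!f. f \<in> arr C \<and> src C f = o0 \<and> tgt C f = x"
    and "zpath C W l o0 y" and f: "f \<in> arr C" "src C f = o0" "tgt C f = y"
  shows "zeq C W o0 y l [Fwd f]"
  using assms(2) f
proof (induction l arbitrary: y f rule: rev_induct)
  case Nil
  have "f = idt C o0" using init[of o0] Nil idt_arr src_idt tgt_idt by auto
  then show ?case using zeq_Fwd_idt[of o0] Nil by (auto intro: zeq.sym)
next
  case (snoc s l)
  then obtain v where v: "zpath C W l o0 v" "zpath C W [s] v y" by (auto simp: zpath_append)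
  have "v \<in> obj C" using v zpath_objs by blast
  then obtain g where g: "g \<in> arr C" "src C g = o0" "tgt C g = v" using init by blast
  have lg: "zeq C W o0 v l [Fwd g]" using snoc.IH v g by blast
  show ?case
  proof (cases s)
    case (Fwd h)
    then have h: "h \<in> arr C" "src C h = v" "tgt C h = y" using v by auto
    have "cmp C h g = f"
      using init[of y] snoc.prems h g cmp_arr src_cmp tgt_cmp tgt_obj
      by (metis (no_types, lifting))
    moreover have "zeq C W o0 y (l @ [s]) ([Fwd g] @ [s])"
      using lg v(2) by (intro zeq_append) (auto intro: zeq.refl)
    ultimately show ?thesis
      using zeq_Fwd_Fwd[of g h] g h Fwd by (auto intro: zeq.trans)
  next
    case (Inv h)
    then have h: "h \<in> arr C" "h \<in> W" "src C h = y" "tgt C h = v" using v by auto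
    have "cmp C h f = g"
      using init[of v] snoc.prems h g cmp_arr src_cmp tgt_cmp \<open>v \<in> obj C\<close>
      by (metis (no_types, lifting))
    then have "zeq C W o0 v [Fwd f, Fwd h] [Fwd g]"
      using zeq_Fwd_Fwd[of f h] snoc.prems h by auto
    then have "zeq C W o0 v l [Fwd f, Fwd h]" using lg by (blast intro: zeq.trans zeq.sym)
    then have "zeq C W o0 y (l @ [s]) ([Fwd f, Fwd h] @ [s])"
      using v(2) by (intro zeq_append) (auto intro: zeq.refl)
    moreover have "zeq C W o0 y ([Fwd f] @ [Fwd h, Inv h] @ []) ([Fwd f] @ [] @ [])"
      using h snoc.prems src_obj[OF h(1)] tgt_obj by (intro zeq.move) (auto intro: zmove.intros)
    ultimately show ?thesis using Inv by (auto intro: zeq.trans)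
  qed
qed

lemma zeq_to_terminal:
  assumes final: "\<And>x. x \<in> obj C \<Longrightarrow> \<exists>!f. f \<in> arr C \<and> src C f = x \<and> tgt C f = o0"
    and "zpath C W l y o0" and f: "f \<in> arr C" "src C f = y" "tgt C f = o0"
  shows "zeq C W y o0 l [Fwd f]"
  using assms(2) f
proof (induction l arbitrary: y f)
  case Nil
  have "f = idt C o0" using final[of o0] Nil idt_arr src_idt tgt_idt by auto
  then show ?case using zeq_Fwd_idt[of o0] Nil by (auto intro: zeq.sym)
next
  case (Cons s l)
  then obtain v where v: "zpath C W [s] y v" "zpath C W l v o0"
    using zpath_append[of W "[s]" l y o0] by auto
  have "v \<in> obj C" "y \<in> obj C" using v zpath_objs by blast+
  then obtain g where g: "g \<in> arr C" "src C g = v" "tgt C g = o0" using final by blast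
  have lg: "zeq C W v o0 l [Fwd g]" using Cons.IH v g by blast
  show ?case
  proof (cases s)
    case (Fwd h)
    then have h: "h \<in> arr C" "src C h = y" "tgt C h = v" using v by auto
    have "cmp C g h = f"
      using final[of y] Cons.prems h g cmp_arr src_cmp tgt_cmp \<open>y \<in> obj C\<close>
      by (metis (no_types, lifting))
    moreover have "zeq C W y o0 ([s] @ l) ([s] @ [Fwd g])"
      using lg v(1) by (intro zeq_append) (auto intro: zeq.refl)
    ultimately show ?thesis
      using zeq_Fwd_Fwd[of h g] g h Fwd by (auto intro: zeq.trans)
  next
    case (Inv h)
    then have h: "h \<in> arr C" "h \<in> W" "src C h = v" "tgt C h = y" using v by auto
    have "cmp C f h = g"
      using final[of v] Cons.prems h g cmp_arr src_cmp tgt_cmp \<open>v \<in> obj C\<close>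
      by (metis (no_types, lifting))
    then have "zeq C W v o0 [Fwd h, Fwd f] [Fwd g]"
      using zeq_Fwd_Fwd[of h f] Cons.prems h by auto
    then have "zeq C W v o0 l [Fwd h, Fwd f]" using lg by (blast intro: zeq.trans zeq.sym)
    then have "zeq C W y o0 ([s] @ l) ([s] @ [Fwd h, Fwd f])"
      using v(1) by (intro zeq_append) (auto intro: zeq.refl)
    moreover have "zeq C W y o0 ([] @ [Inv h, Fwd h] @ [Fwd f]) ([] @ [] @ [Fwd f])"
      using h Cons.prems tgt_obj[OF h(1)] tgt_obj by (intro zeq.move) (auto intro: zmove.intros)
    ultimately show ?thesis using Inv by (auto intro: zeq.trans)
  qed
qed

text \<open>The class of the unique arrow of \<open>C\<close> is the only class of zigzags into or out of a zero object.\<close>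

lemma zero_obj_loc_cat:
  assumes "zero_obj C o0"
  shows "zero_obj (loc_cat C W) o0"
proof -
  have o0: "o0 \<in> obj C"
    and init: "\<And>x. x \<in> obj C \<Longrightarrow> \<exists>!f. f \<in> arr C \<and> src C f = o0 \<and> tgt C f = x"
    and final: "\<And>x. x \<in> obj C \<Longrightarrow> \<exists>!f. f \<in> arr C \<and> src C f = x \<and> tgt C f = o0"
    using assms by (auto simp: zero_obj_def)
  let ?L = "loc_cat C W" and ?F = "far (loc_functor C W)"
  have "\<exists>!g. g \<in> arr ?L \<and> src ?L g = o0 \<and> tgt ?L g = x" if x: "x \<in> obj C" for x
  proof -
    obtain f where f: "f \<in> arr C" "src C f = o0" "tgt C f = x" using init[OF x] by blast
    have "g = ?F f" if "g \<in> arr ?L" "src ?L g = o0" "tgt ?L g = x" for g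
      using that f zcls_eq[OF zeq_from_initial[OF init]]
      by (fastforce simp: loc_cat_def loc_functor_def)
    then show ?thesis using loc_functor_arr[OF f(1)] f by metis
  qed
  moreover have "\<exists>!g. g \<in> arr ?L \<and> src ?L g = x \<and> tgt ?L g = o0" if x: "x \<in> obj C" for x
  proof -
    obtain f where f: "f \<in> arr C" "src C f = x" "tgt C f = o0" using final[OF x] by blast
    have "g = ?F f" if "g \<in> arr ?L" "src ?L g = x" "tgt ?L g = o0" for g
      using that f zcls_eq[OF zeq_to_terminal[OF final]]
      by (fastforce simp: loc_cat_def loc_functor_def)
    then show ?thesis using loc_functor_arr[OF f(1)] f by metis
  qed
  ultimately show ?thesis using o0 by (auto simp: zero_obj_def loc_cat_def)
qed

lemma zero_arr_loc_functor:
  assumes "zero_arr C f"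
  shows "zero_arr (loc_cat C W) (far (loc_functor C W) f)"
proof -
  obtain o0 g h where *: "zero_obj C o0" "g \<in> arr C" "h \<in> arr C" "tgt C g = o0" "src C h = o0"
     "f = cmp C h g"
    using assms by (auto simp: zero_arr_def)
  show ?thesis unfolding zero_arr_def
    using * zero_obj_loc_cat[OF *(1)] loc_functor_arr[OF *(2)] loc_functor_arr[OF *(3)]
      loc_functor_cmp[of g h] by metis
qed

lemma is_bounded_complex_loc_functor:
  assumes "is_bounded_complex C K"
  shows "is_bounded_complex (loc_cat C W)
    \<lparr>cob = cob K, cdf = (\<lambda>i. far (loc_functor C W) (cdf K i))\<rparr>"
proof -
  have K: "\<And>i. cob K i \<in> obj C" "\<And>i. cdf K i \<in> arr C" "\<And>i. src C (cdf K i) = cob K i"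
    "\<And>i. tgt C (cdf K i) = cob K (i + 1)" "\<And>i. zero_arr C (cmp C (cdf K (i + 1)) (cdf K i))"
    "\<exists>N. \<forall>i. \<bar>i\<bar> > N \<longrightarrow> zero_obj C (cob K i)"
    using assms by (auto simp: is_bounded_complex_def)
  have "zero_arr (loc_cat C W) (cmp (loc_cat C W)
      (far (loc_functor C W) (cdf K (i + 1))) (far (loc_functor C W) (cdf K i)))" for i
    using zero_arr_loc_functor[OF K(5)[of i]] loc_functor_cmp[OF K(2) K(2), of i "i + 1"] K(3,4) by simp
  moreover have "\<exists>N. \<forall>i. \<bar>i\<bar> > N \<longrightarrow> zero_obj (loc_cat C W) (cob K i)"
    using K(6) zero_obj_loc_cat by metis
  moreover have "cob K i \<in> obj (loc_cat C W)" for i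
    using K(1) by (simp add: loc_cat_def)
  ultimately show ?thesis unfolding is_bounded_complex_def
    using K(3,4) loc_functor_arr[OF K(2)] by simp
qed

text \<open>The derived category localizes this category, so isomorphisms of complexes become isomorphisms there
  by \<open>is_iso_loc_functor\<close>.\<close>

lemma category_complexes: "category (complexes C)"
proof
  fix f g h
  { assume f: "f \<in> arr (complexes C)" "g \<in> arr (complexes C)" "tgt (complexes C) f = src (complexes C) g"
    then obtain K \<phi> L \<chi> M where fg: "f = (K, \<phi>, L)" "g = (L, \<chi>, M)" 
      by (cases f, cases g) (auto simp: complexes_def)
    have c: "is_chain_map C K \<phi> L" "is_chain_map C L \<chi> M" 
      and b: "is_bounded_complex C K" "is_bounded_complex C L" "is_bounded_complex C M"
      using f by (auto simp: fg complexes_def)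
    have dK: "cdf K i \<in> arr C \<and> src C (cdf K i) = cob K i \<and> tgt C (cdf K i) = cob K (i + 1)" for i
      using b by (auto simp: is_bounded_complex_def)
    have dL: "cdf L i \<in> arr C \<and> src C (cdf L i) = cob L i \<and> tgt C (cdf L i) = cob L (i + 1)" for i
      using b by (auto simp: is_bounded_complex_def)
    have dM: "cdf M i \<in> arr C \<and> src C (cdf M i) = cob M i \<and> tgt C (cdf M i) = cob M (i + 1)" for i
      using b by (auto simp: is_bounded_complex_def)
    have \<phi>: "\<phi> i \<in> arr C \<and> src C (\<phi> i) = cob K i \<and> tgt C (\<phi> i) = cob L i \<and>
        cmp C (cdf L i) (\<phi> i) = cmp C (\<phi> (i + 1)) (cdf K i)" for i
      using c by (auto simp: is_chain_map_def)
    have \<chi>: "\<chi> i \<in> arr C \<and> src C (\<chi> i) = cob L i \<and> tgt C (\<chi> i) = cob M i \<and>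
        cmp C (cdf M i) (\<chi> i) = cmp C (\<chi> (i + 1)) (cdf L i)" for i
      using c by (auto simp: is_chain_map_def)
    have "cmp C (cdf M i) (cmp C (\<chi> i) (\<phi> i)) = cmp C (cmp C (\<chi> (i + 1)) (\<phi> (i + 1))) (cdf K i)" for i
    proof -
      have "cmp C (cdf M i) (cmp C (\<chi> i) (\<phi> i)) = cmp C (cmp C (\<chi> (i + 1)) (cdf L i)) (\<phi> i)"
        using \<phi>[of i] \<chi>[of i] dM[of i] by (simp add: cmp_assoc)
      also have "\<dots> = cmp C (\<chi> (i + 1)) (cmp C (\<phi> (i + 1)) (cdf K i))"
        using \<phi>[of i] \<chi>[of "i + 1"] dL[of i] by (simp flip: cmp_assoc)
      also have "\<dots> = cmp C (cmp C (\<chi> (i + 1)) (\<phi> (i + 1))) (cdf K i)"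
        using \<phi>[of "i + 1"] \<chi>[of "i + 1"] dK[of i] by (simp add: cmp_assoc)
      finally show ?thesis .
    qed
    then have "is_chain_map C K (\<lambda>i. cmp C (\<chi> i) (\<phi> i)) M"
      using \<phi> \<chi> by (simp add: is_chain_map_def cmp_arr src_cmp tgt_cmp)
    then show "cmp (complexes C) g f \<in> arr (complexes C)"
      "src (complexes C) (cmp (complexes C) g f) = src (complexes C) f"
      "tgt (complexes C) (cmp (complexes C) g f) = tgt (complexes C) g"
      using b by (simp_all add: complexes_def fg) }
  { assume "f \<in> arr (complexes C)" "g \<in> arr (complexes C)" "h \<in> arr (complexes C)"
      "tgt (complexes C) f = src (complexes C) g" "tgt (complexes C) g = src (complexes C) h"
    then show "cmp (complexes C) h (cmp (complexes C) g f) = cmp (complexes C) (cmp (complexes C) h g) f"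
      by (cases f, cases g, cases h) (auto simp: complexes_def is_chain_map_def cmp_assoc) }
next
  fix f assume "f \<in> arr (complexes C)"
  then show "cmp (complexes C) (idt (complexes C) (tgt (complexes C) f)) f = f"
    "cmp (complexes C) f (idt (complexes C) (src (complexes C) f)) = f"
    by (auto simp: complexes_def is_chain_map_def fun_eq_iff)
      (metis cmp_idt_left cmp_idt_right)+
next
  fix K assume "K \<in> obj (complexes C)"
  then have K: "is_bounded_complex C K" by (simp add: complexes_def)
  then have "is_chain_map C K (\<lambda>i. idt C (cob K i)) K"
    unfolding is_chain_map_def is_bounded_complex_def
    by (metis cmp_idt_left cmp_idt_right idt_arr src_idt tgt_idt)
  then show "idt (complexes C) K \<in> arr (complexes C)" using K by (simp add: complexes_def)
qed (auto simp: complexes_def)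

end

section \<open>Central localization\<close>

text \<open>Evaluates the operations of \<open>loc_alg\<close>, which are unions over representatives, once they are known
  not to depend on the representatives.\<close>

lemma UN_pairs_eqI:
  assumes "(a0, m0) \<in> A" "(b0, l0) \<in> B"
    and "\<And>a m b l. (a, m) \<in> A \<Longrightarrow> (b, l) \<in> B \<Longrightarrow> F a m b l = K"
  shows "(\<Union>(a, m)\<in>A. \<Union>(b, l)\<in>B. F a m b l) = K"
proof -
  have "(\<Union>(a, m)\<in>A. \<Union>(b, l)\<in>B. F a m b l) = (\<Union>p\<in>A. \<Union>q\<in>B. K)"
    unfolding case_prod_beta using assms(3) by (intro SUP_cong refl) (simp_all add: assms(3))
  then show ?thesis using assms(1,2) by auto
qed

locale central_localization = ring R for R :: "('k, 'r) galg" (structure) +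
  fixes z :: 'r
  assumes z_closed [simp]: "z \<in> carrier R"
    and z_central: "a \<in> carrier R \<Longrightarrow> z \<otimes> a = a \<otimes> z"
begin

abbreviation "L \<equiv> loc_alg R z"
abbreviation "fraction a m \<equiv> Defs.frac R z a m"

lemma zpow_closed [simp]: "z [^] (k::nat) \<in> carrier R" by simp

lemma zpow_central: "a \<in> carrier R \<Longrightarrow> z [^] (k::nat) \<otimes> a = a \<otimes> z [^] k"
proof (induction k)
  case (Suc k)
  have "z [^] k \<otimes> z \<otimes> a = z [^] k \<otimes> a \<otimes> z" using Suc.prems by (simp add: m_assoc z_central)
  then show ?case using Suc by (simp add: m_assoc)
qed simp

lemma zpow_zpow: "a \<in> carrier R \<Longrightarrow> z [^] (k::nat) \<otimes> (z [^] (l::nat) \<otimes> a) = z [^] (k + l) \<otimes> a"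
  by (simp add: m_assoc[symmetric] nat_pow_mult)

lemma zpow_mult_mult:
  assumes "a \<in> carrier R" "b \<in> carrier R"
  shows "z [^] (k::nat) \<otimes> a \<otimes> (z [^] (l::nat) \<otimes> b) = z [^] (k + l) \<otimes> (a \<otimes> b)"
proof -
  have "z [^] k \<otimes> a \<otimes> (z [^] l \<otimes> b) = z [^] k \<otimes> (a \<otimes> z [^] l) \<otimes> b"
    using assms by (simp add: m_assoc)
  also have "\<dots> = z [^] k \<otimes> (z [^] l \<otimes> a) \<otimes> b" using assms by (simp add: zpow_central)
  also have "\<dots> = z [^] (k + l) \<otimes> (a \<otimes> b)" using assms by (simp add: zpow_zpow m_assoc)
  finally show ?thesis .
qed

text \<open>An equation between multiples by powers of \<open>z\<close> may be multiplied by a further power of \<open>z\<close>.\<close>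

lemma zpow_shift:
  assumes "z [^] (i::nat) \<otimes> a = z [^] (j::nat) \<otimes> b" "a \<in> carrier R" "b \<in> carrier R"
    "p + j = q + (i::nat)" "p \<ge> i"
  shows "z [^] p \<otimes> a = z [^] q \<otimes> b"
proof -
  have "z [^] p \<otimes> a = z [^] (p - i) \<otimes> (z [^] i \<otimes> a)" using assms(2,5) by (simp add: zpow_zpow)
  also have "\<dots> = z [^] (p - i) \<otimes> (z [^] j \<otimes> b)" using assms(1) by simp
  also have "\<dots> = z [^] q \<otimes> b"
  proof -
    have "p - i + j = q" using assms(4,5) by simp
    then show ?thesis using assms(3) by (simp add: zpow_zpow)
  qed
  finally show ?thesis .
qed

lemma mem_fraction:
  "a \<in> carrier R \<Longrightarrow> (b, l) \<in> fraction a m \<longleftrightarrow>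
    b \<in> carrier R \<and> (\<exists>k. z [^] (k + l) \<otimes> a = z [^] (k + m) \<otimes> b)"
  unfolding Defs.frac_def by (auto simp: zpow_zpow)

lemma fraction_eqI:
  assumes a: "a \<in> carrier R" "b \<in> carrier R" and k: "z [^] (k + l) \<otimes> a = z [^] (k + m) \<otimes> b"
  shows "fraction a m = fraction b l"
proof -
  have *: "fraction a m \<subseteq> fraction b l"
    if H: "a \<in> carrier R" "b \<in> carrier R" "z [^] (k + l) \<otimes> a = z [^] (k + m) \<otimes> b" for a b k l m
  proof
    fix x assume "x \<in> fraction a m"
    then obtain c p j where x: "x = (c, p)" "c \<in> carrier R" "z [^] (j + p) \<otimes> a = z [^] (j + m) \<otimes> c"
      using H by (cases x) (auto simp: mem_fraction)
    \<comment> \<open>a suitable power of \<open>z\<close> times \<open>a\<close> is the middle term between \<open>b\<close> and \<open>c\<close>\<close>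
    have "z [^] ((j + k + m) + p) \<otimes> b = z [^] (j + k + p + l) \<otimes> a"
      using H by (intro zpow_shift[OF H(3)[symmetric]]) auto
    also have "\<dots> = z [^] ((j + k + m) + l) \<otimes> c"
      using H x by (intro zpow_shift[OF x(3)]) auto
    finally show "x \<in> fraction b l" using H x by (auto simp: mem_fraction)
  qed
  show ?thesis using *[OF a k] *[OF a(2,1) k[symmetric]] by blast
qed

lemma fraction_self: "a \<in> carrier R \<Longrightarrow> (a, m) \<in> fraction a m"
  by (auto simp: mem_fraction)

lemma carrier_L: "s \<in> carrier L \<longleftrightarrow> (\<exists>a m. a \<in> carrier R \<and> s = fraction a m)"
  by (auto simp: loc_alg_def)

lemma fraction_closed [simp]: "a \<in> carrier R \<Longrightarrow> fraction a m \<in> carrier L"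
  by (auto simp: carrier_L)

lemma add_L:
  assumes a: "a \<in> carrier R" "b \<in> carrier R"
  shows "fraction a m \<oplus>\<^bsub>L\<^esub> fraction b l = fraction (z [^] l \<otimes> a \<oplus> z [^] m \<otimes> b) (m + l)"
proof -
  have "fraction (z [^] l' \<otimes> a' \<oplus> z [^] m' \<otimes> b') (m' + l') = fraction (z [^] l \<otimes> a \<oplus> z [^] m \<otimes> b) (m + l)"
    if a': "(a', m') \<in> fraction a m" and b': "(b', l') \<in> fraction b l" for a' m' b' l'
  proof -
    obtain k j where *: "a' \<in> carrier R" "z [^] (k + m') \<otimes> a = z [^] (k + m) \<otimes> a'"
      "b' \<in> carrier R" "z [^] (j + l') \<otimes> b = z [^] (j + l) \<otimes> b'"
      using a' b' a by (auto simp: mem_fraction)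
    have "z [^] (k + j + m' + l' + l) \<otimes> a = z [^] (k + j + m + l + l') \<otimes> a'"
      using * a by (intro zpow_shift[OF *(2)]) auto
    moreover have "z [^] (k + j + m' + l' + m) \<otimes> b = z [^] (k + j + m + l + m') \<otimes> b'"
      using * a by (intro zpow_shift[OF *(4)]) auto
    ultimately have "z [^] ((k + j) + (m + l)) \<otimes> (z [^] l' \<otimes> a' \<oplus> z [^] m' \<otimes> b') =
        z [^] ((k + j) + (m' + l')) \<otimes> (z [^] l \<otimes> a \<oplus> z [^] m \<otimes> b)"
      using * a by (simp add: r_distr zpow_zpow add.assoc)
    then show ?thesis using * a by (intro fraction_eqI) auto
  qed
  then show ?thesis unfolding loc_alg_def galg.simps ring.simps monoid.simps case_prod_beta
    by (rule UN_pairs_eqI[OF fraction_self[OF a(1)] fraction_self[OF a(2)], unfolded case_prod_beta])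
qed

lemma mult_L:
  assumes a: "a \<in> carrier R" "b \<in> carrier R"
  shows "fraction a m \<otimes>\<^bsub>L\<^esub> fraction b l = fraction (a \<otimes> b) (m + l)"
proof -
  have "fraction (a' \<otimes> b') (m' + l') = fraction (a \<otimes> b) (m + l)"
    if a': "(a', m') \<in> fraction a m" and b': "(b', l') \<in> fraction b l" for a' m' b' l'
  proof -
    obtain k j where *: "a' \<in> carrier R" "z [^] (k + m') \<otimes> a = z [^] (k + m) \<otimes> a'"
      "b' \<in> carrier R" "z [^] (j + l') \<otimes> b = z [^] (j + l) \<otimes> b'"
      using a' b' a by (auto simp: mem_fraction)
    have "z [^] ((k + j) + (m + l)) \<otimes> (a' \<otimes> b') = z [^] (k + m) \<otimes> a' \<otimes> (z [^] (j + l) \<otimes> b')"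
      using * by (simp add: zpow_mult_mult algebra_simps)
    also have "\<dots> = z [^] (k + m') \<otimes> a \<otimes> (z [^] (j + l') \<otimes> b)" using * by simp
    also have "\<dots> = z [^] ((k + j) + (m' + l')) \<otimes> (a \<otimes> b)"
      using a by (simp add: zpow_mult_mult algebra_simps)
    finally show ?thesis using * a by (intro fraction_eqI) auto
  qed
  then show ?thesis unfolding loc_alg_def galg.simps ring.simps monoid.simps case_prod_beta
    by (rule UN_pairs_eqI[OF fraction_self[OF a(1)] fraction_self[OF a(2)], unfolded case_prod_beta])
qed

lemma one_L: "\<one>\<^bsub>L\<^esub> = fraction \<one> 0" by (simp add: loc_alg_def)

lemma mult_L_closed: "s \<in> carrier L \<Longrightarrow> t \<in> carrier L \<Longrightarrow> s \<otimes>\<^bsub>L\<^esub> t \<in> carrier L"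
  by (auto simp: carrier_L mult_L) blast

lemma add_L_closed: "s \<in> carrier L \<Longrightarrow> t \<in> carrier L \<Longrightarrow> s \<oplus>\<^bsub>L\<^esub> t \<in> carrier L"
  using add_L fraction_closed by (fastforce simp: carrier_L)

lemma fraction_factor: "a \<in> carrier R \<Longrightarrow> fraction \<one> m \<otimes>\<^bsub>L\<^esub> fraction a 0 = fraction a m"
  by (simp add: mult_L)

lemma fraction_cancel: "a \<in> carrier R \<Longrightarrow> fraction (z [^] l \<otimes> a) (m + l) = fraction a m"
  by (rule fraction_eqI[of _ _ 0]) (auto simp: zpow_zpow)

lemma fraction_zpow_cancel:
  "fraction (z [^] m) 0 \<otimes>\<^bsub>L\<^esub> fraction a m = fraction a 0" if "a \<in> carrier R"
  using that fraction_cancel[of a m 0] by (simp add: mult_L)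

lemma hpart_L: "s \<in> hpart L d \<longleftrightarrow> (\<exists>a m. a \<in> hpart R (d + int m) \<and> s = fraction a m)"
  by (auto simp: loc_alg_def)

end

section \<open>Auxiliary facts on sets and rings\<close>

lemma lists_lepoll_infinite:
  assumes "infinite (UNIV :: 'k set)" "A \<lesssim> (UNIV :: 'k set)"
  shows "lists A \<lesssim> (UNIV :: 'k set)"
proof -
  obtain f :: "'k list \<Rightarrow> 'k" where "bij f"
    using lists_infinite_bij_betw_types[OF assms(1)] by blast
  then have "(UNIV :: 'k list set) \<lesssim> (UNIV :: 'k set)"
    by (auto simp: lepoll_def bij_def)
  then show ?thesis using lists_lepoll_mono[OF assms(2)] by (metis lepoll_trans lists_UNIV)
qed

lemma times_lepoll_infinite:
  assumes "infinite (UNIV :: 'k set)" "A \<lesssim> (UNIV :: 'k set)" "B \<lesssim> (UNIV :: 'k set)"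
  shows "A \<times> B \<lesssim> (UNIV :: 'k set)"
proof -
  obtain f g :: "_ \<Rightarrow> 'k" where "inj_on f A" "inj_on g B"
    using assms(2,3) by (auto simp: lepoll_def)
  then have "inj_on (\<lambda>(x, y). [f x, g y]) (A \<times> B)" by (auto simp: inj_on_def)
  then have "A \<times> B \<lesssim> lists (UNIV :: 'k set)" by (auto simp: lepoll_def)
  then show ?thesis using lists_lepoll_infinite[OF assms(1)] by (blast intro: lepoll_trans)
qed

lemma ring_extend:
  assumes "ring S" shows "ring (ring.extend S m)"
proof -
  interpret S: ring S by (rule assms)
  have "\<exists>y\<in>carrier S. y \<oplus>\<^bsub>S\<^esub> x = \<zero>\<^bsub>S\<^esub>" if "x \<in> carrier S" for x
    using that S.a_inv_closed S.l_neg by blast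
  then show ?thesis unfolding ring.extend_def
    by (intro ringI abelian_groupI monoidI)
      (simp_all add: S.a_ac S.m_assoc S.l_distr S.r_distr)
qed

text \<open>Finite sums of elements of the sets \<open>H d\<close>, as an inductive set: being generated by homogeneous
  elements can then be verified one summand at a time, without indexed families.\<close>

inductive_set homogeneous_sums :: "('u, 'z) ring_scheme \<Rightarrow> (int \<Rightarrow> 'u set) \<Rightarrow> 'u set"
  for M H where
  zero: "\<zero>\<^bsub>M\<^esub> \<in> homogeneous_sums M H"
| add: "x \<in> H d \<Longrightarrow> y \<in> homogeneous_sums M H \<Longrightarrow> x \<oplus>\<^bsub>M\<^esub> y \<in> homogeneous_sums M H"

section \<open>The free algebra\<close>

context
  fixes A :: "'x set" and F :: "('k::field, 'x list \<Rightarrow> 'k) galg"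
  defines "F \<equiv> free_alg A"
begin

lemma free_alg_simps:
  "carrier F = {f. finite {w. f w \<noteq> 0} \<and> {w. f w \<noteq> 0} \<subseteq> lists A}"
  "f \<otimes>\<^bsub>F\<^esub> g = (\<lambda>w. \<Sum>i\<le>length w. f (take i w) * g (drop i w))"
  "\<one>\<^bsub>F\<^esub> = wmon []"
  "\<zero>\<^bsub>F\<^esub> = (\<lambda>_. 0)"
  "f \<oplus>\<^bsub>F\<^esub> g = (\<lambda>w. f w + g w)"
  "scal F c = (\<lambda>w. c * wmon [] w)"
  "hpart F d = {f \<in> carrier F. \<forall>w. f w \<noteq> 0 \<longrightarrow> int (length w) = d}"
  by (auto simp: F_def free_alg_def Let_def)

lemma free_alg_carrierI: "finite S \<Longrightarrow> S \<subseteq> lists A \<Longrightarrow> {w. f w \<noteq> 0} \<subseteq> S \<Longrightarrow> f \<in> carrier F"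
  unfolding free_alg_simps by (auto intro: finite_subset)

lemma free_alg_mult_closed:
  assumes "f \<in> carrier F" "g \<in> carrier F" shows "f \<otimes>\<^bsub>F\<^esub> g \<in> carrier F"
proof -
  let ?S = "(\<lambda>(u, v). u @ v) ` ({w. f w \<noteq> 0} \<times> {w. g w \<noteq> 0})"
  have "{w. (f \<otimes>\<^bsub>F\<^esub> g) w \<noteq> 0} \<subseteq> ?S"
  proof
    fix w assume "w \<in> {w. (f \<otimes>\<^bsub>F\<^esub> g) w \<noteq> 0}"
    then obtain i where "f (take i w) * g (drop i w) \<noteq> 0"
      by (auto simp: free_alg_simps elim!: sum.not_neutral_contains_not_neutral)
    then show "w \<in> ?S" by (auto intro!: image_eqI[of _ _ "(take i w, drop i w)"])
  qed
  moreover have "finite ?S" "?S \<subseteq> lists A"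
    using assms by (auto simp: free_alg_simps subset_iff in_lists_conv_set)
  ultimately show ?thesis by (intro free_alg_carrierI)
qed

text \<open>Both sides sum over the ways of cutting the word into three pieces; only the order of summation
  differs.\<close>

lemma free_alg_mult_assoc: "(f \<otimes>\<^bsub>F\<^esub> g) \<otimes>\<^bsub>F\<^esub> h = f \<otimes>\<^bsub>F\<^esub> (g \<otimes>\<^bsub>F\<^esub> h)"
proof
  fix w :: "'x list"
  let ?n = "length w"
  let ?t = "\<lambda>i j. f (take i w) * g (take j (drop i w)) * h (drop (i + j) w)"
  have "((f \<otimes>\<^bsub>F\<^esub> g) \<otimes>\<^bsub>F\<^esub> h) w = (\<Sum>k\<le>?n. \<Sum>i\<le>k. ?t i (k - i))"
    by (auto simp: free_alg_simps sum_distrib_right min_def drop_take intro!: sum.cong)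
  also have "\<dots> = (\<Sum>(i, j)\<in>Sigma {..?n} (\<lambda>i. {..?n - i}). ?t i j)"
    by (subst sum.triangle_reindex_eq[symmetric]) (rule sum.cong, auto)
  also have "\<dots> = (\<Sum>i\<le>?n. \<Sum>j\<le>?n - i. ?t i j)" by (subst sum.Sigma) auto
  also have "\<dots> = (f \<otimes>\<^bsub>F\<^esub> (g \<otimes>\<^bsub>F\<^esub> h)) w"
    by (auto simp: free_alg_simps sum_distrib_left mult.assoc add.commute intro!: sum.cong)
  finally show "((f \<otimes>\<^bsub>F\<^esub> g) \<otimes>\<^bsub>F\<^esub> h) w = (f \<otimes>\<^bsub>F\<^esub> (g \<otimes>\<^bsub>F\<^esub> h)) w" .
qed

lemma wmon_closed: "w \<in> lists A \<Longrightarrow> wmon w \<in> carrier F"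
  by (rule free_alg_carrierI[of "{w}"]) (auto simp: wmon_def)

lemma scaled_wmon_closed: "w \<in> lists A \<Longrightarrow> (\<lambda>v. c * wmon w v) \<in> carrier F"
  by (rule free_alg_carrierI[of "{w}"]) (auto simp: wmon_def)

lemma wmon_Nil_mult: "(\<lambda>v. c * wmon [] v) \<otimes>\<^bsub>F\<^esub> f = (\<lambda>v. c * f v)"
proof
  fix w
  have "((\<lambda>v. c * wmon [] v) \<otimes>\<^bsub>F\<^esub> f) w = (\<Sum>i\<in>{0}. c * wmon [] (take i w) * f (drop i w))"
    unfolding free_alg_simps by (rule sum.mono_neutral_right) (auto simp: wmon_def)
  then show "((\<lambda>v. c * wmon [] v) \<otimes>\<^bsub>F\<^esub> f) w = c * f w" by (simp add: wmon_def)
qed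

lemma mult_wmon_Nil: "f \<otimes>\<^bsub>F\<^esub> (\<lambda>v. c * wmon [] v) = (\<lambda>v. c * f v)"
proof
  fix w
  have "(f \<otimes>\<^bsub>F\<^esub> (\<lambda>v. c * wmon [] v)) w = (\<Sum>i\<in>{length w}. f (take i w) * (c * wmon [] (drop i w)))"
    unfolding free_alg_simps by (rule sum.mono_neutral_right) (auto simp: wmon_def)
  then show "(f \<otimes>\<^bsub>F\<^esub> (\<lambda>v. c * wmon [] v)) w = c * f w" by (simp add: wmon_def)
qed

lemma wmon_mult: "wmon u \<otimes>\<^bsub>F\<^esub> wmon v = wmon (u @ v)"
proof
  fix w
  have "(wmon u \<otimes>\<^bsub>F\<^esub> wmon v) w =
      (\<Sum>i\<in>{..length w} \<inter> {length u}. wmon u (take i w) * wmon v (drop i w))"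
    unfolding free_alg_simps by (rule sum.mono_neutral_right) (auto simp: wmon_def)
  also have "\<dots> = wmon (u @ v) w"
    by (cases "length u \<le> length w") (auto simp: wmon_def append_eq_conv_conj, metis append_take_drop_id)
  finally show "(wmon u \<otimes>\<^bsub>F\<^esub> wmon v) w = wmon (u @ v) w" .
qed

lemma free_alg_add_closed:
  assumes "f \<in> carrier F" "g \<in> carrier F" shows "f \<oplus>\<^bsub>F\<^esub> g \<in> carrier F"
  using assms
  by (intro free_alg_carrierI[of "{w. f w \<noteq> 0} \<union> {w. g w \<noteq> 0}"]) (auto simp: free_alg_simps)

lemma ring_free_alg: "ring F"
proof (rule ringI)
  show "abelian_group F"
  proof (rule abelian_groupI)
    fix f assume "f \<in> carrier F"
    then have "(\<lambda>w. - f w) \<in> carrier F" "(\<lambda>w. - f w) \<oplus>\<^bsub>F\<^esub> f = \<zero>\<^bsub>F\<^esub>"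
      by (simp_all add: free_alg_simps)
    then show "\<exists>g\<in>carrier F. g \<oplus>\<^bsub>F\<^esub> f = \<zero>\<^bsub>F\<^esub>" by blast
  qed (auto simp: free_alg_add_closed, auto simp: free_alg_simps algebra_simps)
  show "Group.monoid F"
    using wmon_Nil_mult[of 1] mult_wmon_Nil[of _ 1]
    by (intro monoidI) (auto simp: free_alg_mult_closed free_alg_mult_assoc free_alg_simps(3) wmon_closed)
qed (auto simp: free_alg_simps sum.distrib algebra_simps)

text \<open>The support is removed word by word.\<close>

lemma free_alg_induct [consumes 1, case_names zero step]:
  assumes "f \<in> carrier F" and "P \<zero>\<^bsub>F\<^esub>"
    and step: "\<And>c w g. w \<in> lists A \<Longrightarrow> g \<in> carrier F \<Longrightarrow> P g \<Longrightarrow> P ((\<lambda>v. c * wmon w v) \<oplus>\<^bsub>F\<^esub> g)"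
  shows "P f"
proof -
  have "finite S \<Longrightarrow> S \<subseteq> lists A \<Longrightarrow> {w. f w \<noteq> 0} \<subseteq> S \<Longrightarrow> P f" for S f
  proof (induction S arbitrary: f rule: finite_induct)
    case empty
    then have "f = \<zero>\<^bsub>F\<^esub>" by (auto simp: free_alg_simps)
    then show ?case using assms(2) by simp
  next
    case (insert w S)
    have "{v. (f(w := 0)) v \<noteq> 0} \<subseteq> S" using insert.prems by auto
    then have "P (f(w := 0))" "f(w := 0) \<in> carrier F"
      using insert.IH insert.hyps(1) insert.prems(1) by (blast, intro free_alg_carrierI[of S]) auto
    then have "P ((\<lambda>v. f w * wmon w v) \<oplus>\<^bsub>F\<^esub> f(w := 0))"
      using step insert.prems by simp
    moreover have "(\<lambda>v. f w * wmon w v) \<oplus>\<^bsub>F\<^esub> f(w := 0) = f"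
      by (auto simp: free_alg_simps wmon_def)
    ultimately show ?case by simp
  qed
  then show ?thesis using assms(1) by (auto simp: free_alg_simps)
qed

lemma free_alg_homogeneous_sums: "f \<in> carrier F \<Longrightarrow> f \<in> homogeneous_sums F (hpart F)"
proof (induction rule: free_alg_induct)
  case (step c w g)
  then have "(\<lambda>v. c * wmon w v) \<in> hpart F (int (length w))"
    using scaled_wmon_closed[of w c] by (simp add: free_alg_simps(7)) (simp add: wmon_def)
  then show ?case using step by (blast intro: homogeneous_sums.add)
qed (rule homogeneous_sums.zero)

text \<open>An element is recorded by the finite list of its nonzero coefficients.\<close>

lemma free_alg_lepoll:
  assumes "infinite (UNIV :: 'k set)" "A \<lesssim> (UNIV :: 'k set)"
  shows "carrier F \<lesssim> (UNIV :: 'k set)"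
proof -
  let ?f = "\<lambda>l w. case map_of l w of None \<Rightarrow> 0 | Some c \<Rightarrow> c"
  have "carrier F \<subseteq> ?f ` lists (lists A \<times> (UNIV :: 'k set))"
  proof
    fix g assume g: "g \<in> carrier F"
    then obtain l where l: "set l = {w. g w \<noteq> 0}" using finite_list[of "{w. g w \<noteq> 0}"] by (auto simp: free_alg_simps)
    have "g = ?f (map (\<lambda>w. (w, g w)) l)"
      using l by (auto simp: map_of_map_restrict restrict_map_def fun_eq_iff)
    moreover have "map (\<lambda>w. (w, g w)) l \<in> lists (lists A \<times> UNIV)"
      using l g by (auto simp: free_alg_simps)
    ultimately show "g \<in> ?f ` lists (lists A \<times> UNIV)" by blast
  qed
  moreover have "lists (lists A \<times> (UNIV :: 'k set)) \<lesssim> (UNIV :: 'k set)"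
    using assms by (intro lists_lepoll_infinite times_lepoll_infinite) auto
  ultimately show ?thesis by (meson subset_image_lepoll lepoll_trans)
qed

end

section \<open>The homogeneous G-algebra\<close>

context
  fixes n :: nat and b :: "nat \<Rightarrow> nat \<Rightarrow> 'k::field_char_0" and c :: "nat \<Rightarrow> nat \<Rightarrow> nat \<Rightarrow> 'k"
    and d :: "nat \<Rightarrow> nat \<Rightarrow> 'k"
begin

(* keeps the index set of the alphabet in the form {1..n} of the definitions *)
declare One_nat_def [simp del]

abbreviation (input) "BF \<equiv> (free_alg (insert Z (X ` {1..n})) :: ('k, gvar list \<Rightarrow> 'k) galg)"
abbreviation (input) "BI \<equiv> B_ideal n b c d"
abbreviation (input) "BB \<equiv> B_alg n b c d"

lemma B_rels_closed: "B_rels n b c d \<subseteq> carrier BF"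
proof
  fix f assume "f \<in> B_rels n b c d"
  then consider i j where "1 \<le> j" "j < i" "i \<le> n"
      "f = (\<lambda>w. wmon [X i, X j] w - b i j * wmon [X j, X i] w
           + (\<Sum>k=1..n. c i j k * wmon [Z, X k] w) + d i j * wmon [Z, Z] w)"
    | i where "1 \<le> i" "i \<le> n" "f = (\<lambda>w. wmon [X i, Z] w - wmon [Z, X i] w)"
    by (auto simp: B_rels_def)
  then show "f \<in> carrier BF"
  proof cases
    case 1
    have "{w. f w \<noteq> 0} \<subseteq> {[X i, X j], [X j, X i], [Z, Z]} \<union> (\<lambda>k. [Z, X k]) ` {1..n}"
    proof (intro subsetI, rule ccontr)
      fix w assume w: "w \<in> {w. f w \<noteq> 0}"
        "w \<notin> {[X i, X j], [X j, X i], [Z, Z]} \<union> (\<lambda>k. [Z, X k]) ` {1..n}"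
      have "(\<Sum>k=1..n. c i j k * wmon [Z, X k] w) = 0"
        by (rule sum.neutral) (use w in \<open>auto simp: wmon_def\<close>)
      then show False using w unfolding 1 by (auto simp: wmon_def)
    qed
    then show ?thesis using 1 by (rule_tac free_alg_carrierI) auto
  next
    case 2
    then show ?thesis by (intro free_alg_carrierI[of "{[X i, Z], [Z, X i]}"]) (auto simp: wmon_def)
  qed
qed

lemma ideal_B_ideal: "ideal BI BF"
  unfolding B_ideal_def using ring.genideal_ideal[OF ring_free_alg B_rels_closed] .

lemma ring_B_alg: "ring BB"
  unfolding B_alg_def quot_alg_def by (intro ring_extend ideal.quotient_is_ring ideal_B_ideal)

lemma B_alg_carrier: "carrier BB = (\<lambda>f. BI +>\<^bsub>BF\<^esub> f) ` carrier BF"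
  by (auto simp: B_alg_def quot_alg_def ring.extend_def FactRing_def A_RCOSETS_def')

lemma B_alg_hom:
  shows B_alg_mult: "f \<in> carrier BF \<Longrightarrow> g \<in> carrier BF \<Longrightarrow>
      (BI +>\<^bsub>BF\<^esub> f) \<otimes>\<^bsub>BB\<^esub> (BI +>\<^bsub>BF\<^esub> g) = BI +>\<^bsub>BF\<^esub> (f \<otimes>\<^bsub>BF\<^esub> g)"
    and B_alg_add: "f \<in> carrier BF \<Longrightarrow> g \<in> carrier BF \<Longrightarrow>
      (BI +>\<^bsub>BF\<^esub> f) \<oplus>\<^bsub>BB\<^esub> (BI +>\<^bsub>BF\<^esub> g) = BI +>\<^bsub>BF\<^esub> (f \<oplus>\<^bsub>BF\<^esub> g)"
    and B_alg_one: "\<one>\<^bsub>BB\<^esub> = BI +>\<^bsub>BF\<^esub> \<one>\<^bsub>BF\<^esub>"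
  using ideal.rcos_ring_hom[OF ideal_B_ideal]
  by (simp_all add: B_alg_def quot_alg_def ring.extend_def ring_hom_def)

lemma B_alg_zero: "\<zero>\<^bsub>BB\<^esub> = BI +>\<^bsub>BF\<^esub> \<zero>\<^bsub>BF\<^esub>"
  using ring_hom_zero[OF ideal.rcos_ring_hom[OF ideal_B_ideal] ring_free_alg
      ideal.quotient_is_ring[OF ideal_B_ideal]]
  by (simp add: B_alg_def quot_alg_def ring.extend_def)

lemma B_alg_hpart: "hpart BB e = (\<lambda>f. BI +>\<^bsub>BF\<^esub> f) ` hpart BF e"
  by (simp add: B_alg_def quot_alg_def ring.extend_def galg.defs)

lemma B_hpartI: "f \<in> hpart BF e \<Longrightarrow> BI +>\<^bsub>BF\<^esub> f \<in> hpart BB e"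
  unfolding B_alg_hpart by (rule imageI)

lemma B_Z_closed: "B_Z n b c d \<in> carrier BB"
  unfolding B_alg_carrier B_Z_def by (intro imageI wmon_closed) auto

lemma B_Z_commutes_letter:
  assumes "x \<in> insert Z (X ` {1..n})"
  shows "B_Z n b c d \<otimes>\<^bsub>BB\<^esub> (BI +>\<^bsub>BF\<^esub> wmon [x]) = (BI +>\<^bsub>BF\<^esub> wmon [x]) \<otimes>\<^bsub>BB\<^esub> B_Z n b c d"
proof (cases x)
  case (X i)
  then have i: "1 \<le> i" "i \<le> n" using assms by auto
  interpret I: ideal BI BF by (rule ideal_B_ideal)
  let ?r = "\<lambda>w. wmon [X i, Z] w - wmon [Z, X i] w"
  have "?r \<in> BI"
    unfolding B_ideal_def using i
    by (intro subsetD[OF I.genideal_self[OF B_rels_closed]]) (auto simp: B_rels_def)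
  moreover have w: "wmon [X i, Z] \<in> carrier BF" "wmon [Z, X i] \<in> carrier BF"
    "wmon [X i] \<in> carrier BF" "wmon [Z] \<in> carrier BF"
    using i by (auto intro!: wmon_closed)
  moreover have "wmon [X i, Z] = ?r \<oplus>\<^bsub>BF\<^esub> wmon [Z, X i]" by (simp add: free_alg_simps)
  ultimately have "wmon [X i, Z] \<in> BI +>\<^bsub>BF\<^esub> wmon [Z, X i]"
    by (auto simp: a_r_coset_def')
  then have "BI +>\<^bsub>BF\<^esub> wmon [X i, Z] = BI +>\<^bsub>BF\<^esub> wmon [Z, X i]"
    using I.a_repr_independence' w by metis
  then show ?thesis using w by (simp add: X B_Z_def B_alg_mult wmon_mult)
qed (simp add: B_Z_def)

text \<open>The centralizer of \<open>Z\<close> contains the letters, by the defining relations, and the scalars, and it is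
  closed under products and sums.\<close>

lemma B_Z_central:
  assumes "a \<in> carrier BB"
  shows "B_Z n b c d \<otimes>\<^bsub>BB\<^esub> a = a \<otimes>\<^bsub>BB\<^esub> B_Z n b c d"
proof -
  interpret B: ring BB by (rule ring_B_alg)
  interpret F: ring BF by (rule ring_free_alg)
  let ?z = "B_Z n b c d" and ?\<pi> = "\<lambda>f. BI +>\<^bsub>BF\<^esub> f"
  note [simp] = B_Z_closed
  have \<pi>: "?\<pi> f \<in> carrier BB" if "f \<in> carrier BF" for f using that by (simp add: B_alg_carrier)
  have zF: "wmon [Z] \<in> carrier BF" by (intro wmon_closed) auto
  have commutes_mult: "?z \<otimes>\<^bsub>BB\<^esub> (x \<otimes>\<^bsub>BB\<^esub> y) = (x \<otimes>\<^bsub>BB\<^esub> y) \<otimes>\<^bsub>BB\<^esub> ?z"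
    if "x \<in> carrier BB" "y \<in> carrier BB" "?z \<otimes>\<^bsub>BB\<^esub> x = x \<otimes>\<^bsub>BB\<^esub> ?z"
      "?z \<otimes>\<^bsub>BB\<^esub> y = y \<otimes>\<^bsub>BB\<^esub> ?z" for x y
    using that B_Z_closed by (metis B.m_assoc)
  have word: "?z \<otimes>\<^bsub>BB\<^esub> ?\<pi> (wmon w) = ?\<pi> (wmon w) \<otimes>\<^bsub>BB\<^esub> ?z"
    if "w \<in> lists (insert Z (X ` {1..n}))" for w
    using that
  proof (induction w)
    case Nil
    show ?case by (simp flip: B_alg_one free_alg_simps(3)[where A = "insert Z (X ` {1..n})"])
  next
    case (Cons x w)
    have c: "wmon [x] \<in> carrier BF" "wmon w \<in> carrier BF" using Cons by (auto intro!: wmon_closed)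
    have e: "?\<pi> (wmon (x # w)) = ?\<pi> (wmon [x]) \<otimes>\<^bsub>BB\<^esub> ?\<pi> (wmon w)"
      using c by (simp add: B_alg_mult wmon_mult)
    have x: "?z \<otimes>\<^bsub>BB\<^esub> ?\<pi> (wmon [x]) = ?\<pi> (wmon [x]) \<otimes>\<^bsub>BB\<^esub> ?z"
      by (rule B_Z_commutes_letter) (use Cons.hyps in simp)
    have IH: "?z \<otimes>\<^bsub>BB\<^esub> ?\<pi> (wmon w) = ?\<pi> (wmon w) \<otimes>\<^bsub>BB\<^esub> ?z" by fact
    show ?case unfolding e by (rule commutes_mult[OF \<pi>[OF c(1)] \<pi>[OF c(2)] x IH])
  qed
  obtain f where f: "f \<in> carrier BF" "a = ?\<pi> f" using assms by (auto simp: B_alg_carrier)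
  have "?z \<otimes>\<^bsub>BB\<^esub> ?\<pi> f = ?\<pi> f \<otimes>\<^bsub>BB\<^esub> ?z"
    using f(1)
  proof (induction rule: free_alg_induct)
    case zero
    show ?case by (simp flip: B_alg_zero)
  next
    case (step e w g)
    let ?e = "\<lambda>v. e * wmon [] v"
    have c: "?e \<in> carrier BF" "wmon w \<in> carrier BF" "(\<lambda>v. e * wmon w v) \<in> carrier BF"
      using step by (auto intro!: wmon_closed scaled_wmon_closed)
    have "?\<pi> (\<lambda>v. e * wmon w v) = ?\<pi> ?e \<otimes>\<^bsub>BB\<^esub> ?\<pi> (wmon w)"
      using c by (simp add: B_alg_mult wmon_Nil_mult)
    moreover have "?z \<otimes>\<^bsub>BB\<^esub> ?\<pi> ?e = ?\<pi> ?e \<otimes>\<^bsub>BB\<^esub> ?z"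
      using c zF by (simp add: B_Z_def B_alg_mult wmon_Nil_mult mult_wmon_Nil)
    ultimately have "?z \<otimes>\<^bsub>BB\<^esub> ?\<pi> (\<lambda>v. e * wmon w v) = ?\<pi> (\<lambda>v. e * wmon w v) \<otimes>\<^bsub>BB\<^esub> ?z"
      using commutes_mult[OF \<pi>[OF c(1)] \<pi>[OF c(2)] _ word[OF step.hyps(1)]] by simp
    then show ?case using step c \<pi> by (simp add: B.l_distr B.r_distr flip: B_alg_add)
  qed
  then show ?thesis using f by simp
qed

lemma B_Z_hpart: "B_Z n b c d \<in> hpart BB 1"
  unfolding B_alg_hpart B_Z_def
  by (intro imageI) (auto simp: free_alg_simps(7) wmon_closed, simp add: wmon_def split: if_splits)

lemma B_one_hpart: "\<one>\<^bsub>BB\<^esub> \<in> hpart BB 0"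
  unfolding B_alg_hpart B_alg_one free_alg_simps(3)
  by (intro imageI) (auto simp: free_alg_simps(7) wmon_closed, simp add: wmon_def split: if_splits)

lemma B_hpart_closed: "hpart BB e \<subseteq> carrier BB"
  unfolding B_alg_hpart B_alg_carrier free_alg_simps(7) by blast

lemma B_homogeneous_sums: "a \<in> carrier BB \<Longrightarrow> a \<in> homogeneous_sums BB (hpart BB)"
proof -
  have "BI +>\<^bsub>BF\<^esub> f \<in> homogeneous_sums BB (hpart BB) \<and> f \<in> carrier BF"
    if "f \<in> homogeneous_sums BF (hpart BF)" for f
    using that
  proof induction
    case zero
    interpret F: ring BF by (rule ring_free_alg)
    show ?case by (simp add: homogeneous_sums.zero flip: B_alg_zero)
  next
    case (add f e g)
    then have "f \<in> carrier BF" by (simp add: free_alg_simps(7))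
    moreover have "(BI +>\<^bsub>BF\<^esub> f) \<oplus>\<^bsub>BB\<^esub> (BI +>\<^bsub>BF\<^esub> g) \<in> homogeneous_sums BB (hpart BB)"
      using homogeneous_sums.add[OF _ conjunct1[OF add.IH]] add.hyps(1) by (blast intro: B_hpartI)
    ultimately show ?case using add.IH by (simp add: B_alg_add free_alg_add_closed)
  qed
  moreover assume "a \<in> carrier BB"
  ultimately show ?thesis using free_alg_homogeneous_sums by (auto simp: B_alg_carrier)
qed

lemma B_lepoll: "carrier BB \<lesssim> (UNIV :: 'k set)"
proof -
  have "inj (case_gvar (\<lambda>i. of_nat (Suc i) :: 'k) 0)"
    by (auto simp: inj_def simp del: of_nat_Suc split: gvar.splits)
  then have "(UNIV :: gvar set) \<lesssim> (UNIV :: 'k set)" unfolding lepoll_def by blast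
  then have "insert Z (X ` {1..n}) \<lesssim> (UNIV :: 'k set)"
    using lepoll_trans[OF subset_imp_lepoll[OF subset_UNIV]] by blast
  then have "carrier BF \<lesssim> (UNIV :: 'k set)"
    by (intro free_alg_lepoll infinite_UNIV_char_0)
  then show ?thesis unfolding B_alg_carrier by (meson image_lepoll lepoll_trans)
qed

lemma central_localization_B: "central_localization BB (B_Z n b c d)"
  by (intro central_localization.intro ring_B_alg central_localization_axioms.intro
      B_Z_closed B_Z_central)

declare One_nat_def [simp]

end

section \<open>Graded modules\<close>

lemma left_moduleD:
  assumes "left_module R M"
  shows "abelian_group M"
    and "a \<in> carrier R \<Longrightarrow> x \<in> carrier M \<Longrightarrow> a \<odot>\<^bsub>M\<^esub> x \<in> carrier M"
    and "a \<in> carrier R \<Longrightarrow> b \<in> carrier R \<Longrightarrow> x \<in> carrier M \<Longrightarrow>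
      (a \<oplus>\<^bsub>R\<^esub> b) \<odot>\<^bsub>M\<^esub> x = a \<odot>\<^bsub>M\<^esub> x \<oplus>\<^bsub>M\<^esub> b \<odot>\<^bsub>M\<^esub> x"
    and "a \<in> carrier R \<Longrightarrow> x \<in> carrier M \<Longrightarrow> y \<in> carrier M \<Longrightarrow>
      a \<odot>\<^bsub>M\<^esub> (x \<oplus>\<^bsub>M\<^esub> y) = a \<odot>\<^bsub>M\<^esub> x \<oplus>\<^bsub>M\<^esub> a \<odot>\<^bsub>M\<^esub> y"
    and "a \<in> carrier R \<Longrightarrow> b \<in> carrier R \<Longrightarrow> x \<in> carrier M \<Longrightarrow>
      (a \<otimes>\<^bsub>R\<^esub> b) \<odot>\<^bsub>M\<^esub> x = a \<odot>\<^bsub>M\<^esub> (b \<odot>\<^bsub>M\<^esub> x)"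
    and "x \<in> carrier M \<Longrightarrow> \<one>\<^bsub>R\<^esub> \<odot>\<^bsub>M\<^esub> x = x"
  using assms by (auto simp: left_module_def)

lemma left_module_smult_zero:
  assumes "left_module R M" "a \<in> carrier R" shows "a \<odot>\<^bsub>M\<^esub> \<zero>\<^bsub>M\<^esub> = \<zero>\<^bsub>M\<^esub>"
proof -
  interpret M: abelian_group M by (rule left_moduleD(1)[OF assms(1)])
  have "a \<odot>\<^bsub>M\<^esub> \<zero>\<^bsub>M\<^esub> \<oplus>\<^bsub>M\<^esub> a \<odot>\<^bsub>M\<^esub> \<zero>\<^bsub>M\<^esub> = a \<odot>\<^bsub>M\<^esub> \<zero>\<^bsub>M\<^esub>"
    using left_moduleD(4)[OF assms(1,2) M.zero_closed M.zero_closed] by simp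
  then show ?thesis
    using left_moduleD(2)[OF assms(1,2)] M.add.r_cancel_one' by (metis M.zero_closed)
qed

lemma left_module_smult_minus:
  assumes "left_module R M" "a \<in> carrier R" "x \<in> carrier M"
  shows "a \<odot>\<^bsub>M\<^esub> (\<ominus>\<^bsub>M\<^esub> x) = \<ominus>\<^bsub>M\<^esub> (a \<odot>\<^bsub>M\<^esub> x)"
proof -
  interpret M: abelian_group M by (rule left_moduleD(1)[OF assms(1)])
  note c = left_moduleD(2)[OF assms(1,2)]
  have "a \<odot>\<^bsub>M\<^esub> (\<ominus>\<^bsub>M\<^esub> x) \<oplus>\<^bsub>M\<^esub> a \<odot>\<^bsub>M\<^esub> x = \<zero>\<^bsub>M\<^esub>"
    using left_moduleD(4)[OF assms(1,2), of "\<ominus>\<^bsub>M\<^esub> x" x] assms left_module_smult_zero[OF assms(1,2)]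
    by (simp add: M.l_neg)
  then show ?thesis using c[of x] c[of "\<ominus>\<^bsub>M\<^esub> x"] assms(3) by (metis M.minus_equality M.a_inv_closed)
qed

lemma graded_moduleD:
  assumes "graded_module R M"
  shows "left_module R M" "abelian_group M" "additive_subgroup (mpart M d) M"
    and "x \<in> carrier M \<Longrightarrow> \<exists>!c. (\<forall>d. c d \<in> mpart M d) \<and> finite {d. c d \<noteq> \<zero>\<^bsub>M\<^esub>} \<and>
           x = (\<Oplus>\<^bsub>M\<^esub>d\<in>{d. c d \<noteq> \<zero>\<^bsub>M\<^esub>}. c d)"
    and "a \<in> hpart R i \<Longrightarrow> x \<in> mpart M j \<Longrightarrow> a \<odot>\<^bsub>M\<^esub> x \<in> mpart M (i + j)"
  using assms by (auto simp: graded_module_def left_module_def)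

lemma mpart_closed: "graded_module R M \<Longrightarrow> x \<in> mpart M d \<Longrightarrow> x \<in> carrier M"
  using graded_moduleD(3) additive_subgroup.a_subset by blast

text \<open>The module axioms are inherited along an injective map that is semilinear over \<open>h\<close>.  It serves both
  for a lattice inside a module over the localization and, with \<open>h\<close> the identity, for \<open>L \<otimes> P\<close>.\<close>

lemma left_module_pullback:
  fixes R :: "('r, 'z) ring_scheme" and S :: "('s, 'y) ring_scheme"
    and M :: "('r, 'u, 'v) module_scheme" and N :: "('s, 't, 'w) module_scheme"
  assumes N: "left_module S N"
    and R: "\<And>a b. a \<in> carrier R \<Longrightarrow> b \<in> carrier R \<Longrightarrow> a \<oplus>\<^bsub>R\<^esub> b \<in> carrier R"
      "\<And>a b. a \<in> carrier R \<Longrightarrow> b \<in> carrier R \<Longrightarrow> a \<otimes>\<^bsub>R\<^esub> b \<in> carrier R" "\<one>\<^bsub>R\<^esub> \<in> carrier R"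
    and h: "\<And>a. a \<in> carrier R \<Longrightarrow> h a \<in> carrier S"
      "\<And>a b. a \<in> carrier R \<Longrightarrow> b \<in> carrier R \<Longrightarrow> h (a \<oplus>\<^bsub>R\<^esub> b) = h a \<oplus>\<^bsub>S\<^esub> h b"
      "\<And>a b. a \<in> carrier R \<Longrightarrow> b \<in> carrier R \<Longrightarrow> h (a \<otimes>\<^bsub>R\<^esub> b) = h a \<otimes>\<^bsub>S\<^esub> h b" "h \<one>\<^bsub>R\<^esub> = \<one>\<^bsub>S\<^esub>"
    and \<Phi>: "\<And>x. x \<in> carrier M \<Longrightarrow> \<Phi> x \<in> carrier N" "inj_on \<Phi> (carrier M)"
    and add: "\<And>x y. x \<in> carrier M \<Longrightarrow> y \<in> carrier M \<Longrightarrow> x \<oplus>\<^bsub>M\<^esub> y \<in> carrier M"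
      "\<And>x y. x \<in> carrier M \<Longrightarrow> y \<in> carrier M \<Longrightarrow> \<Phi> (x \<oplus>\<^bsub>M\<^esub> y) = \<Phi> x \<oplus>\<^bsub>N\<^esub> \<Phi> y"
    and zero: "\<zero>\<^bsub>M\<^esub> \<in> carrier M" "\<Phi> \<zero>\<^bsub>M\<^esub> = \<zero>\<^bsub>N\<^esub>"
    and neg: "\<And>x. x \<in> carrier M \<Longrightarrow> \<exists>y\<in>carrier M. \<Phi> y = \<ominus>\<^bsub>N\<^esub> \<Phi> x"
    and smult: "\<And>a x. a \<in> carrier R \<Longrightarrow> x \<in> carrier M \<Longrightarrow> a \<odot>\<^bsub>M\<^esub> x \<in> carrier M"
      "\<And>a x. a \<in> carrier R \<Longrightarrow> x \<in> carrier M \<Longrightarrow> \<Phi> (a \<odot>\<^bsub>M\<^esub> x) = h a \<odot>\<^bsub>N\<^esub> \<Phi> x"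
  shows "left_module R M"
proof -
  interpret N: abelian_group N by (rule left_moduleD(1)[OF N])
  have eq: "x = y" if "\<Phi> x = \<Phi> y" "x \<in> carrier M" "y \<in> carrier M" for x y
    using \<Phi>(2) that by (auto dest: inj_onD)
  note [simp] = \<Phi>(1) add zero smult R h left_moduleD[OF N]
  have "abelian_group M"
  proof (rule abelian_groupI)
    fix x assume x: "x \<in> carrier M"
    then obtain y where y: "y \<in> carrier M" "\<Phi> y = \<ominus>\<^bsub>N\<^esub> \<Phi> x" using neg by blast
    then have "y \<oplus>\<^bsub>M\<^esub> x = \<zero>\<^bsub>M\<^esub>" using x by (intro eq) (simp_all add: N.l_neg)
    then show "\<exists>y\<in>carrier M. y \<oplus>\<^bsub>M\<^esub> x = \<zero>\<^bsub>M\<^esub>" using y by blast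
  qed (auto intro!: eq simp: N.a_ac)
  then show ?thesis unfolding left_module_def by (auto intro!: eq)
qed

text \<open>Summands of equal degree are collected.\<close>

lemma homogeneous_sums_family:
  assumes M: "abelian_group M" and H: "\<And>d. additive_subgroup (H d) M"
    and "x \<in> homogeneous_sums M H"
  shows "\<exists>c. (\<forall>d::int. c d \<in> H d) \<and> finite {d. c d \<noteq> \<zero>\<^bsub>M\<^esub>} \<and> x = (\<Oplus>\<^bsub>M\<^esub>d\<in>{d. c d \<noteq> \<zero>\<^bsub>M\<^esub>}. c d)"
  using assms(3)
proof induction
  case zero
  interpret M: abelian_group M by (rule M)
  show ?case using H additive_subgroup.zero_closed by (intro exI[of _ "\<lambda>_. \<zero>\<^bsub>M\<^esub>"]) force
next
  case (add x e y)
  interpret M: abelian_group M by (rule M)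
  obtain c where c: "\<And>d. c d \<in> H d" "finite {d. c d \<noteq> \<zero>\<^bsub>M\<^esub>}" "y = (\<Oplus>\<^bsub>M\<^esub>d\<in>{d. c d \<noteq> \<zero>\<^bsub>M\<^esub>}. c d)"
    using add.IH by blast
  let ?c = "c(e := x \<oplus>\<^bsub>M\<^esub> c e)" and ?D = "insert e {d. c d \<noteq> \<zero>\<^bsub>M\<^esub>}"
  have cl: "c d \<in> carrier M" for d using c(1) H additive_subgroup.a_subset by blast
  have x: "x \<in> carrier M" using add.hyps H additive_subgroup.a_subset by blast
  have "(\<Oplus>\<^bsub>M\<^esub>d\<in>{d. ?c d \<noteq> \<zero>\<^bsub>M\<^esub>}. ?c d) = (\<Oplus>\<^bsub>M\<^esub>d\<in>?D. ?c d)"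
    using c(2) cl x by (intro M.add.finprod_mono_neutral_cong_left) (auto split: if_splits)
  also have "\<dots> = x \<oplus>\<^bsub>M\<^esub> c e \<oplus>\<^bsub>M\<^esub> (\<Oplus>\<^bsub>M\<^esub>d\<in>?D - {e}. ?c d)"
    using M.finsum_insert[of "?D - {e}" e ?c] c(2) cl x by (simp add: Pi_iff fun_upd_def)
  also have "(\<Oplus>\<^bsub>M\<^esub>d\<in>?D - {e}. ?c d) = (\<Oplus>\<^bsub>M\<^esub>d\<in>?D - {e}. c d)"
    using cl x by (intro M.finsum_cong) auto
  also have "x \<oplus>\<^bsub>M\<^esub> c e \<oplus>\<^bsub>M\<^esub> \<dots> = x \<oplus>\<^bsub>M\<^esub> (c e \<oplus>\<^bsub>M\<^esub> \<dots>)"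
    using cl x by (intro M.a_assoc) auto
  also have "c e \<oplus>\<^bsub>M\<^esub> (\<Oplus>\<^bsub>M\<^esub>d\<in>?D - {e}. c d) = (\<Oplus>\<^bsub>M\<^esub>d\<in>?D. c d)"
    using M.finsum_insert[of "?D - {e}" e c] c(2) cl by (simp add: insert_absorb Pi_iff)
  also have "\<dots> = y"
    unfolding c(3) using c(2) cl by (intro M.add.finprod_mono_neutral_cong_right) auto
  finally have "x \<oplus>\<^bsub>M\<^esub> y = (\<Oplus>\<^bsub>M\<^esub>d\<in>{d. ?c d \<noteq> \<zero>\<^bsub>M\<^esub>}. ?c d)" by simp
  moreover have "finite {d. ?c d \<noteq> \<zero>\<^bsub>M\<^esub>}"
    using c(2) by (rule_tac finite_subset[of _ ?D]) auto
  moreover have "?c d \<in> H d" for d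
    using c(1) add.hyps(1) additive_subgroup.a_closed[OF H] by auto
  ultimately show ?case by (intro exI[of _ ?c]) blast
qed

lemma additive_map_finsum:
  assumes "abelian_group M" "abelian_group N"
    and "\<And>x. x \<in> carrier M \<Longrightarrow> \<Phi> x \<in> carrier N" "\<Phi> \<zero>\<^bsub>M\<^esub> = \<zero>\<^bsub>N\<^esub>"
    and "\<And>x y. x \<in> carrier M \<Longrightarrow> y \<in> carrier M \<Longrightarrow> \<Phi> (x \<oplus>\<^bsub>M\<^esub> y) = \<Phi> x \<oplus>\<^bsub>N\<^esub> \<Phi> y"
    and "finite A" "\<And>d. d \<in> A \<Longrightarrow> c d \<in> carrier M"
  shows "\<Phi> (\<Oplus>\<^bsub>M\<^esub>d\<in>A. c d) = (\<Oplus>\<^bsub>N\<^esub>d\<in>A. \<Phi> (c d))"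
proof -
  interpret M: abelian_group M by fact
  interpret N: abelian_group N by fact
  show ?thesis using assms(6,7)
    by (induction rule: finite_induct) (auto simp: assms(3-5) Pi_iff)
qed

text \<open>Uniqueness of the homogeneous components comes from \<open>N\<close>, since \<open>\<Phi>\<close> is injective; only their
  existence has to be assumed.\<close>

lemma graded_module_pullback:
  fixes R :: "('k, 'r) galg" and S :: "('k, 's) galg" and M :: "('r, 'u) gmod" and N :: "('s, 't) gmod"
  assumes M: "left_module R M" and N: "graded_module S N"
    and \<Phi>: "\<And>x. x \<in> carrier M \<Longrightarrow> \<Phi> x \<in> carrier N" "inj_on \<Phi> (carrier M)" "\<Phi> \<zero>\<^bsub>M\<^esub> = \<zero>\<^bsub>N\<^esub>"
      "\<And>x y. x \<in> carrier M \<Longrightarrow> y \<in> carrier M \<Longrightarrow> \<Phi> (x \<oplus>\<^bsub>M\<^esub> y) = \<Phi> x \<oplus>\<^bsub>N\<^esub> \<Phi> y"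
      "\<And>a x. a \<in> carrier R \<Longrightarrow> x \<in> carrier M \<Longrightarrow> \<Phi> (a \<odot>\<^bsub>M\<^esub> x) = h a \<odot>\<^bsub>N\<^esub> \<Phi> x"
    and mpart: "\<And>d. mpart M d = {x \<in> carrier M. \<Phi> x \<in> mpart N d}"
    and hpart: "\<And>d. hpart R d \<subseteq> carrier R" "\<And>a d. a \<in> hpart R d \<Longrightarrow> h a \<in> hpart S d"
    and sums: "\<And>x. x \<in> carrier M \<Longrightarrow> x \<in> homogeneous_sums M (mpart M)"
  shows "graded_module R M"
proof -
  interpret M: abelian_group M by (rule left_moduleD(1)[OF M])
  interpret N: abelian_group N by (rule graded_moduleD(2)[OF N])
  have \<Phi>0: "\<Phi> x = \<zero>\<^bsub>N\<^esub> \<longleftrightarrow> x = \<zero>\<^bsub>M\<^esub>" if "x \<in> carrier M" for x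
    using \<Phi>(2,3) that by (metis M.zero_closed inj_onD)
  have \<Phi>neg: "\<Phi> (\<ominus>\<^bsub>M\<^esub> x) = \<ominus>\<^bsub>N\<^esub> \<Phi> x" if "x \<in> carrier M" for x
  proof -
    have "\<Phi> (\<ominus>\<^bsub>M\<^esub> x) \<oplus>\<^bsub>N\<^esub> \<Phi> x = \<zero>\<^bsub>N\<^esub>"
      using that by (simp add: M.l_neg \<Phi>(3) flip: \<Phi>(4))
    then show ?thesis using that \<Phi>(1) by (metis M.a_inv_closed N.minus_equality)
  qed
  have sub: "additive_subgroup (mpart M d) M" for d
  proof -
    interpret H: additive_subgroup "mpart N d" N by (rule graded_moduleD(3)[OF N])
    show ?thesis unfolding mpart
      by (intro additive_subgroupI subgroup.intro)
        (auto simp: \<Phi> \<Phi>neg H.a_inv_closed simp flip: a_inv_def)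
  qed
  moreover have "\<exists>!c. (\<forall>d. c d \<in> mpart M d) \<and> finite {d. c d \<noteq> \<zero>\<^bsub>M\<^esub>} \<and>
      x = (\<Oplus>\<^bsub>M\<^esub>d\<in>{d. c d \<noteq> \<zero>\<^bsub>M\<^esub>}. c d)" (is "\<exists>!c. ?D c") if x: "x \<in> carrier M" for x
  proof (rule ex_ex1I)
    show "\<exists>c. ?D c" using homogeneous_sums_family[OF M.abelian_group_axioms sub sums[OF x]] .
  next
    fix c c' assume *: "?D c" "?D c'"
    have push: "(\<forall>d. (\<Phi> \<circ> c) d \<in> mpart N d) \<and> finite {d. (\<Phi> \<circ> c) d \<noteq> \<zero>\<^bsub>N\<^esub>} \<and>
      \<Phi> x = (\<Oplus>\<^bsub>N\<^esub>d\<in>{d. (\<Phi> \<circ> c) d \<noteq> \<zero>\<^bsub>N\<^esub>}. (\<Phi> \<circ> c) d)" if c: "?D c" for c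
    proof -
      have cl: "c d \<in> carrier M" for d using c by (auto simp: mpart)
      have "{d. (\<Phi> \<circ> c) d \<noteq> \<zero>\<^bsub>N\<^esub>} = {d. c d \<noteq> \<zero>\<^bsub>M\<^esub>}" using \<Phi>0[OF cl] by simp
      moreover have "\<Phi> x = (\<Oplus>\<^bsub>N\<^esub>d\<in>{d. c d \<noteq> \<zero>\<^bsub>M\<^esub>}. \<Phi> (c d))"
        using additive_map_finsum[OF M.abelian_group_axioms N.abelian_group_axioms \<Phi>(1,3,4), of _ c]
          c cl by metis
      ultimately show ?thesis using c by (simp add: mpart)
    qed
    have "\<Phi> \<circ> c = \<Phi> \<circ> c'"
      using push[OF *(1)] push[OF *(2)] graded_moduleD(4)[OF N \<Phi>(1)[OF x]] by blast
    then have "\<Phi> (c d) = \<Phi> (c' d)" for d by (metis comp_apply)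
    then show "c = c'" using * \<Phi>(2) by (auto simp: mpart fun_eq_iff dest: inj_onD)
  qed
  moreover have "a \<odot>\<^bsub>M\<^esub> x \<in> mpart M (i + j)" if "a \<in> hpart R i" "x \<in> mpart M j" for a x i j
  proof -
    have a: "a \<in> carrier R" and x: "x \<in> carrier M" "\<Phi> x \<in> mpart N j"
      using that hpart(1) by (auto simp: mpart)
    show ?thesis using graded_moduleD(5)[OF N hpart(2)[OF that(1)] x(2)] left_moduleD(2)[OF M a x(1)]
      by (simp add: mpart \<Phi>(5)[OF a x(1)])
  qed
  ultimately show ?thesis using M unfolding graded_module_def by blast
qed

lemma additive_subgroup_finsum:
  assumes "abelian_group M" "additive_subgroup N M" "\<And>d. d \<in> A \<Longrightarrow> c d \<in> N"
  shows "(\<Oplus>\<^bsub>M\<^esub>d\<in>A. c d) \<in> N"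
proof -
  interpret M: abelian_group M by fact
  interpret N: additive_subgroup N M by fact
  show ?thesis
  proof (cases "finite A")
    case True
    then show ?thesis using assms(3) N.a_subset
      by (induction rule: finite_induct) (auto simp: Pi_iff subset_iff N.zero_closed N.a_closed)
  next
    case False
    then have "(\<Oplus>\<^bsub>M\<^esub>d\<in>A. c d) = \<zero>\<^bsub>M\<^esub>" by (simp add: finsum_def finprod_def)
    then show ?thesis by simp
  qed
qed

section \<open>The category of graded modules\<close>

lemma gmod_homD:
  assumes "f \<in> gmod_hom R M N"
  shows "x \<in> carrier M \<Longrightarrow> f x \<in> carrier N"
    "x \<in> carrier M \<Longrightarrow> y \<in> carrier M \<Longrightarrow> f (x \<oplus>\<^bsub>M\<^esub> y) = f x \<oplus>\<^bsub>N\<^esub> f y"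
    "a \<in> carrier R \<Longrightarrow> x \<in> carrier M \<Longrightarrow> f (a \<odot>\<^bsub>M\<^esub> x) = a \<odot>\<^bsub>N\<^esub> f x"
    "x \<in> mpart M d \<Longrightarrow> f x \<in> mpart N d" "f \<in> extensional (carrier M)"
  using assms by (auto simp: gmod_hom_def PiE_def image_subset_iff)

lemma gmod_hom_zero:
  assumes "f \<in> gmod_hom R M N" "abelian_group M" "abelian_group N"
  shows "f \<zero>\<^bsub>M\<^esub> = \<zero>\<^bsub>N\<^esub>"
proof -
  interpret M: abelian_group M by fact
  interpret N: abelian_group N by fact
  have "f \<zero>\<^bsub>M\<^esub> \<oplus>\<^bsub>N\<^esub> f \<zero>\<^bsub>M\<^esub> = f \<zero>\<^bsub>M\<^esub>"
    using gmod_homD(2)[OF assms(1) M.zero_closed M.zero_closed] by simp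
  then show ?thesis
    using gmod_homD(1)[OF assms(1) M.zero_closed] by (metis N.add.r_cancel_one' N.zero_closed)
qed

lemma gmod_hom_compose:
  assumes "f \<in> gmod_hom R M N" "g \<in> gmod_hom R N P" "graded_module R M"
  shows "compose (carrier M) g f \<in> gmod_hom R M P"
proof -
  interpret M: abelian_group M using assms(3) by (rule graded_moduleD(2))
  have "compose (carrier M) g f x \<in> mpart P d" if "x \<in> mpart M d" for x d
    using that mpart_closed[OF assms(3)] gmod_homD(4)[OF assms(1)] gmod_homD(4)[OF assms(2)]
    by (simp add: compose_eq)
  then show ?thesis
    using gmod_homD[OF assms(1)] gmod_homD[OF assms(2)] left_moduleD(2)[OF graded_moduleD(1)[OF assms(3)]]
      mpart_closed[OF assms(3)]
    by (auto simp: gmod_hom_def compose_def)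
qed

lemma category_gr: "category (gr R)"
proof
  fix M assume "M \<in> obj (gr R)"
  then have M: "graded_module R M" "fin_gen R M" by (auto simp: gr_def)
  interpret abelian_group M using M(1) by (rule graded_moduleD(2))
  show "idt (gr R) M \<in> arr (gr R)"
    using M left_moduleD(2)[OF graded_moduleD(1)[OF M(1)]] mpart_closed[OF M(1)]
    by (auto simp: gr_def gmod_hom_def)
next
  fix f assume "f \<in> arr (gr R)"
  then show "cmp (gr R) (idt (gr R) (tgt (gr R) f)) f = f" "cmp (gr R) f (idt (gr R) (src (gr R) f)) = f"
    by (auto simp: gr_def gmod_hom_def compose_def PiE_def extensional_def Pi_iff fun_eq_iff) metis+
next
  fix f g h assume "f \<in> arr (gr R)" "g \<in> arr (gr R)" "h \<in> arr (gr R)"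
    "tgt (gr R) f = src (gr R) g" "tgt (gr R) g = src (gr R) h"
  then show "cmp (gr R) h (cmp (gr R) g f) = cmp (gr R) (cmp (gr R) h g) f"
    by (auto simp: gr_def gmod_hom_def intro!: compose_assoc)
qed (auto simp: gr_def gmod_hom_compose)

definition zero_map :: "('r, 'u) gmod \<Rightarrow> ('r, 'u) gmod \<Rightarrow> 'u \<Rightarrow> 'u" where
  "zero_map M N = (\<lambda>x\<in>carrier M. \<zero>\<^bsub>N\<^esub>)"

lemma zero_map_hom:
  assumes "graded_module R M" "graded_module R N" shows "zero_map M N \<in> gmod_hom R M N"
proof -
  interpret M: abelian_group M using assms(1) by (rule graded_moduleD(2))
  interpret N: abelian_group N using assms(2) by (rule graded_moduleD(2))
  have "\<zero>\<^bsub>N\<^esub> \<in> mpart N d" for d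
    using graded_moduleD(3)[OF assms(2)] additive_subgroup.zero_closed by blast
  then show ?thesis using mpart_closed[OF assms(1)] left_moduleD(2)[OF graded_moduleD(1)[OF assms(1)]]
    left_module_smult_zero[OF graded_moduleD(1)[OF assms(2)]]
    by (auto simp: gmod_hom_def zero_map_def)
qed

text \<open>On a zero object the identity and the zero map coincide.\<close>

lemma zero_obj_gr:
  "zero_obj (gr R) M \<longleftrightarrow> graded_module R M \<and> fin_gen R M \<and> carrier M = {\<zero>\<^bsub>M\<^esub>}"
proof
  assume z: "zero_obj (gr R) M"
  then have M: "graded_module R M" "fin_gen R M" by (auto simp: zero_obj_def gr_def)
  interpret M: abelian_group M using M(1) by (rule graded_moduleD(2))
  have "(M, zero_map M M, M) \<in> arr (gr R)" "(M, \<lambda>x\<in>carrier M. x, M) \<in> arr (gr R)"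
    using M zero_map_hom[OF M(1) M(1)] category.idt_arr[OF category_gr, of M R] by (auto simp: gr_def)
  moreover have "\<exists>!f. f \<in> arr (gr R) \<and> src (gr R) f = M \<and> tgt (gr R) f = M"
    using z by (auto simp: zero_obj_def)
  ultimately have "(M, zero_map M M, M) = (M, \<lambda>x\<in>carrier M. x, M)" by (auto simp: gr_def)
  then have "x = \<zero>\<^bsub>M\<^esub>" if "x \<in> carrier M" for x
    using that by (metis Pair_inject restrict_apply' zero_map_def)
  then show "graded_module R M \<and> fin_gen R M \<and> carrier M = {\<zero>\<^bsub>M\<^esub>}" using M by auto
next
  assume M: "graded_module R M \<and> fin_gen R M \<and> carrier M = {\<zero>\<^bsub>M\<^esub>}"
  have "f = zero_map M N" if "f \<in> gmod_hom R M N" "graded_module R N" for f N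
    using that M gmod_hom_zero[OF that(1)] graded_moduleD(2) gmod_homD(5)[OF that(1)]
    by (auto simp: zero_map_def fun_eq_iff extensional_def)
  moreover have "f = zero_map N M" if "f \<in> gmod_hom R N M" for f N
    using that M gmod_homD(1,5)[OF that] by (auto simp: zero_map_def fun_eq_iff extensional_def)
  moreover have "zero_map M N \<in> gmod_hom R M N" "zero_map N M \<in> gmod_hom R N M" if "graded_module R N" for N
    using M that zero_map_hom by blast+
  ultimately show "zero_obj (gr R) M"
    using M unfolding zero_obj_def by (auto simp: gr_def; (blast | metis))
qed

lemma zero_arr_grI:
  fixes M N O0 :: "('r, 'u) gmod"
  assumes "zero_obj (gr R) O0" "graded_module R M" "fin_gen R M" "graded_module R N" "fin_gen R N"
  shows "zero_arr (gr R) (M, zero_map M N, N)"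
proof -
  have O0: "graded_module R O0" "fin_gen R O0" "carrier O0 = {\<zero>\<^bsub>O0\<^esub>}" using assms(1) by (auto simp: zero_obj_gr)
  have "(M, zero_map M O0, O0) \<in> arr (gr R)" "(O0, zero_map O0 N, N) \<in> arr (gr R)"
    using O0 assms zero_map_hom by (auto simp: gr_def)
  moreover have "(M, zero_map M N, N) = cmp (gr R) (O0, zero_map O0 N, N) (M, zero_map M O0, O0)"
    using O0 by (auto simp: gr_def zero_map_def compose_def fun_eq_iff)
  ultimately show ?thesis unfolding zero_arr_def using assms(1)
    by (intro exI[of _ O0]) (auto simp: gr_def)
qed

lemma zero_arr_grD:
  assumes "zero_arr (gr R) f" "x \<in> carrier (fst f)"
  shows "fst (snd f) x = \<zero>\<^bsub>snd (snd f)\<^esub>"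
proof -
  obtain O0 g h where *: "zero_obj (gr R) O0" "g \<in> arr (gr R)" "h \<in> arr (gr R)" "tgt (gr R) g = O0"
    "src (gr R) h = O0" "f = cmp (gr R) h g"
    using assms(1) by (auto simp: zero_arr_def)
  obtain M g' where g: "g = (M, g', O0)" "g' \<in> gmod_hom R M O0"
    using * by (cases g) (auto simp: gr_def)
  obtain N h' where h: "h = (O0, h', N)" "h' \<in> gmod_hom R O0 N" "graded_module R N" "graded_module R O0"
    using * by (cases h) (auto simp: gr_def)
  have f: "f = (M, compose (carrier M) h' g', N)" using * g h by (simp add: gr_def)
  have "g' x = \<zero>\<^bsub>O0\<^esub>" using gmod_homD(1)[OF g(2)] assms(2) *(1) f by (auto simp: zero_obj_gr)
  then show ?thesis using f assms(2) gmod_hom_zero[OF h(2)] h graded_moduleD(2) by (auto simp: compose_eq)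
qed

section \<open>Lattices in modules over the localization\<close>

lemma homogeneous_sums_map:
  assumes "abelian_group M" "\<And>x d. x \<in> H d \<Longrightarrow> x \<in> carrier M"
    and "f \<zero>\<^bsub>M\<^esub> = \<zero>\<^bsub>N\<^esub>" "\<And>x d. x \<in> H d \<Longrightarrow> f x \<in> H' d"
    and "\<And>x y. x \<in> carrier M \<Longrightarrow> y \<in> carrier M \<Longrightarrow> f (x \<oplus>\<^bsub>M\<^esub> y) = f x \<oplus>\<^bsub>N\<^esub> f y"
    and "x \<in> homogeneous_sums M H"
  shows "f x \<in> homogeneous_sums N H' \<and> x \<in> carrier M"
proof -
  interpret M: abelian_group M by fact
  show ?thesis using assms(6)
  proof induction
    case (add x d y)
    then have "f x \<oplus>\<^bsub>N\<^esub> f y \<in> homogeneous_sums N H'"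
      using assms(4) by (blast intro: homogeneous_sums.add)
    then show ?case using add assms(2,5) by auto
  qed (simp add: assms(3) homogeneous_sums.zero)
qed

lemma graded_module_homogeneous_sums:
  assumes "graded_module R M" "x \<in> carrier M"
  shows "x \<in> homogeneous_sums M (mpart M)"
proof -
  interpret M: abelian_group M using assms(1) by (rule graded_moduleD(2))
  obtain c where c: "\<And>d. c d \<in> mpart M d" "finite {d. c d \<noteq> \<zero>\<^bsub>M\<^esub>}"
    "x = (\<Oplus>\<^bsub>M\<^esub>d\<in>{d. c d \<noteq> \<zero>\<^bsub>M\<^esub>}. c d)"
    using graded_moduleD(4)[OF assms] by blast
  have "(\<Oplus>\<^bsub>M\<^esub>d\<in>D. c d) \<in> homogeneous_sums M (mpart M)" if "finite D" for D
    using that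
  proof induction
    case (insert d D)
    then have "(\<Oplus>\<^bsub>M\<^esub>d\<in>insert d D. c d) = c d \<oplus>\<^bsub>M\<^esub> (\<Oplus>\<^bsub>M\<^esub>d\<in>D. c d)"
      using c(1) mpart_closed[OF assms(1)] by (intro M.finsum_insert) auto
    then show ?case using homogeneous_sums.add[OF c(1) insert.IH] by simp
  qed (simp add: homogeneous_sums.zero)
  then show ?thesis using c by simp
qed

lemma additive_subgroup_preimage:
  assumes "abelian_group M" "abelian_group N" "additive_subgroup K N"
    and f: "\<And>x. x \<in> carrier M \<Longrightarrow> f x \<in> carrier N"
      "\<And>x y. x \<in> carrier M \<Longrightarrow> y \<in> carrier M \<Longrightarrow> f (x \<oplus>\<^bsub>M\<^esub> y) = f x \<oplus>\<^bsub>N\<^esub> f y"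
  shows "additive_subgroup {x \<in> carrier M. f x \<in> K} M"
proof -
  interpret M: abelian_group M by fact
  interpret N: abelian_group N by fact
  interpret K: additive_subgroup K N by fact
  have f0: "f \<zero>\<^bsub>M\<^esub> = \<zero>\<^bsub>N\<^esub>"
    using f(2)[of "\<zero>\<^bsub>M\<^esub>" "\<zero>\<^bsub>M\<^esub>"] f(1)[of "\<zero>\<^bsub>M\<^esub>"] by (metis M.l_zero M.zero_closed N.add.r_cancel_one')
  have "f (\<ominus>\<^bsub>M\<^esub> x) = \<ominus>\<^bsub>N\<^esub> f x" if "x \<in> carrier M" for x
    using f(2)[of "\<ominus>\<^bsub>M\<^esub> x" x] f(1) f0 that by (metis M.a_inv_closed M.l_neg N.minus_equality)
  then show ?thesis
    by (intro additive_subgroupI subgroup.intro) (auto simp: f f0 simp flip: a_inv_def)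
qed

text \<open>The preimage of a submodule containing the images of the generators contains the generators.\<close>

lemma fin_gen_image:
  assumes M: "left_module R M" and N: "abelian_group N" and "fin_gen R M"
    and f: "f ` carrier M = carrier N"
      "\<And>x y. x \<in> carrier M \<Longrightarrow> y \<in> carrier M \<Longrightarrow> f (x \<oplus>\<^bsub>M\<^esub> y) = f x \<oplus>\<^bsub>N\<^esub> f y"
      "\<And>a x. a \<in> carrier R \<Longrightarrow> x \<in> carrier M \<Longrightarrow> f (a \<odot>\<^bsub>M\<^esub> x) = a \<odot>\<^bsub>N\<^esub> f x"
  shows "fin_gen R N"
proof -
  obtain S where S: "finite S" "S \<subseteq> carrier M"
    "\<And>K. left_submodule R M K \<Longrightarrow> S \<subseteq> K \<Longrightarrow> K = carrier M"
    using assms(3) by (auto simp: fin_gen_def)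
  have "K = carrier N" if K: "left_submodule R N K" "f ` S \<subseteq> K" for K
  proof -
    have sub: "additive_subgroup K N" "\<And>a x. a \<in> carrier R \<Longrightarrow> x \<in> K \<Longrightarrow> a \<odot>\<^bsub>N\<^esub> x \<in> K"
      using K by (auto simp: left_submodule_def)
    have "additive_subgroup {x \<in> carrier M. f x \<in> K} M"
      using f by (intro additive_subgroup_preimage[OF left_moduleD(1)[OF M] N sub(1)]) auto
    then have K': "left_submodule R M {x \<in> carrier M. f x \<in> K}"
      using f(3) sub(2) left_moduleD(2)[OF M] by (auto simp: left_submodule_def)
    have "S \<subseteq> {x \<in> carrier M. f x \<in> K}" using S(2) K(2) by auto
    then have eq: "carrier M \<subseteq> {x \<in> carrier M. f x \<in> K}" by (rule equalityD2[OF S(3)[OF K']])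
    have "carrier N \<subseteq> K" unfolding f(1)[symmetric] using eq by auto
    then show ?thesis using additive_subgroup.a_subset[OF sub(1)] by (rule antisym[rotated])
  qed
  then show ?thesis unfolding fin_gen_def using S f(1) by (intro exI[of _ "f ` S"]) blast
qed

text \<open>Elements of \<open>R\<close> are sums of homogeneous ones, so that the \<open>R\<close>-span of homogeneous elements is graded;
  \<open>z\<close> has degree one, so that dividing by it lowers degrees by one.\<close>

locale graded_localization = central_localization R z for R :: "('k, 'r) galg" (structure) and z +
  assumes hpart_closed: "hpart R d \<subseteq> carrier R"
    and one_hpart: "\<one> \<in> hpart R 0"
    and z_hpart: "z \<in> hpart R 1"
    and homogeneous_sums: "a \<in> carrier R \<Longrightarrow> a \<in> homogeneous_sums R (hpart R)"
begin

abbreviation "can a \<equiv> Defs.frac R z a 0"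

lemma can_add: "a \<in> carrier R \<Longrightarrow> b \<in> carrier R \<Longrightarrow> can (a \<oplus> b) = can a \<oplus>\<^bsub>L\<^esub> can b"
  by (simp add: add_L)

lemma can_mult: "a \<in> carrier R \<Longrightarrow> b \<in> carrier R \<Longrightarrow> can (a \<otimes> b) = can a \<otimes>\<^bsub>L\<^esub> can b"
  by (simp add: mult_L)

lemma can_hpart: "a \<in> hpart R d \<Longrightarrow> can a \<in> hpart L d"
  unfolding hpart_L by (intro exI[of _ a] exI[of _ 0]) simp

lemma hpart_L_closed: "hpart L d \<subseteq> carrier L"
  using hpart_closed by (auto simp: hpart_L subset_iff)

lemma inverse_zpow_hpart: "fraction \<one> m \<in> hpart L (- int m)"
  unfolding hpart_L using one_hpart by (intro exI[of _ \<one>] exI[of _ m]) simp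

lemma inverse_zpow_smult:
  assumes "left_module L Y" "y \<in> carrier Y"
  shows "fraction \<one> m \<odot>\<^bsub>Y\<^esub> (can (z [^] m) \<odot>\<^bsub>Y\<^esub> y) = y"
    "can (z [^] m) \<odot>\<^bsub>Y\<^esub> (fraction \<one> m \<odot>\<^bsub>Y\<^esub> y) = y"
proof -
  have "fraction \<one> m \<otimes>\<^bsub>L\<^esub> can (z [^] m) = \<one>\<^bsub>L\<^esub>" "can (z [^] m) \<otimes>\<^bsub>L\<^esub> fraction \<one> m = \<one>\<^bsub>L\<^esub>"
    using fraction_cancel[of \<one> m 0] fraction_zpow_cancel[of \<one> m] by (simp_all add: mult_L one_L)
  then show "fraction \<one> m \<odot>\<^bsub>Y\<^esub> (can (z [^] m) \<odot>\<^bsub>Y\<^esub> y) = y"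
    "can (z [^] m) \<odot>\<^bsub>Y\<^esub> (fraction \<one> m \<odot>\<^bsub>Y\<^esub> y) = y"
    using assms left_moduleD(5,6)[OF assms(1)] by (metis fraction_closed one_closed zpow_closed)+
qed

lemma zpow_smult_mpart:
  assumes "graded_module L Y" "y \<in> mpart Y d"
  shows "can (z [^] m) \<odot>\<^bsub>Y\<^esub> y \<in> mpart Y (d + int m)"
proof (induction m)
  case 0
  then show ?case using assms mpart_closed[OF assms] left_moduleD(6)[OF graded_moduleD(1)[OF assms(1)]]
    by (simp flip: one_L)
next
  case (Suc m)
  have "can (z [^] Suc m) \<odot>\<^bsub>Y\<^esub> y = can z \<odot>\<^bsub>Y\<^esub> (can (z [^] m) \<odot>\<^bsub>Y\<^esub> y)"
    using mpart_closed[OF assms] left_moduleD(5)[OF graded_moduleD(1)[OF assms(1)]]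
    by (simp add: z_central[symmetric] can_mult)
  moreover have "can z \<odot>\<^bsub>Y\<^esub> (can (z [^] m) \<odot>\<^bsub>Y\<^esub> y) \<in> mpart Y (1 + (d + int m))"
    by (rule graded_moduleD(5)[OF assms(1) can_hpart[OF z_hpart] Suc])
  ultimately show ?case by (simp add: algebra_simps)
qed

end

text \<open>\<open>M\<close> is an abstract copy of an \<open>R\<close>-submodule of \<open>Y\<close>, embedded by \<open>\<iota>\<close>, that every element of \<open>Y\<close> enters
  after multiplication by a power of \<open>z\<close>.  The copy is kept apart from its image because the two
  carriers lie in different types.\<close>

locale graded_lattice = graded_localization R z for R :: "('k, 'r) galg" (structure) and z +
  fixes Y :: "(('r \<times> nat) set, 't) gmod" and M :: "('r, 'u) gmod" and \<iota> :: "'u \<Rightarrow> 't"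
  assumes Y: "graded_module L Y" and M: "graded_module R M"
    and \<iota>_closed: "u \<in> carrier M \<Longrightarrow> \<iota> u \<in> carrier Y"
    and \<iota>_inj: "inj_on \<iota> (carrier M)"
    and \<iota>_zero: "\<iota> \<zero>\<^bsub>M\<^esub> = \<zero>\<^bsub>Y\<^esub>"
    and \<iota>_add: "u \<in> carrier M \<Longrightarrow> v \<in> carrier M \<Longrightarrow> \<iota> (u \<oplus>\<^bsub>M\<^esub> v) = \<iota> u \<oplus>\<^bsub>Y\<^esub> \<iota> v"
    and \<iota>_smult: "a \<in> carrier R \<Longrightarrow> u \<in> carrier M \<Longrightarrow> \<iota> (a \<odot>\<^bsub>M\<^esub> u) = can a \<odot>\<^bsub>Y\<^esub> \<iota> u"
    and \<iota>_mpart: "mpart M d = {u \<in> carrier M. \<iota> u \<in> mpart Y d}"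
    and absorbing: "y \<in> carrier Y \<Longrightarrow> \<exists>m. can (z [^] (m::nat)) \<odot>\<^bsub>Y\<^esub> y \<in> \<iota> ` carrier M"
begin

abbreviation "T \<equiv> tensor_pre L M"
abbreviation "rel \<equiv> tensor_rel R L can M"
abbreviation "cls \<equiv> tensor_cls R L can M"
abbreviation "E \<equiv> ext_scalars_obj R L can M"

sublocale Y: abelian_group Y using Y by (rule graded_moduleD(2))
sublocale M: abelian_group M using M by (rule graded_moduleD(2))

lemmas Y_module = graded_moduleD(1)[OF Y] and M_module = graded_moduleD(1)[OF M]
lemmas Y_smult = left_moduleD(2-6)[OF Y_module] and M_smult = left_moduleD(2-6)[OF M_module]

lemma T_zero: "0 \<in> T" by (simp add: tensor_pre_def)
lemma T_diff: "\<phi> \<in> T \<Longrightarrow> \<psi> \<in> T \<Longrightarrow> \<phi> - \<psi> \<in> T"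
  using keys_diff[of \<phi> \<psi>] by (auto simp: tensor_pre_def)
lemma T_add: "\<phi> \<in> T \<Longrightarrow> \<psi> \<in> T \<Longrightarrow> \<phi> + \<psi> \<in> T"
  using Poly_Mapping.keys_add[of \<phi> \<psi>] by (auto simp: tensor_pre_def)
lemma T_frag: "s \<in> carrier L \<Longrightarrow> u \<in> carrier M \<Longrightarrow> frag_of (s, u) \<in> T"
  by (simp add: tensor_pre_def)

lemma T_induct [consumes 1, case_names zero frag diff]:
  assumes "\<phi> \<in> T" "P 0" "\<And>s u. s \<in> carrier L \<Longrightarrow> u \<in> carrier M \<Longrightarrow> P (frag_of (s, u))"
    and "\<And>\<phi> \<psi>. \<phi> \<in> T \<Longrightarrow> \<psi> \<in> T \<Longrightarrow> P \<phi> \<Longrightarrow> P \<psi> \<Longrightarrow> P (\<phi> - \<psi>)"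
  shows "P \<phi>"
proof -
  have "Poly_Mapping.keys \<phi> \<subseteq> carrier L \<times> carrier M" using assms(1) by (simp add: tensor_pre_def)
  then have "\<phi> \<in> T \<and> P \<phi>"
    by (induction rule: frag_induction) (auto simp: T_zero T_frag T_diff assms(2-4))
  then show ?thesis by blast
qed

text \<open>The multiplication map \<open>s \<otimes> u \<mapsto> s \<iota>(u)\<close> before passing to the tensor product.  It exists by the
  universal property of the free abelian group.\<close>

definition ev :: "(('r \<times> nat) set \<times> 'u \<Rightarrow>\<^sub>0 int) \<Rightarrow> 't" where
  "ev = (SOME e. (\<forall>\<phi>\<in>T. e \<phi> \<in> carrier Y) \<and> (\<forall>\<phi>\<in>T. \<forall>\<psi>\<in>T. e (\<phi> + \<psi>) = e \<phi> \<oplus>\<^bsub>Y\<^esub> e \<psi>) \<and>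
     (\<forall>s\<in>carrier L. \<forall>u\<in>carrier M. e (frag_of (s, u)) = s \<odot>\<^bsub>Y\<^esub> \<iota> u))"

lemma ev_closed: "\<phi> \<in> T \<Longrightarrow> ev \<phi> \<in> carrier Y"
  and ev_add: "\<phi> \<in> T \<Longrightarrow> \<psi> \<in> T \<Longrightarrow> ev (\<phi> + \<psi>) = ev \<phi> \<oplus>\<^bsub>Y\<^esub> ev \<psi>"
  and ev_frag: "s \<in> carrier L \<Longrightarrow> u \<in> carrier M \<Longrightarrow> ev (frag_of (s, u)) = s \<odot>\<^bsub>Y\<^esub> \<iota> u"
proof -
  let ?S = "carrier L \<times> carrier M"
  have "(\<lambda>(s, u). s \<odot>\<^bsub>Y\<^esub> \<iota> u) ` ?S \<subseteq> carrier (add_monoid Y)"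
    using Y_smult(1) \<iota>_closed by auto
  then obtain e where e: "e \<in> hom (free_Abelian_group ?S) (add_monoid Y)"
    "\<And>x. x \<in> ?S \<Longrightarrow> e (frag_of x) = (\<lambda>(s, u). s \<odot>\<^bsub>Y\<^esub> \<iota> u) x"
    using comm_group.free_Abelian_group_universal[OF Y.a_comm_group] by blast
  have "\<exists>e. (\<forall>\<phi>\<in>T. e \<phi> \<in> carrier Y) \<and> (\<forall>\<phi>\<in>T. \<forall>\<psi>\<in>T. e (\<phi> + \<psi>) = e \<phi> \<oplus>\<^bsub>Y\<^esub> e \<psi>) \<and>
     (\<forall>s\<in>carrier L. \<forall>u\<in>carrier M. e (frag_of (s, u)) = s \<odot>\<^bsub>Y\<^esub> \<iota> u)"
    using e by (intro exI[of _ e]) (auto simp: hom_def tensor_pre_def free_Abelian_group_def Pi_iff)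
  from someI_ex[OF this, folded ev_def]
  show "\<phi> \<in> T \<Longrightarrow> ev \<phi> \<in> carrier Y" "\<phi> \<in> T \<Longrightarrow> \<psi> \<in> T \<Longrightarrow> ev (\<phi> + \<psi>) = ev \<phi> \<oplus>\<^bsub>Y\<^esub> ev \<psi>"
    "s \<in> carrier L \<Longrightarrow> u \<in> carrier M \<Longrightarrow> ev (frag_of (s, u)) = s \<odot>\<^bsub>Y\<^esub> \<iota> u" by blast+
qed

lemma ev_zero: "ev 0 = \<zero>\<^bsub>Y\<^esub>"
  using ev_add[OF T_zero T_zero] ev_closed[OF T_zero] by (simp add: Y.add.r_cancel_one')

lemma ev_diff:
  assumes "\<phi> \<in> T" "\<psi> \<in> T" shows "ev (\<phi> - \<psi>) = ev \<phi> \<ominus>\<^bsub>Y\<^esub> ev \<psi>"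
proof -
  have "ev \<phi> = ev (\<phi> - \<psi>) \<oplus>\<^bsub>Y\<^esub> ev \<psi>" using ev_add[OF T_diff[OF assms] assms(2)] by simp
  then show ?thesis using ev_closed[OF T_diff[OF assms]] ev_closed[OF assms(2)]
    by (simp add: Y.minus_eq Y.a_assoc Y.r_neg)
qed

lemma rel_uminus: "\<phi> \<in> rel \<Longrightarrow> - \<phi> \<in> rel"
  using tensor_rel.diff[OF tensor_rel.zero] by fastforce

lemma rel_add: "\<phi> \<in> rel \<Longrightarrow> \<psi> \<in> rel \<Longrightarrow> \<phi> + \<psi> \<in> rel"
  using tensor_rel.diff[OF _ rel_uminus] by fastforce

lemma Y_sum_minus_both:
  assumes "x \<in> carrier Y" "y \<in> carrier Y" shows "x \<oplus>\<^bsub>Y\<^esub> y \<ominus>\<^bsub>Y\<^esub> x \<ominus>\<^bsub>Y\<^esub> y = \<zero>\<^bsub>Y\<^esub>"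
proof -
  have "x \<oplus>\<^bsub>Y\<^esub> y \<ominus>\<^bsub>Y\<^esub> x = y"
    using assms by (simp add: Y.a_comm[of x y] Y.a_assoc Y.r_neg Y.minus_eq)
  then show ?thesis using assms by (simp add: Y.minus_eq Y.r_neg)
qed

lemma Y_diff_zero_iff: "x \<in> carrier Y \<Longrightarrow> y \<in> carrier Y \<Longrightarrow> x \<ominus>\<^bsub>Y\<^esub> y = \<zero>\<^bsub>Y\<^esub> \<longleftrightarrow> x = y"
  using Y.minus_equality[of x "\<ominus>\<^bsub>Y\<^esub> y"] by (auto simp: Y.minus_eq Y.r_neg)

lemma ev_rel: "\<phi> \<in> rel \<Longrightarrow> \<phi> \<in> T \<and> ev \<phi> = \<zero>\<^bsub>Y\<^esub>"
proof (induction rule: tensor_rel.induct)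
  case zero
  then show ?case by (simp add: T_zero ev_zero)
next
  case (diff \<phi> \<psi>)
  then show ?case by (simp add: T_diff ev_diff Y.minus_eq)
next
  case (add_left s t u)
  have "s \<oplus>\<^bsub>L\<^esub> t \<in> carrier L" using add_left by (simp add: add_L_closed)
  then show ?case using add_left Y_smult(1,2) \<iota>_closed
    by (simp add: T_diff ev_diff T_frag ev_frag Y_sum_minus_both)
next
  case (add_right s u v)
  then show ?case using Y_smult(1,3) \<iota>_closed
    by (simp add: T_diff ev_diff T_frag ev_frag \<iota>_add Y_sum_minus_both)
next
  case (balanced s r u)
  have "s \<otimes>\<^bsub>L\<^esub> can r \<in> carrier L" using balanced by (simp add: mult_L_closed)
  then show ?case using balanced Y_smult(1,4) M_smult(1) \<iota>_closed
    by (simp add: T_diff ev_diff T_frag ev_frag \<iota>_smult Y.minus_eq Y.r_neg)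
qed

lemma frag_zero_rel: "s \<in> carrier L \<Longrightarrow> frag_of (s, \<zero>\<^bsub>M\<^esub>) \<in> rel"
  using tensor_rel.add_right[of s L "\<zero>\<^bsub>M\<^esub>" M "\<zero>\<^bsub>M\<^esub>" R can] rel_uminus[of "- frag_of (s, \<zero>\<^bsub>M\<^esub>)"] by simp

lemma common_denominator:
  assumes "u \<in> carrier M"
  shows "frag_of (fraction \<one> m, u) - frag_of (fraction \<one> (m + l), z [^] l \<odot>\<^bsub>M\<^esub> u) \<in> rel"
proof -
  have "fraction \<one> (m + l) \<otimes>\<^bsub>L\<^esub> can (z [^] l) = fraction \<one> m"
    using fraction_cancel[of \<one> l m] by (simp add: mult_L)
  then show ?thesis
    using tensor_rel.balanced[of "fraction \<one> (m + l)" L "z [^] l" R u M can] assms by simp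
qed

text \<open>Finitely many fractions have a common denominator, so every tensor is a single pure tensor
  \<open>z\<^sup>-\<^sup>m \<otimes> u\<close>.\<close>

lemma normal_form:
  assumes "\<phi> \<in> T"
  shows "\<exists>m. \<exists>u\<in>carrier M. \<phi> - frag_of (fraction \<one> m, u) \<in> rel"
  using assms
proof (induction rule: T_induct)
  case zero
  show ?case using rel_uminus[OF frag_zero_rel[of "fraction \<one> 0"]] by (auto intro!: bexI[of _ "\<zero>\<^bsub>M\<^esub>"])
next
  case (frag s u)
  then obtain a m where a: "a \<in> carrier R" "s = fraction \<one> m \<otimes>\<^bsub>L\<^esub> can a"
    by (metis carrier_L fraction_factor)
  then have "frag_of (s, u) - frag_of (fraction \<one> m, a \<odot>\<^bsub>M\<^esub> u) \<in> rel"
    using tensor_rel.balanced[of "fraction \<one> m" L a R u M can] frag by simp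
  then show ?case using M_smult(1)[OF a(1) frag(2)] by blast
next
  case (diff \<phi> \<psi>)
  then obtain m u l v where u: "u \<in> carrier M" "\<phi> - frag_of (fraction \<one> m, u) \<in> rel"
    and v: "v \<in> carrier M" "\<psi> - frag_of (fraction \<one> l, v) \<in> rel" by blast
  let ?s = "fraction \<one> (m + l)" and ?x = "z [^] l \<odot>\<^bsub>M\<^esub> u" and ?y = "z [^] m \<odot>\<^bsub>M\<^esub> v"
  let ?A = "frag_of (fraction \<one> m, u)" and ?B = "frag_of (fraction \<one> l, v)"
  have xy: "?x \<in> carrier M" "?y \<in> carrier M" using u v M_smult(1) by auto
  have A: "?A - frag_of (?s, ?x) \<in> rel" by (rule common_denominator[OF u(1)])
  have B: "?B - frag_of (?s, ?y) \<in> rel"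
    using common_denominator[OF v(1), of l m] by (simp add: add.commute)
  have C: "frag_of (?s, ?x) - frag_of (?s, ?x \<ominus>\<^bsub>M\<^esub> ?y) - frag_of (?s, ?y) \<in> rel"
  proof -
    have "?x \<ominus>\<^bsub>M\<^esub> ?y \<oplus>\<^bsub>M\<^esub> ?y = ?x" using xy by (simp add: M.minus_eq M.a_assoc M.l_neg)
    then show ?thesis using tensor_rel.add_right[of ?s L "?x \<ominus>\<^bsub>M\<^esub> ?y" M ?y R can] xy by simp
  qed
  \<comment> \<open>bring both tensors to the denominator \<open>z^(m + l)\<close> and subtract there\<close>
  have "(\<phi> - ?A) - (\<psi> - ?B) + ((?A - frag_of (?s, ?x)) - (?B - frag_of (?s, ?y))) +
      (frag_of (?s, ?x) - frag_of (?s, ?x \<ominus>\<^bsub>M\<^esub> ?y) - frag_of (?s, ?y)) \<in> rel"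
    by (intro rel_add tensor_rel.diff u v A B C)
  then have "\<phi> - \<psi> - frag_of (?s, ?x \<ominus>\<^bsub>M\<^esub> ?y) \<in> rel" by (simp add: algebra_simps)
  then show ?case using xy M.minus_closed by blast
qed

text \<open>Injectivity of \<open>L \<otimes> M \<rightarrow> Y\<close>: if \<open>z\<^sup>-\<^sup>m \<otimes> u\<close> is mapped to zero, then so is \<open>u\<close>, because \<open>z\<close> is invertible on
  \<open>Y\<close>, and \<open>\<iota>\<close> is injective.\<close>

lemma rel_iff: "\<phi> \<in> T \<Longrightarrow> \<phi> \<in> rel \<longleftrightarrow> ev \<phi> = \<zero>\<^bsub>Y\<^esub>"
proof
  assume \<phi>: "\<phi> \<in> T" "ev \<phi> = \<zero>\<^bsub>Y\<^esub>"
  obtain m u where u: "u \<in> carrier M" "\<phi> - frag_of (fraction \<one> m, u) \<in> rel"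
    using normal_form[OF \<phi>(1)] by blast
  have "\<zero>\<^bsub>Y\<^esub> \<ominus>\<^bsub>Y\<^esub> fraction \<one> m \<odot>\<^bsub>Y\<^esub> \<iota> u = \<zero>\<^bsub>Y\<^esub>"
    using ev_rel[OF u(2)] \<phi> u(1) by (simp add: ev_diff T_frag ev_frag)
  then have "fraction \<one> m \<odot>\<^bsub>Y\<^esub> \<iota> u = \<zero>\<^bsub>Y\<^esub>"
    using Y_smult(1)[of "fraction \<one> m" "\<iota> u"] \<iota>_closed[OF u(1)]
by (simp add: Y_diff_zero_iff)
  then have "\<iota> u = can (z [^] m) \<odot>\<^bsub>Y\<^esub> \<zero>\<^bsub>Y\<^esub>"
    using inverse_zpow_smult(2)[OF Y_module \<iota>_closed[OF u(1)], of m] by simp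
  then have "\<iota> u = \<iota> \<zero>\<^bsub>M\<^esub>" using left_module_smult_zero[OF Y_module] by (simp add: \<iota>_zero)
  then have "u = \<zero>\<^bsub>M\<^esub>" using \<iota>_inj u(1) by (auto dest: inj_onD)
  then have "\<phi> - frag_of (fraction \<one> m, u) + frag_of (fraction \<one> m, u) \<in> rel"
    using u(2) frag_zero_rel by (intro rel_add) auto
  then show "\<phi> \<in> rel" by simp
qed (use ev_rel in blast)

lemma ev_surj:
  assumes "y \<in> carrier Y"
  obtains m u where "u \<in> carrier M" "can (z [^] m) \<odot>\<^bsub>Y\<^esub> y = \<iota> u" "ev (frag_of (fraction \<one> m, u)) = y"
proof -
  obtain m u where u: "u \<in> carrier M" "can (z [^] (m::nat)) \<odot>\<^bsub>Y\<^esub> y = \<iota> u" using absorbing[OF assms] by blast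
  then have "ev (frag_of (fraction \<one> m, u)) = y"
    using inverse_zpow_smult(1)[OF Y_module assms, of m] by (simp add: ev_frag)
  then show thesis using u that by blast
qed

text \<open>The classes of \<open>tensor_cls\<close> turn out to be the fibres of \<open>ev\<close>.  Hence \<open>fib\<close> is the isomorphism from \<open>Y\<close>
  onto \<open>L \<otimes> M\<close>, and \<open>unfib\<close>, which evaluates any representative, is its inverse; the operations of \<open>ext_scalars_obj\<close> are read off from it
  without checking that they respect the tensor relators.\<close>

definition fib :: "'t \<Rightarrow> (('r \<times> nat) set \<times> 'u \<Rightarrow>\<^sub>0 int) set" where
  "fib y = {\<phi> \<in> T. ev \<phi> = y}"

definition unfib :: "(('r \<times> nat) set \<times> 'u \<Rightarrow>\<^sub>0 int) set \<Rightarrow> 't" where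
  "unfib A = ev (SOME \<phi>. \<phi> \<in> A)"

lemma fib_nonempty: 
  assumes "y \<in> carrier Y" shows "\<exists>\<phi>. \<phi> \<in> fib y"
proof -
  obtain m u where "u \<in> carrier M" "ev (frag_of (fraction \<one> m, u)) = y"
    using ev_surj[OF assms] by metis
  then have "frag_of (fraction \<one> m, u) \<in> fib y" by (simp add: fib_def T_frag)
  then show ?thesis ..
qed

lemma unfib_fib: "y \<in> carrier Y \<Longrightarrow> unfib (fib y) = y"
  using someI_ex[OF fib_nonempty] by (auto simp: unfib_def fib_def)

lemma cls_eq_fib: "\<phi> \<in> T \<Longrightarrow> cls \<phi> = fib (ev \<phi>)"
  unfolding tensor_cls_def fib_def
  by (auto simp: rel_iff T_diff ev_diff ev_closed Y_diff_zero_iff)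

lemma UN_fib:
  assumes "y \<in> carrier Y" "\<And>\<phi>. \<phi> \<in> T \<Longrightarrow> ev \<phi> = y \<Longrightarrow> F \<phi> = K"
  shows "(\<Union>\<phi>\<in>fib y. F \<phi>) = K"
  using fib_nonempty[OF assms(1)] assms(2) by (auto simp: fib_def)

lemma carrier_E: "carrier E = fib ` carrier Y"
proof -
  have "cls ` T = (\<lambda>\<phi>. fib (ev \<phi>)) ` T" by (simp add: cls_eq_fib)
  also have "\<dots> = fib ` carrier Y" using fib_nonempty by (force simp: fib_def ev_closed)
  finally show ?thesis by (simp add: ext_scalars_obj_def)
qed

lemma zero_E: "\<zero>\<^bsub>E\<^esub> = fib \<zero>\<^bsub>Y\<^esub>"
  by (simp add: ext_scalars_obj_def cls_eq_fib T_zero ev_zero)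

lemma add_E: "x \<in> carrier Y \<Longrightarrow> y \<in> carrier Y \<Longrightarrow> fib x \<oplus>\<^bsub>E\<^esub> fib y = fib (x \<oplus>\<^bsub>Y\<^esub> y)"
  unfolding ext_scalars_obj_def by (simp, intro UN_fib) (auto simp: cls_eq_fib T_add ev_add)

lemma frag_extend_smult:
  assumes "t \<in> carrier L" "\<phi> \<in> T"
  shows "frag_extend (\<lambda>(s, u). frag_of (t \<otimes>\<^bsub>L\<^esub> s, u)) \<phi> \<in> T \<and>
    ev (frag_extend (\<lambda>(s, u). frag_of (t \<otimes>\<^bsub>L\<^esub> s, u)) \<phi>) = t \<odot>\<^bsub>Y\<^esub> ev \<phi>"
  using assms(2)
proof (induction rule: T_induct)
  case zero
  then show ?case using left_module_smult_zero[OF Y_module assms(1)] by (simp add: T_zero ev_zero)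
next
  case (frag s u)
  then show ?case using assms(1) Y_smult(4)[OF assms(1) frag(1) \<iota>_closed[OF frag(2)]] mult_L_closed
    by (simp add: T_frag ev_frag)
next
  case (diff \<phi> \<psi>)
  then show ?case using assms(1) Y_smult(3)[OF assms(1)] left_module_smult_minus[OF Y_module assms(1)]
    by (simp add: frag_extend_diff T_diff ev_diff ev_closed Y.minus_eq)
qed

lemma smult_E: "t \<in> carrier L \<Longrightarrow> y \<in> carrier Y \<Longrightarrow> t \<odot>\<^bsub>E\<^esub> fib y = fib (t \<odot>\<^bsub>Y\<^esub> y)"
  unfolding ext_scalars_obj_def by (simp, intro UN_fib) (auto simp: cls_eq_fib frag_extend_smult)

text \<open>A homogeneous \<open>y\<close> of degree \<open>d\<close> is the image of \<open>z\<^sup>-\<^sup>m \<otimes> z\<^sup>m y\<close>, whose factors have degrees \<open>-m\<close> and \<open>d + m\<close>.\<close>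

lemma mpart_E: "mpart E d = fib ` mpart Y d"
proof -
  let ?S = "{(s, x). \<exists>i j. i + j = d \<and> s \<in> hpart L i \<and> x \<in> mpart M j}"
  let ?H = "{\<phi>. \<forall>(s, x) \<in> Poly_Mapping.keys \<phi>. \<exists>i j. i + j = d \<and> s \<in> hpart L i \<and> x \<in> mpart M j}"
  interpret D: additive_subgroup "mpart Y d" Y by (rule graded_moduleD(3)[OF Y])
  have H: "\<phi> \<in> T \<and> ev \<phi> \<in> mpart Y d" if "\<phi> \<in> ?H" for \<phi>
  proof -
    have "Poly_Mapping.keys \<phi> \<subseteq> ?S" using that by auto
    then show ?thesis
    proof (induction rule: frag_induction)
      case zero
      then show ?case by (simp add: T_zero ev_zero)
    next
      case (one p)
      then obtain s x i j where p: "p = (s, x)" "i + j = d" "s \<in> hpart L i" "x \<in> mpart M j" by auto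
      then have c: "s \<in> carrier L" "x \<in> carrier M" "\<iota> x \<in> mpart Y j"
        using hpart_L_closed by (auto simp: \<iota>_mpart)
      then show ?case using p graded_moduleD(5)[OF Y p(3) c(3)] by (simp add: T_frag ev_frag)
    next
      case (diff a b)
      then show ?case by (simp add: T_diff ev_diff Y.minus_eq D.a_closed D.a_inv_closed)
    qed
  qed
  have "\<exists>\<phi>\<in>?H. ev \<phi> = y" if y: "y \<in> mpart Y d" for y
  proof -
    obtain m u where u: "u \<in> carrier M" "can (z [^] m) \<odot>\<^bsub>Y\<^esub> y = \<iota> u" "ev (frag_of (fraction \<one> m, u)) = y"
      using ev_surj[OF mpart_closed[OF Y y]] .
    have "\<iota> u \<in> mpart Y (d + int m)" using zpow_smult_mpart[OF Y y, of m] u by simp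
    then have "frag_of (fraction \<one> m, u) \<in> ?H"
      using inverse_zpow_hpart[of m] u(1) by (force simp: \<iota>_mpart)
    then show ?thesis using u by blast
  qed
  then have "cls ` ?H = fib ` mpart Y d" using H by (force simp: cls_eq_fib)
  then show ?thesis by (simp add: ext_scalars_obj_def)
qed

lemma unfib_E:
  "A \<in> carrier E \<Longrightarrow> unfib A \<in> carrier Y \<and> fib (unfib A) = A"
  by (auto simp: carrier_E unfib_fib)

lemma left_module_E: "left_module L E"
proof (rule left_module_pullback[OF Y_module, where h = "\<lambda>a. a" and \<Phi> = unfib])
  show "inj_on unfib (carrier E)" by (auto simp: carrier_E inj_on_def unfib_fib)
  show "\<exists>B\<in>carrier E. unfib B = \<ominus>\<^bsub>Y\<^esub> unfib A" if "A \<in> carrier E" for A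
    using that unfib_E[OF that] by (intro bexI[of _ "fib (\<ominus>\<^bsub>Y\<^esub> unfib A)"]) (auto simp: unfib_fib carrier_E)
qed (auto simp: carrier_E unfib_fib add_E zero_E smult_E Y_smult(1) add_L_closed mult_L_closed one_L)

lemma fib_homogeneous_sums:
  assumes "y \<in> carrier Y" shows "fib y \<in> homogeneous_sums E (mpart E)"
proof -
  have "fib y \<in> homogeneous_sums E (mpart E) \<and> y \<in> carrier Y"
  proof (rule homogeneous_sums_map[OF Y.abelian_group_axioms])
    show "y \<in> homogeneous_sums Y (mpart Y)" by (rule graded_module_homogeneous_sums[OF Y assms])
  qed (simp_all add: zero_E add_E mpart_E mpart_closed[OF Y])
  then show ?thesis ..
qed

lemma graded_module_E: "graded_module L E"
proof (rule graded_module_pullback[OF left_module_E Y, where h = "\<lambda>a. a" and \<Phi> = unfib])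
  show "inj_on unfib (carrier E)" by (auto simp: carrier_E inj_on_def unfib_fib)
  show "mpart E d = {A \<in> carrier E. unfib A \<in> mpart Y d}" for d
    using mpart_closed[OF Y] by (auto simp: carrier_E mpart_E unfib_fib)
  show "A \<in> homogeneous_sums E (mpart E)" if "A \<in> carrier E" for A
    using that fib_homogeneous_sums by (auto simp: carrier_E)
qed (use hpart_L_closed in \<open>auto simp: carrier_E unfib_fib add_E zero_E smult_E Y_smult(1)\<close>)

lemma fin_gen_E: "fin_gen L Y \<Longrightarrow> fin_gen L E"
  by (rule fin_gen_image[OF Y_module graded_moduleD(2)[OF graded_module_E], where f = fib])
    (auto simp: carrier_E add_E smult_E)

end

text \<open>The isomorphisms \<open>fib\<close> are natural: extension of scalars turns the restriction \<open>g\<close> of \<open>f\<close> to the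
  lattices back into \<open>f\<close>.\<close>

lemma ext_scalars_arr:
  assumes K: "graded_lattice R z Y M \<iota>" and K': "graded_lattice R z Y' M' \<iota>'"
    and f: "f \<in> gmod_hom (loc_alg R z) Y Y'" and g: "\<And>u. u \<in> carrier M \<Longrightarrow> g u \<in> carrier M'"
    and fg: "\<And>u. u \<in> carrier M \<Longrightarrow> \<iota>' (g u) = f (\<iota> u)"
    and y: "y \<in> carrier Y"
  shows "fst (snd (far (ext_scalars R (loc_alg R z) (\<lambda>r. Defs.frac R z r 0)) (M, g, M'))) (graded_lattice.fib R z Y M \<iota> y)
      = graded_lattice.fib R z Y' M' \<iota>' (f y)"
proof -
  interpret K: graded_lattice R z Y M \<iota> by (rule K)
  interpret K': graded_lattice R z Y' M' \<iota>' by (rule K')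
  have "frag_extend (\<lambda>(s, x). frag_of (s, g x)) \<phi> \<in> K'.T \<and>
     K'.ev (frag_extend (\<lambda>(s, x). frag_of (s, g x)) \<phi>) = f (K.ev \<phi>)" if "\<phi> \<in> K.T" for \<phi>
    using that
  proof (induction rule: K.T_induct)
    case zero
    then show ?case using gmod_hom_zero[OF f K.Y.abelian_group_axioms K'.Y.abelian_group_axioms]
      by (simp add: K'.T_zero K'.ev_zero K.ev_zero)
  next
    case (frag s u)
    then show ?case using gmod_homD(3)[OF f] K.\<iota>_closed g fg
      by (simp add: K'.T_frag K'.ev_frag K.ev_frag)
  next
    case (diff \<phi> \<psi>)
    have "f (K.ev \<phi>) = f (K.ev (\<phi> - \<psi>)) \<oplus>\<^bsub>Y'\<^esub> f (K.ev \<psi>)"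
      using diff.hyps gmod_homD(2)[OF f] K.ev_add[of "\<phi> - \<psi>" \<psi>] K.T_diff K.ev_closed by simp
    then have "f (K.ev (\<phi> - \<psi>)) = f (K.ev \<phi>) \<ominus>\<^bsub>Y'\<^esub> f (K.ev \<psi>)"
      using diff.hyps gmod_homD(1)[OF f] K.T_diff K.ev_closed
      by (simp add: K'.Y.minus_eq K'.Y.a_assoc K'.Y.r_neg)
    then show ?case using diff by (simp add: frag_extend_diff K'.T_diff K'.ev_diff)
  qed
  then have "(\<Union>\<phi>\<in>K.fib y. K'.cls (frag_extend (\<lambda>(s, x). frag_of (s, g x)) \<phi>)) = K'.fib (f y)"
    by (intro K.UN_fib[OF y]) (simp add: K'.cls_eq_fib)
  moreover have "K.fib y \<in> carrier K.E" using y by (simp add: K.carrier_E)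
  ultimately show ?thesis by (simp add: ext_scalars_def)
qed

section \<open>Spans of homogeneous elements\<close>

lemma homogeneous_generators:
  assumes Y: "graded_module R Y" "fin_gen R Y"
  obtains G where "finite G" "\<And>g. g \<in> G \<Longrightarrow> \<exists>d. g \<in> mpart Y d"
    "\<And>N. left_submodule R Y N \<Longrightarrow> G \<subseteq> N \<Longrightarrow> N = carrier Y"
proof -
  obtain S where S: "finite S" "S \<subseteq> carrier Y"
    "\<And>N. left_submodule R Y N \<Longrightarrow> S \<subseteq> N \<Longrightarrow> N = carrier Y"
    using Y(2) by (auto simp: fin_gen_def)
  have "\<forall>s\<in>S. \<exists>c. (\<forall>d. c d \<in> mpart Y d) \<and> finite {d. c d \<noteq> \<zero>\<^bsub>Y\<^esub>} \<and> s = (\<Oplus>\<^bsub>Y\<^esub>d\<in>{d. c d \<noteq> \<zero>\<^bsub>Y\<^esub>}. c d)"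
    using graded_moduleD(4)[OF Y(1)] S(2) by blast
  then obtain c where c: "\<And>s d. s \<in> S \<Longrightarrow> c s d \<in> mpart Y d"
    "\<And>s. s \<in> S \<Longrightarrow> finite {d. c s d \<noteq> \<zero>\<^bsub>Y\<^esub>}"
    "\<And>s. s \<in> S \<Longrightarrow> s = (\<Oplus>\<^bsub>Y\<^esub>d\<in>{d. c s d \<noteq> \<zero>\<^bsub>Y\<^esub>}. c s d)"
    by metis
  let ?G = "\<Union>s\<in>S. c s ` {d. c s d \<noteq> \<zero>\<^bsub>Y\<^esub>}"
  show thesis
  proof (rule that[of ?G])
    show "finite ?G" using S(1) c(2) by blast
    show "\<exists>d. g \<in> mpart Y d" if "g \<in> ?G" for g using that c(1) by blast
    show "N = carrier Y" if N: "left_submodule R Y N" "?G \<subseteq> N" for N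
    proof (rule S(3)[OF N(1)], rule subsetI)
      fix s assume s: "s \<in> S"
      have "additive_subgroup N Y" using N(1) by (simp add: left_submodule_def)
      then have "(\<Oplus>\<^bsub>Y\<^esub>d\<in>{d. c s d \<noteq> \<zero>\<^bsub>Y\<^esub>}. c s d) \<in> N"
        using N(2) s by (intro additive_subgroup_finsum[OF graded_moduleD(2)[OF Y(1)]]) auto
      then show "s \<in> N" using c(3)[OF s] by simp
    qed
  qed
qed

text \<open>The \<open>R\<close>-submodule of \<open>Y\<close> generated by \<open>G\<close>, built one multiple of a generator at a time: its
  grading, its size and its stability under maps follow from this by the same induction.\<close>

inductive_set can_span ::
    "('k, 'r) galg \<Rightarrow> 'r \<Rightarrow> (('r \<times> nat) set, 't) gmod \<Rightarrow> 't set \<Rightarrow> 't set"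
  for R z Y G where
  zero: "\<zero>\<^bsub>Y\<^esub> \<in> can_span R z Y G"
| add: "a \<in> carrier R \<Longrightarrow> g \<in> G \<Longrightarrow> y \<in> can_span R z Y G \<Longrightarrow>
    (Defs.frac R z a 0 \<odot>\<^bsub>Y\<^esub> g) \<oplus>\<^bsub>Y\<^esub> y \<in> can_span R z Y G"

locale span_setting = graded_localization R z for R :: "('k, 'r) galg" (structure) and z +
  fixes Y :: "(('r \<times> nat) set, 't) gmod" and G :: "'t set"
  assumes Y: "graded_module L Y" and G_homogeneous: "g \<in> G \<Longrightarrow> \<exists>d. g \<in> mpart Y d"
begin

abbreviation "P \<equiv> can_span R z Y G"

sublocale Y: abelian_group Y using Y by (rule graded_moduleD(2))
lemmas Y_module = graded_moduleD(1)[OF Y]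
lemmas Y_smult = left_moduleD(2-6)[OF Y_module]

lemma G_closed: "g \<in> G \<Longrightarrow> g \<in> carrier Y"
  using G_homogeneous mpart_closed[OF Y] by blast

lemma can_smult_closed: "a \<in> carrier R \<Longrightarrow> y \<in> carrier Y \<Longrightarrow> can a \<odot>\<^bsub>Y\<^esub> y \<in> carrier Y"
  by (simp add: Y_smult(1))

lemma can_smult_mult: "a \<in> carrier R \<Longrightarrow> b \<in> carrier R \<Longrightarrow> y \<in> carrier Y \<Longrightarrow>
    can (a \<otimes> b) \<odot>\<^bsub>Y\<^esub> y = can a \<odot>\<^bsub>Y\<^esub> (can b \<odot>\<^bsub>Y\<^esub> y)"
  by (simp add: can_mult Y_smult(4))

lemma can_smult_one: "y \<in> carrier Y \<Longrightarrow> can \<one> \<odot>\<^bsub>Y\<^esub> y = y"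
  using Y_smult(5) by (simp add: one_L)

lemma can_smult_zero: assumes "y \<in> carrier Y" shows "can \<zero> \<odot>\<^bsub>Y\<^esub> y = \<zero>\<^bsub>Y\<^esub>"
proof -
  have "can \<zero> \<odot>\<^bsub>Y\<^esub> y \<oplus>\<^bsub>Y\<^esub> can \<zero> \<odot>\<^bsub>Y\<^esub> y = can \<zero> \<odot>\<^bsub>Y\<^esub> y"
    using Y_smult(2)[of "can \<zero>" "can \<zero>" y] can_add[of \<zero> \<zero>] assms by simp
  then show ?thesis using can_smult_closed[of \<zero> y] assms by (simp add: Y.add.r_cancel_one')
qed

lemma can_smult_uminus_one: assumes "y \<in> carrier Y" shows "can (\<ominus> \<one>) \<odot>\<^bsub>Y\<^esub> y = \<ominus>\<^bsub>Y\<^esub> y"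
proof -
  have "can (\<ominus> \<one>) \<odot>\<^bsub>Y\<^esub> y \<oplus>\<^bsub>Y\<^esub> y = can (\<ominus> \<one> \<oplus> \<one>) \<odot>\<^bsub>Y\<^esub> y"
    using assms by (simp add: can_add Y_smult(2) can_smult_one)
  then have "can (\<ominus> \<one>) \<odot>\<^bsub>Y\<^esub> y \<oplus>\<^bsub>Y\<^esub> y = \<zero>\<^bsub>Y\<^esub>" using assms by (simp add: l_neg can_smult_zero)
  then show ?thesis using Y.minus_equality[OF _ assms can_smult_closed[of "\<ominus> \<one>" y]] assms by simp
qed

lemma P_closed: "y \<in> P \<Longrightarrow> y \<in> carrier Y"
  by (induction rule: can_span.induct) (auto simp: G_closed can_smult_closed)

lemma P_add: "x \<in> P \<Longrightarrow> y \<in> P \<Longrightarrow> x \<oplus>\<^bsub>Y\<^esub> y \<in> P"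
proof (induction rule: can_span.induct)
  case (add a g x)
  then have "can a \<odot>\<^bsub>Y\<^esub> g \<oplus>\<^bsub>Y\<^esub> (x \<oplus>\<^bsub>Y\<^esub> y) \<in> P" by (blast intro: can_span.add)
  then show ?case using add by (simp add: Y.a_assoc P_closed G_closed can_smult_closed)
qed (simp add: P_closed)

lemma P_smult: "y \<in> P \<Longrightarrow> a \<in> carrier R \<Longrightarrow> can a \<odot>\<^bsub>Y\<^esub> y \<in> P"
proof (induction rule: can_span.induct)
  case zero
  then show ?case using left_module_smult_zero[OF Y_module] by (simp add: can_span.zero)
next
  case (add b g y)
  have "can a \<odot>\<^bsub>Y\<^esub> (can b \<odot>\<^bsub>Y\<^esub> g \<oplus>\<^bsub>Y\<^esub> y) = can (a \<otimes> b) \<odot>\<^bsub>Y\<^esub> g \<oplus>\<^bsub>Y\<^esub> can a \<odot>\<^bsub>Y\<^esub> y"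
    using add.hyps add.prems by (simp add: can_smult_mult Y_smult(3) G_closed P_closed can_smult_closed)
  moreover have "\<dots> \<in> P" using add by (intro can_span.add) auto
  ultimately show ?case by simp
qed

lemma P_uminus: "y \<in> P \<Longrightarrow> \<ominus>\<^bsub>Y\<^esub> y \<in> P"
  using P_smult[of y "\<ominus> \<one>"] by (simp add: can_smult_uminus_one P_closed)

lemma G_subset_P: "g \<in> G \<Longrightarrow> g \<in> P"
  using can_span.add[OF one_closed _ can_span.zero, of g G Y z] by (simp add: can_smult_one G_closed)

text \<open>Since the generators are homogeneous, only their coefficients have to be split.\<close>

lemma P_homogeneous_sums: "y \<in> P \<Longrightarrow> y \<in> homogeneous_sums Y (\<lambda>d. P \<inter> mpart Y d)"
proof (induction rule: can_span.induct)
  case (add a g y)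
  let ?H = "homogeneous_sums Y (\<lambda>d. P \<inter> mpart Y d)"
  obtain e where e: "g \<in> mpart Y e" using G_homogeneous add by blast
  have "can a \<odot>\<^bsub>Y\<^esub> g \<oplus>\<^bsub>Y\<^esub> y \<in> ?H \<and> a \<in> carrier R" if "a \<in> homogeneous_sums R (hpart R)" for a
    using that
  proof induction
    case zero
    show ?case using add by (simp add: can_smult_zero G_closed P_closed)
  next
    case (add r d b)
    have r: "r \<in> carrier R" using add.hyps hpart_closed by blast
    have "can r \<odot>\<^bsub>Y\<^esub> g \<in> P \<inter> mpart Y (d + e)"
      using P_smult[OF G_subset_P[OF \<open>g \<in> G\<close>] r] graded_moduleD(5)[OF Y can_hpart[OF add.hyps(1)] e] by blast
    then have "can r \<odot>\<^bsub>Y\<^esub> g \<oplus>\<^bsub>Y\<^esub> (can b \<odot>\<^bsub>Y\<^esub> g \<oplus>\<^bsub>Y\<^esub> y) \<in> ?H"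
      using add.IH by (blast intro: homogeneous_sums.add)
    moreover have "can (r \<oplus> b) \<odot>\<^bsub>Y\<^esub> g \<oplus>\<^bsub>Y\<^esub> y = can r \<odot>\<^bsub>Y\<^esub> g \<oplus>\<^bsub>Y\<^esub> (can b \<odot>\<^bsub>Y\<^esub> g \<oplus>\<^bsub>Y\<^esub> y)"
      using r add.IH G_closed[OF \<open>g \<in> G\<close>] P_closed[OF \<open>y \<in> P\<close>]
      by (simp add: can_add Y_smult(2) Y.a_assoc can_smult_closed)
    ultimately show ?case using r add.IH by simp
  qed
  then show ?case using homogeneous_sums add.hyps(1) by blast
qed (rule homogeneous_sums.zero)

text \<open>The elements that some power of \<open>z\<close> moves into \<open>P\<close> form an \<open>L\<close>-submodule: to multiply by \<open>a/z\<^sup>l\<close>,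
  increase the power by \<open>l\<close>.\<close>

lemma P_absorbing:
  assumes gen: "\<And>N. left_submodule L Y N \<Longrightarrow> G \<subseteq> N \<Longrightarrow> N = carrier Y" and y: "y \<in> carrier Y"
  shows "\<exists>m. can (z [^] (m::nat)) \<odot>\<^bsub>Y\<^esub> y \<in> P"
proof -
  let ?N = "{y \<in> carrier Y. \<exists>m. can (z [^] (m::nat)) \<odot>\<^bsub>Y\<^esub> y \<in> P}"
  have up: "can (z [^] (l + m)) \<odot>\<^bsub>Y\<^esub> y \<in> P" if "can (z [^] (m::nat)) \<odot>\<^bsub>Y\<^esub> y \<in> P" "y \<in> carrier Y" for l m y
    using P_smult[OF that(1), of "z [^] l"] that(2) by (simp add: nat_pow_mult flip: can_smult_mult)
  have "additive_subgroup ?N Y"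
  proof (intro additive_subgroupI subgroup.intro)
    fix x y assume xy: "x \<in> ?N" "y \<in> ?N"
    then obtain m l where "can (z [^] (m::nat)) \<odot>\<^bsub>Y\<^esub> x \<in> P" "can (z [^] (l::nat)) \<odot>\<^bsub>Y\<^esub> y \<in> P" by blast
    then have "can (z [^] (l + m)) \<odot>\<^bsub>Y\<^esub> x \<oplus>\<^bsub>Y\<^esub> can (z [^] (l + m)) \<odot>\<^bsub>Y\<^esub> y \<in> P"
      using up[of m x l] up[of l y m] xy by (intro P_add) (simp_all add: add.commute)
    then have "can (z [^] (l + m)) \<odot>\<^bsub>Y\<^esub> (x \<oplus>\<^bsub>Y\<^esub> y) \<in> P" using xy by (simp add: Y_smult(3))
    then show "x \<otimes>\<^bsub>add_monoid Y\<^esub> y \<in> ?N" using xy by auto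
  next
    fix x assume x: "x \<in> ?N"
    then obtain m where "can (z [^] (m::nat)) \<odot>\<^bsub>Y\<^esub> x \<in> P" by blast
    then have "can (z [^] m) \<odot>\<^bsub>Y\<^esub> (\<ominus>\<^bsub>Y\<^esub> x) \<in> P"
      using x by (simp add: left_module_smult_minus[OF Y_module] P_uminus)
    then show "inv\<^bsub>add_monoid Y\<^esub> x \<in> ?N" using x by (auto simp flip: a_inv_def)
  next
    show "\<one>\<^bsub>add_monoid Y\<^esub> \<in> ?N"
      using left_module_smult_zero[OF Y_module] by (auto simp: can_span.zero)
  qed auto
  moreover have "s \<odot>\<^bsub>Y\<^esub> y \<in> ?N" if s: "s \<in> carrier L" and y: "y \<in> ?N" for s y
  proof -
    obtain a l where a: "a \<in> carrier R" "s = fraction a l" using s by (auto simp: carrier_L)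
    obtain m where m: "can (z [^] (m::nat)) \<odot>\<^bsub>Y\<^esub> y \<in> P" using y by blast
    have "can (z [^] (l + m)) \<otimes>\<^bsub>L\<^esub> s = can (z [^] m \<otimes> a)"
      using a fraction_cancel[of "z [^] m \<otimes> a" l 0] by (simp add: mult_L zpow_zpow)
    also have "\<dots> = can a \<otimes>\<^bsub>L\<^esub> can (z [^] m)" using a by (simp add: zpow_central can_mult)
    finally have "can (z [^] (l + m)) \<odot>\<^bsub>Y\<^esub> (s \<odot>\<^bsub>Y\<^esub> y) = can a \<odot>\<^bsub>Y\<^esub> (can (z [^] m) \<odot>\<^bsub>Y\<^esub> y)"
      using Y_smult(4)[of "can (z [^] (l + m))" s y] Y_smult(4)[of "can a" "can (z [^] m)" y] a s y by simp
    then have "can (z [^] (l + m)) \<odot>\<^bsub>Y\<^esub> (s \<odot>\<^bsub>Y\<^esub> y) \<in> P" using P_smult[OF m a(1)] by simp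
    then show ?thesis using Y_smult(1)[OF s] y by blast
  qed
  ultimately have "left_submodule L Y ?N" by (auto simp: left_submodule_def)
  moreover have "G \<subseteq> ?N"
    using P_smult[OF G_subset_P, of _ "z [^] (0::nat)"] G_closed by (intro subsetI CollectI conjI exI[of _ "0::nat"]) auto
  ultimately have "carrier Y \<subseteq> ?N" by (rule equalityD2[OF gen])
  then show ?thesis using y by blast
qed

text \<open>An element of the span is recorded by the list of the pairs (coefficient, generator).\<close>

lemma P_lepoll:
  assumes inf: "infinite (UNIV :: 'c set)" and "finite G" "carrier R \<lesssim> (UNIV :: 'c set)"
  shows "P \<lesssim> (UNIV :: 'c set)"
proof -
  let ?f = "\<lambda>l. foldr (\<lambda>(a, g) y. can a \<odot>\<^bsub>Y\<^esub> g \<oplus>\<^bsub>Y\<^esub> y) l \<zero>\<^bsub>Y\<^esub>"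
  have "y \<in> ?f ` lists (carrier R \<times> G)" if "y \<in> P" for y
    using that
  proof (induction rule: can_span.induct)
    case zero
    show ?case by (rule image_eqI[of _ _ "[]"]) auto
  next
    case (add a g y)
    then obtain l where "y = ?f l" "l \<in> lists (carrier R \<times> G)" by blast
    then show ?case using add by (intro image_eqI[of _ _ "(a, g) # l"]) auto
  qed
  then have "P \<subseteq> ?f ` lists (carrier R \<times> G)" by blast
  moreover have "lists (carrier R \<times> G) \<lesssim> (UNIV :: 'c set)"
    by (intro lists_lepoll_infinite times_lepoll_infinite inf assms(3) finite_lepoll_infinite[OF inf assms(2)])
  ultimately show ?thesis by (meson subset_image_lepoll lepoll_trans)
qed

text \<open>The span of \<open>G\<close> with its structure transported along \<open>e\<close>.  This moves it into the universe in which
  the objects of \<open>gr R\<close> have to live.\<close>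

lemma ex_lattice:
  fixes e :: "'t \<Rightarrow> 'u"
  assumes gen: "\<And>N. left_submodule L Y N \<Longrightarrow> G \<subseteq> N \<Longrightarrow> N = carrier Y" and "finite G"
    and e: "inj_on e P"
  shows "\<exists>(M :: ('r, 'u) gmod) \<iota>. graded_lattice R z Y M \<iota> \<and> fin_gen R M \<and> \<iota> ` carrier M = P"
proof -
  define \<iota> where "\<iota> = inv_into P e"
  have \<iota>e: "\<iota> (e y) = y" if "y \<in> P" for y using that e by (simp add: \<iota>_def)
  define M :: "('r, 'u) gmod" where "M = \<lparr>carrier = e ` P, mult = (\<lambda>_ _. e \<zero>\<^bsub>Y\<^esub>), one = e \<zero>\<^bsub>Y\<^esub>,
     ring.zero = e \<zero>\<^bsub>Y\<^esub>, add = (\<lambda>u v. e (\<iota> u \<oplus>\<^bsub>Y\<^esub> \<iota> v)), smult = (\<lambda>a u. e (can a \<odot>\<^bsub>Y\<^esub> \<iota> u)),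
     mpart = (\<lambda>d. e ` (P \<inter> mpart Y d))\<rparr>"
  have M: "carrier M = e ` P" "\<zero>\<^bsub>M\<^esub> = e \<zero>\<^bsub>Y\<^esub>" "mpart M d = e ` (P \<inter> mpart Y d)" for d
    by (simp_all add: M_def)
  have e_add: "e x \<oplus>\<^bsub>M\<^esub> e y = e (x \<oplus>\<^bsub>Y\<^esub> y)" if "x \<in> P" "y \<in> P" for x y
    using that by (simp add: M_def \<iota>e)
  have smult: "a \<odot>\<^bsub>M\<^esub> e y = e (can a \<odot>\<^bsub>Y\<^esub> y)" if "y \<in> P" for a y
    using that by (simp add: M_def \<iota>e)
  have inj: "inj_on \<iota> (carrier M)" by (auto simp: M inj_on_def \<iota>e)
  have mpart: "mpart M d = {u \<in> carrier M. \<iota> u \<in> mpart Y d}" for d by (auto simp: M \<iota>e)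
  note simps = M e_add smult \<iota>e P_closed P_add P_smult can_span.zero
  have lm: "left_module R M"
  proof (rule left_module_pullback[OF Y_module, where h = can and \<Phi> = \<iota>])
    show "\<exists>v\<in>carrier M. \<iota> v = \<ominus>\<^bsub>Y\<^esub> \<iota> u" if "u \<in> carrier M" for u
      using that by (intro bexI[of _ "e (\<ominus>\<^bsub>Y\<^esub> \<iota> u)"]) (auto simp: simps P_uminus)
  qed (use inj in \<open>auto simp: simps can_add can_mult one_L\<close>)
  have gm: "graded_module R M"
  proof (rule graded_module_pullback[OF lm Y, where h = can and \<Phi> = \<iota>])
    show "u \<in> homogeneous_sums M (mpart M)" if u: "u \<in> carrier M" for u
    proof -
      have "e y \<in> homogeneous_sums M (mpart M) \<and> y \<in> P" if "y \<in> homogeneous_sums Y (\<lambda>d. P \<inter> mpart Y d)" for y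
        using that
      proof induction
        case zero
        show ?case by (metis M(2) can_span.zero homogeneous_sums.zero)
      next
        case (add x d y)
        have "e x \<in> mpart M d" using add.hyps by (auto simp: M(3))
        then have "e x \<oplus>\<^bsub>M\<^esub> e y \<in> homogeneous_sums M (mpart M)"
          using add.IH by (blast intro: homogeneous_sums.add)
        moreover have "x \<in> P" "y \<in> P" using add.hyps add.IH by auto
        ultimately show ?case by (simp add: P_add e_add)
      qed
      then show ?thesis using u P_homogeneous_sums by (auto simp: M)
    qed
  qed (use inj mpart hpart_closed can_hpart in \<open>auto simp: simps\<close>)
  have "graded_lattice R z Y M \<iota>"
  proof (intro graded_lattice.intro graded_lattice_axioms.intro)
    show "\<exists>m. can (z [^] (m::nat)) \<odot>\<^bsub>Y\<^esub> y \<in> \<iota> ` carrier M" if "y \<in> carrier Y" for y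
      using P_absorbing[OF gen that] by (force simp: M image_iff \<iota>e)
  qed (use inj mpart gm Y graded_localization_axioms in \<open>auto simp: simps\<close>)
  moreover have "K = carrier M" if K: "left_submodule R M K" "e ` G \<subseteq> K" for K
  proof -
    interpret K: additive_subgroup K M using K by (simp add: left_submodule_def)
    have "e y \<in> K" if "y \<in> P" for y
      using that
    proof (induction rule: can_span.induct)
      case zero
      show ?case using K.zero_closed by (simp add: M)
    next
      case (add a g y)
      then have "a \<odot>\<^bsub>M\<^esub> e g \<in> K" using K by (auto simp: left_submodule_def)
      then have "a \<odot>\<^bsub>M\<^esub> e g \<oplus>\<^bsub>M\<^esub> e y \<in> K" using add.IH by (rule K.a_closed)
      then show ?case using add by (simp add: smult e_add G_subset_P P_smult)
    qed
    then show ?thesis using K.a_subset by (auto simp: M)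
  qed
  then have "fin_gen R M" unfolding fin_gen_def
    using \<open>finite G\<close> G_subset_P by (intro exI[of _ "e ` G"]) (auto simp: M)
  moreover have "\<iota> ` carrier M = P" by (force simp: M \<iota>e)
  ultimately show ?thesis by blast
qed

end

lemma gmod_hom_restrict:
  assumes K: "graded_lattice R z Y M \<iota>" and K': "graded_lattice R z Y' M' \<iota>'"
    and f: "f \<in> gmod_hom (loc_alg R z) Y Y'" and im: "f ` \<iota> ` carrier M \<subseteq> \<iota>' ` carrier M'"
  shows "\<exists>g\<in>gmod_hom R M M'. \<forall>u\<in>carrier M. \<iota>' (g u) = f (\<iota> u)"
proof -
  interpret K: graded_lattice R z Y M \<iota> by (rule K)
  interpret K': graded_lattice R z Y' M' \<iota>' by (rule K')
  define g where "g = (\<lambda>u\<in>carrier M. inv_into (carrier M') \<iota>' (f (\<iota> u)))"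
  have g: "g u \<in> carrier M'" "\<iota>' (g u) = f (\<iota> u)" if "u \<in> carrier M" for u
    using that im by (auto simp: g_def inv_into_into f_inv_into_f image_subset_iff)
  have eq: "u = v" if "\<iota>' u = \<iota>' v" "u \<in> carrier M'" "v \<in> carrier M'" for u v
    using that K'.\<iota>_inj by (auto dest: inj_onD)
  have "g \<in> gmod_hom R M M'"
    unfolding gmod_hom_def
  proof (intro CollectI conjI ballI allI)
    show "g \<in> carrier M \<rightarrow>\<^sub>E carrier M'" using g by (auto simp: g_def)
    show "g ` mpart M d \<subseteq> mpart M' d" for d
      using g gmod_homD(4)[OF f] by (auto simp: K.\<iota>_mpart K'.\<iota>_mpart)
  next
    fix u v assume "u \<in> carrier M" "v \<in> carrier M"
    then show "g (u \<oplus>\<^bsub>M\<^esub> v) = g u \<oplus>\<^bsub>M'\<^esub> g v"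
      using g gmod_homD(2)[OF f] by (intro eq) (auto simp: K.\<iota>_add K'.\<iota>_add K.\<iota>_closed)
  next
    fix a u assume "a \<in> carrier R" "u \<in> carrier M"
    then show "g (a \<odot>\<^bsub>M\<^esub> u) = a \<odot>\<^bsub>M'\<^esub> g u"
      using g gmod_homD(3)[OF f] K.M_smult(1) K'.M_smult(1)
      by (intro eq) (auto simp: K.\<iota>_smult K'.\<iota>_smult K.\<iota>_closed)
  qed
  then show ?thesis using g by blast
qed

section \<open>Lifting complexes\<close>

lemma gr_complexD:
  assumes "is_bounded_complex (gr R) K"
  shows "graded_module R (cob K i)" "fin_gen R (cob K i)"
    and "cdf K i = (cob K i, fst (snd (cdf K i)), cob K (i + 1))"
    and "fst (snd (cdf K i)) \<in> gmod_hom R (cob K i) (cob K (i + 1))"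
    and "y \<in> carrier (cob K i) \<Longrightarrow>
      fst (snd (cdf K (i + 1))) (fst (snd (cdf K i)) y) = \<zero>\<^bsub>cob K (i + 1 + 1)\<^esub>"
    and "\<exists>N. \<forall>i. \<bar>i\<bar> > N \<longrightarrow> carrier (cob K i) = {\<zero>\<^bsub>cob K i\<^esub>}"
proof -
  have K: "cob K i \<in> obj (gr R) \<and> cdf K i \<in> arr (gr R) \<and>
          src (gr R) (cdf K i) = cob K i \<and> tgt (gr R) (cdf K i) = cob K (i + 1) \<and>
          zero_arr (gr R) (cmp (gr R) (cdf K (i + 1)) (cdf K i))" for i
    using assms by (simp add: is_bounded_complex_def)
  show "graded_module R (cob K i)" "fin_gen R (cob K i)" using K[of i] by (auto simp: gr_def)
  show eq: "cdf K i = (cob K i, fst (snd (cdf K i)), cob K (i + 1))" for i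
    using K[of i] by (auto simp: gr_def)
  show hom: "fst (snd (cdf K i)) \<in> gmod_hom R (cob K i) (cob K (i + 1))"
    using K[of i] by (subst (asm) eq) (auto simp: gr_def)
  have "cmp (gr R) (cdf K (i + 1)) (cdf K i) = (cob K i,
      compose (carrier (cob K i)) (fst (snd (cdf K (i + 1)))) (fst (snd (cdf K i))), cob K (i + 1 + 1))"
    by (subst eq[of i], subst eq[of "i + 1"]) (simp add: gr_def)
  then show "fst (snd (cdf K (i + 1))) (fst (snd (cdf K i)) y) = \<zero>\<^bsub>cob K (i + 1 + 1)\<^esub>"
    if "y \<in> carrier (cob K i)"
    using zero_arr_grD[OF conjunct2[OF conjunct2[OF conjunct2[OF conjunct2[OF K[of i]]]]], of y] that
    by (simp add: compose_eq)
  show "\<exists>N. \<forall>i. \<bar>i\<bar> > N \<longrightarrow> carrier (cob K i) = {\<zero>\<^bsub>cob K i\<^esub>}"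
    using assms unfolding is_bounded_complex_def zero_obj_gr by meson
qed

lemma gr_complexI:
  fixes M :: "int \<Rightarrow> ('r, 'u) gmod"
  assumes M: "\<And>i. graded_module R (M i)" "\<And>i. fin_gen R (M i)"
    and g: "\<And>i. g i \<in> gmod_hom R (M i) (M (i + 1))"
    and gg: "\<And>i u. u \<in> carrier (M i) \<Longrightarrow> g (i + 1) (g i u) = \<zero>\<^bsub>M (i + 1 + 1)\<^esub>"
    and bounded: "\<exists>N. \<forall>i. \<bar>i\<bar> > N \<longrightarrow> carrier (M i) = {\<zero>\<^bsub>M i\<^esub>}"
  shows "is_bounded_complex (gr R) \<lparr>cob = M, cdf = (\<lambda>i. (M i, g i, M (i + 1)))\<rparr>"
proof -
  obtain N :: int where N: "\<And>i. \<bar>i\<bar> > N \<Longrightarrow> zero_obj (gr R) (M i)"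
    using bounded M by (auto simp: zero_obj_gr)
  have z: "zero_obj (gr R) (M (\<bar>N\<bar> + 1))" by (rule N) simp
  have "cmp (gr R) (M (i + 1), g (i + 1), M (i + 1 + 1)) (M i, g i, M (i + 1)) = (M i, zero_map (M i) (M (i + 1 + 1)), M (i + 1 + 1))" for i
    using gg[of _ i] by (auto simp: gr_def zero_map_def compose_def)
  moreover have "zero_arr (gr R) (M i, zero_map (M i) (M (i + 1 + 1)), M (i + 1 + 1))" for i
    using M by (intro zero_arr_grI[OF z])
  ultimately have "zero_arr (gr R) (cmp (gr R) (M (i + 1), g (i + 1), M (i + 1 + 1)) (M i, g i, M (i + 1)))" for i
    by simp
  moreover have "M i \<in> obj (gr R)" "(M i, g i, M (i + 1)) \<in> arr (gr R)"
    "src (gr R) (M i, g i, M (i + 1)) = M i" "tgt (gr R) (M i, g i, M (i + 1)) = M (i + 1)" for i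
    using M g by (auto simp: gr_def)
  ultimately show ?thesis unfolding is_bounded_complex_def using N by auto
qed

lemma isomorphic_gr_complexes:
  assumes K: "is_bounded_complex (gr R) K" and K': "is_bounded_complex (gr R) K'"
    and \<phi>: "\<And>i. \<phi> i \<in> gmod_hom R (cob K i) (cob K' i)"
    and \<chi>: "\<And>i. \<chi> i \<in> gmod_hom R (cob K' i) (cob K i)"
    and inv: "\<And>i x. x \<in> carrier (cob K i) \<Longrightarrow> \<chi> i (\<phi> i x) = x" "\<And>i y. y \<in> carrier (cob K' i) \<Longrightarrow> \<phi> i (\<chi> i y) = y"
    and comm: "\<And>i x. x \<in> carrier (cob K i) \<Longrightarrow>
      \<phi> (i + 1) (fst (snd (cdf K i)) x) = fst (snd (cdf K' i)) (\<phi> i x)"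
  shows "isomorphic (complexes (gr R)) K K'"
proof -
  note d = gr_complexD(3)[OF K] and d' = gr_complexD(3)[OF K']
  have comm': "\<chi> (i + 1) (fst (snd (cdf K' i)) y) = fst (snd (cdf K i)) (\<chi> i y)"
    if y: "y \<in> carrier (cob K' i)" for i y
  proof -
    have x: "\<chi> i y \<in> carrier (cob K i)" using gmod_homD(1)[OF \<chi>] y by blast
    have "\<phi> (i + 1) (fst (snd (cdf K i)) (\<chi> i y)) = fst (snd (cdf K' i)) y"
      using comm[OF x] inv(2)[OF y] by simp
    then show ?thesis using inv(1) gmod_homD(1)[OF gr_complexD(4)[OF K] x] by metis
  qed
  let ?f = "(K, \<lambda>i. (cob K i, \<phi> i, cob K' i), K')" and ?g = "(K', \<lambda>i. (cob K' i, \<chi> i, cob K i), K)"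
  note mods = gr_complexD(1,2)[OF K] gr_complexD(1,2)[OF K']
  have "cmp (gr R) (cdf K' i) (cob K i, \<phi> i, cob K' i) = cmp (gr R) (cob K (i + 1), \<phi> (i + 1), cob K' (i + 1)) (cdf K i)" for i
    using comm[of _ i] by (subst d[of i], subst d'[of i]) (auto simp: gr_def compose_def)
  then have f: "?f \<in> arr (complexes (gr R))"
    using K K' \<phi> mods by (auto simp: complexes_def is_chain_map_def gr_def)
  have "cmp (gr R) (cdf K i) (cob K' i, \<chi> i, cob K i) = cmp (gr R) (cob K' (i + 1), \<chi> (i + 1), cob K (i + 1)) (cdf K' i)" for i
    using comm'[of _ i] by (subst d[of i], subst d'[of i]) (auto simp: gr_def compose_def)
  then have g: "?g \<in> arr (complexes (gr R))"
    using K K' \<chi> mods by (auto simp: complexes_def is_chain_map_def gr_def)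
  have "compose (carrier (cob K i)) (\<chi> i) (\<phi> i) = (\<lambda>x\<in>carrier (cob K i). x)"
    "compose (carrier (cob K' i)) (\<phi> i) (\<chi> i) = (\<lambda>x\<in>carrier (cob K' i). x)" for i
    using inv by (auto simp: compose_def)
  then have "cmp (complexes (gr R)) ?g ?f = idt (complexes (gr R)) K"
    "cmp (complexes (gr R)) ?f ?g = idt (complexes (gr R)) K'"
    by (simp_all add: complexes_def gr_def)
  then have "is_iso (complexes (gr R)) ?f"
    unfolding is_iso_def using f g by (intro conjI bexI[of _ ?g]) (auto simp: complexes_def)
  then show ?thesis unfolding isomorphic_def by (intro exI[of _ ?f]) (simp add: complexes_def)
qed

lemma graded_lattice_homs:
  fixes M :: "('r, 'u) gmod"
    and Y :: "(('r \<times> nat) set, ((('r \<times> nat) set \<times> 'u) \<Rightarrow>\<^sub>0 int) set) gmod"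
    and R :: "('k, 'r) galg"
  assumes "graded_lattice R z Y M \<iota>"
  defines "L \<equiv> loc_alg R z"
  defines "E \<equiv> ext_scalars_obj R L (\<lambda>a. Defs.frac R z a 0) M"
  shows "(\<lambda>y\<in>carrier Y. graded_lattice.fib R z Y M \<iota> y) \<in> gmod_hom L Y E"
    and "(\<lambda>A\<in>carrier E. graded_lattice.unfib R z Y M \<iota> A) \<in> gmod_hom L E Y"
proof -
  interpret graded_lattice R z Y M \<iota> by fact
  show "(\<lambda>y\<in>carrier Y. fib y) \<in> gmod_hom L Y E"
    using mpart_closed[OF Y] unfolding assms(2,3)
    by (auto simp: gmod_hom_def carrier_E add_E smult_E Y_smult(1) mpart_E)
  show "(\<lambda>A\<in>carrier E. unfib A) \<in> gmod_hom L E Y"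
    using mpart_closed[OF Y] Y_smult(1) unfolding assms(2,3)
    by (auto simp: gmod_hom_def carrier_E add_E smult_E mpart_E unfib_fib)
qed

context graded_localization
begin

abbreviation "ext_can \<equiv> ext_scalars R L can"

text \<open>A family of lattices that is stable under the differential is a complex over \<open>R\<close>, and extension of
  scalars returns the given complex up to the isomorphisms \<open>fib\<close>.\<close>

lemma lattice_complex:
  fixes K :: "((('r \<times> nat) set, ((('r \<times> nat) set \<times> 'u) \<Rightarrow>\<^sub>0 int) set) gmod,
      (('r \<times> nat) set, ((('r \<times> nat) set \<times> 'u) \<Rightarrow>\<^sub>0 int) set) garr) cplx"
    and M :: "int \<Rightarrow> ('r, 'u) gmod"
  assumes K: "is_bounded_complex (gr L) K"
    and lat: "\<And>i. graded_lattice R z (cob K i) (M i) (\<iota> i)" and fg: "\<And>i. fin_gen R (M i)"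
    and stable: "\<And>i. fst (snd (cdf K i)) ` \<iota> i ` carrier (M i) \<subseteq> \<iota> (i + 1) ` carrier (M (i + 1))"
  shows "\<exists>K'. is_bounded_complex (gr R) K' \<and>
    isomorphic (complexes (gr L)) (fob (complexes_map ext_can) K') K"
proof -
  define \<delta> where "\<delta> i = fst (snd (cdf K i))" for i
  note \<delta> = gr_complexD(4)[OF K, folded \<delta>_def] and \<delta>\<delta> = gr_complexD(5)[OF K, folded \<delta>_def]
  interpret lat: graded_lattice R z "cob K i" "M i" "\<iota> i" for i by (rule lat)
  have inj: "u = v" if "\<iota> i u = \<iota> i v" "u \<in> carrier (M i)" "v \<in> carrier (M i)" for i u v
    using lat.\<iota>_inj that by (auto dest: inj_onD)
  have "\<forall>i. \<exists>g\<in>gmod_hom R (M i) (M (i + 1)). \<forall>u\<in>carrier (M i). \<iota> (i + 1) (g u) = \<delta> i (\<iota> i u)"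
    using gmod_hom_restrict[OF lat lat \<delta>] stable by (simp add: \<delta>_def)
  then obtain g where g: "\<And>i. g i \<in> gmod_hom R (M i) (M (i + 1))"
    "\<And>i u. u \<in> carrier (M i) \<Longrightarrow> \<iota> (i + 1) (g i u) = \<delta> i (\<iota> i u)" by metis
  obtain N where N: "\<And>i. \<bar>i\<bar> > N \<Longrightarrow> carrier (cob K i) = {\<zero>\<^bsub>cob K i\<^esub>}"
    using gr_complexD(6)[OF K] by blast
  define K' where "K' = \<lparr>cob = M, cdf = (\<lambda>i. (M i, g i, M (i + 1)))\<rparr>"
  have K': "is_bounded_complex (gr R) K'"
    unfolding K'_def
  proof (rule gr_complexI)
    fix i u assume u: "u \<in> carrier (M i)"
    then have gu: "g i u \<in> carrier (M (i + 1))" "g (i + 1) (g i u) \<in> carrier (M (i + 1 + 1))"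
      using gmod_homD(1)[OF g(1)] by blast+
    have "\<iota> (i + 1 + 1) (g (i + 1) (g i u)) = \<iota> (i + 1 + 1) \<zero>\<^bsub>M (i + 1 + 1)\<^esub>"
      using g(2)[OF gu(1)] g(2)[OF u] \<delta>\<delta>[OF lat.\<iota>_closed[OF u]] by (simp add: lat.\<iota>_zero)
    then show "g (i + 1) (g i u) = \<zero>\<^bsub>M (i + 1 + 1)\<^esub>" using gu(2) by (rule inj) simp
  next
    have "carrier (M i) = {\<zero>\<^bsub>M i\<^esub>}" if "\<bar>i\<bar> > N" for i
      using inj[of i] lat.\<iota>_closed[of _ i] N[OF that] lat.\<iota>_zero[of i] by fastforce
    then show "\<exists>N. \<forall>i. \<bar>i\<bar> > N \<longrightarrow> carrier (M i) = {\<zero>\<^bsub>M i\<^esub>}" by blast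
  qed (use lat.M fg g in auto)
  define Q where "Q = fob (complexes_map ext_can) K'"
  define D where "D i = fst (snd (far ext_can (M i, g i, M (i + 1))))" for i
  have D_fib: "D i (lat.fib i y) = lat.fib (i + 1) (\<delta> i y)" if "y \<in> carrier (cob K i)" for i y
    unfolding D_def using that g gmod_homD(1)[OF g(1)]
    by (intro ext_scalars_arr[OF lat lat \<delta>]) auto
  have D_ext: "D i \<in> extensional (carrier (lat.E i))" for i
    by (simp add: D_def ext_scalars_def)
  have Q_eq: "Q = \<lparr>cob = lat.E, cdf = (\<lambda>i. (lat.E i, D i, lat.E (i + 1)))\<rparr>"
    by (simp add: Q_def complexes_map_def K'_def ext_scalars_def D_def)
  have \<delta>_closed: "\<delta> i y \<in> carrier (cob K (i + 1))" if "y \<in> carrier (cob K i)" for i y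
    using gmod_homD(1)[OF \<delta> that] .
  have D_hom: "D i \<in> gmod_hom L (lat.E i) (lat.E (i + 1))" for i
    unfolding gmod_hom_def
    using D_ext[of i] \<delta>_closed gmod_homD(2-4)[OF \<delta>] mpart_closed[OF lat.Y] lat.Y_smult(1)
    by (auto simp: PiE_def lat.carrier_E lat.mpart_E D_fib lat.add_E lat.smult_E)
  have Q: "is_bounded_complex (gr L) Q"
    unfolding Q_eq
  proof (rule gr_complexI)
    show "D (i + 1) (D i A) = \<zero>\<^bsub>lat.E (i + 1 + 1)\<^esub>" if "A \<in> carrier (lat.E i)" for i A
      using that \<delta>\<delta> by (auto simp: lat.carrier_E D_fib \<delta>_closed lat.zero_E)
    show "\<exists>N. \<forall>i. \<bar>i\<bar> > N \<longrightarrow> carrier (lat.E i) = {\<zero>\<^bsub>lat.E i\<^esub>}"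
      using N by (intro exI[of _ N]) (simp add: lat.carrier_E lat.zero_E)
  qed (use lat.graded_module_E lat.fin_gen_E gr_complexD(2)[OF K] D_hom in auto)
  have "isomorphic (complexes (gr L)) Q K"
  proof (rule isomorphic_gr_complexes[OF Q K])
    show "(\<lambda>A\<in>carrier (lat.E i). graded_lattice.unfib R z (cob K i) (M i) (\<iota> i) A) \<in> gmod_hom L (cob Q i) (cob K i)" for i
      using graded_lattice_homs(2)[OF lat] by (simp add: Q_eq)
    show "(\<lambda>y\<in>carrier (cob K i). lat.fib i y) \<in> gmod_hom L (cob K i) (cob Q i)" for i
      using graded_lattice_homs(1)[OF lat] by (simp add: Q_eq)
  qed (auto simp: Q_eq lat.carrier_E lat.unfib_fib D_fib \<delta>_closed simp flip: \<delta>_def)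
  then show ?thesis using K' Q_def by blast
qed

text \<open>Stable lattices exist: the generators of degree \<open>i\<close> are enlarged by the images of those of degree
  \<open>i - 1\<close>, which the next differential kills.\<close>

lemma exists_lattice_complex:
  fixes K :: "((('r \<times> nat) set, ((('r \<times> nat) set \<times> 'u) \<Rightarrow>\<^sub>0 int) set) gmod,
      (('r \<times> nat) set, ((('r \<times> nat) set \<times> 'u) \<Rightarrow>\<^sub>0 int) set) garr) cplx"
    and e :: "'c \<Rightarrow> 'u"
  assumes K: "is_bounded_complex (gr L) K"
    and card: "infinite (UNIV :: 'c set)" "carrier R \<lesssim> (UNIV :: 'c set)" and e: "inj e"
  shows "\<exists>K' :: (('r, 'u) gmod, ('r, 'u) garr) cplx. is_bounded_complex (gr R) K' \<and>
    isomorphic (complexes (gr L)) (fob (complexes_map ext_can) K') K"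
proof -
  define \<delta> where "\<delta> i = fst (snd (cdf K i))" for i
  note gm = gr_complexD(1)[OF K] and \<delta> = gr_complexD(4)[OF K, folded \<delta>_def]
    and \<delta>\<delta> = gr_complexD(5)[OF K, folded \<delta>_def]
  have "\<forall>i. \<exists>H. finite H \<and> (\<forall>g\<in>H. \<exists>d. g \<in> mpart (cob K i) d) \<and>
      (\<forall>N. left_submodule L (cob K i) N \<longrightarrow> H \<subseteq> N \<longrightarrow> N = carrier (cob K i))"
    using homogeneous_generators[OF gr_complexD(1,2)[OF K]] by metis
  then obtain H where H: "\<And>i. finite (H i)" "\<And>i g. g \<in> H i \<Longrightarrow> \<exists>d. g \<in> mpart (cob K i) d"
    "\<And>i N. left_submodule L (cob K i) N \<Longrightarrow> H i \<subseteq> N \<Longrightarrow> N = carrier (cob K i)"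
    by metis
  have H_closed: "g \<in> carrier (cob K i)" if "g \<in> H i" for g i
    using H(2)[OF that] mpart_closed[OF gm] by blast
  define G where "G i = H i \<union> \<delta> (i - 1) ` H (i - 1)" for i
  have \<delta>': "\<delta> (i - 1) \<in> gmod_hom L (cob K (i - 1)) (cob K i)" for i using \<delta>[of "i - 1"] by simp
  interpret S: span_setting R z "cob K i" "G i" for i
  proof unfold_locales
    show "graded_module L (cob K i)" by (rule gm)
    show "\<exists>d. g \<in> mpart (cob K i) d" if "g \<in> G i" for g
      using that H(2) gmod_homD(4)[OF \<delta>'] unfolding G_def by blast
  qed
  have G_gen: "N = carrier (cob K i)" if "left_submodule L (cob K i) N" "G i \<subseteq> N" for i N
    using that H(3) by (auto simp: G_def)
  have \<delta>_G: "\<delta> i g \<in> S.P (i + 1)" if g: "g \<in> G i" for i g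
  proof (cases "g \<in> H i")
    case True
    then have "\<delta> i g \<in> G (i + 1)" by (simp add: G_def)
    then show ?thesis by (rule S.G_subset_P)
  next
    case False
    then obtain h where h: "h \<in> H (i - 1)" "g = \<delta> (i - 1) h" using g by (auto simp: G_def)
    then have "\<delta> i g = \<zero>\<^bsub>cob K (i + 1)\<^esub>" using \<delta>\<delta>[OF H_closed[OF h(1)]] by simp
    then show ?thesis by (simp add: can_span.zero)
  qed
  have stable: "\<delta> i y \<in> S.P (i + 1)" if "y \<in> S.P i" for i y
    using that
  proof (induction rule: can_span.induct)
    case zero
    show ?case
      using gmod_hom_zero[OF \<delta> S.Y.abelian_group_axioms S.Y.abelian_group_axioms] by (simp add: can_span.zero)
  next
    case (add a g y)
    have c: "g \<in> carrier (cob K i)" "y \<in> carrier (cob K i)"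
      using add S.G_closed S.P_closed by blast+
    have "\<delta> i (can a \<odot>\<^bsub>cob K i\<^esub> g \<oplus>\<^bsub>cob K i\<^esub> y) =
        can a \<odot>\<^bsub>cob K (i + 1)\<^esub> \<delta> i g \<oplus>\<^bsub>cob K (i + 1)\<^esub> \<delta> i y"
      using add.hyps(1) c by (simp add: gmod_homD(2,3)[OF \<delta>] S.can_smult_closed)
    then show ?case using S.P_add[OF S.P_smult[OF \<delta>_G[OF add.hyps(2)] add.hyps(1)] add.IH] by simp
  qed
  have "\<exists>(M :: ('r, 'u) gmod) \<iota>. graded_lattice R z (cob K i) M \<iota> \<and> fin_gen R M \<and> \<iota> ` carrier M = S.P i" for i
  proof -
    have "finite (G i)" using H(1) by (simp add: G_def)
    then obtain f :: "_ \<Rightarrow> 'c" where f: "inj_on f (S.P i)"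
      using S.P_lepoll[OF card(1) _ card(2)] unfolding lepoll_def by blast
    have "inj_on (e \<circ> f) (S.P i)" using f e by (simp add: comp_inj_on inj_on_subset)
    then show ?thesis using S.ex_lattice[OF G_gen \<open>finite (G i)\<close>] by blast
  qed
  then obtain M :: "int \<Rightarrow> ('r, 'u) gmod" and \<iota> where M: "\<And>i. graded_lattice R z (cob K i) (M i) (\<iota> i)"
    "\<And>i. fin_gen R (M i)" "\<And>i. \<iota> i ` carrier (M i) = S.P i" by metis
  show ?thesis
    by (rule lattice_complex[OF K M(1,2)]) (use stable M(3) in \<open>auto simp flip: \<delta>_def\<close>)
qed

end

lemma isomorphic_loc_cat:
  assumes "category C" "isomorphic C x y" shows "isomorphic (loc_cat C W) x y"
  using assms category.is_iso_loc_functor category.loc_functor_arr(2,3)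
  unfolding isomorphic_def by (metis is_iso_def)

lemma graded_localization_B: "graded_localization (B_alg n b c d) (B_Z n b c d)"
  for b :: "nat \<Rightarrow> nat \<Rightarrow> 'k::field_char_0"
  by (intro graded_localization.intro central_localization_B graded_localization_axioms.intro
      B_hpart_closed B_one_hpart B_Z_hpart B_homogeneous_sums)

theorem corollary3:
  fixes n :: nat
    and b :: "nat \<Rightarrow> nat \<Rightarrow> 'k::field_char_0"
    and c :: "nat \<Rightarrow> nat \<Rightarrow> nat \<Rightarrow> 'k"
    and d :: "nat \<Rightarrow> nat \<Rightarrow> 'k"
    and grB :: "(((gvar list \<Rightarrow> 'k) set, 'u) gmod, ((gvar list \<Rightarrow> 'k) set, 'u) garr) cat"
  assumes "n \<ge> 1"
    and "g_algebra n b c d"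
    and universe: "\<exists>e :: 'k \<Rightarrow> 'u. inj e"
    and grB: "grB = gr (B_alg n b c d)"
  shows "dense (Db grB) (Db (gr (B_loc n b c d)))
           (Db_map (gr (B_loc n b c d)) (Q_functor n b c d))
       \<and> (\<forall>\<psi>. is_functor (Qgr (B_alg n b c d)) (gr (B_loc n b c d)) \<psi> \<and>
              ftor_eq_on grB (ftor_comp \<psi> (Qgr_proj (B_alg n b c d))) (Q_functor n b c d)
            \<longrightarrow> dense (Db (Qgr (B_alg n b c d))) (Db (gr (B_loc n b c d)))
                  (Db_map (gr (B_loc n b c d)) \<psi>))"
proof -
  let ?R = "B_alg n b c d" and ?L = "B_loc n b c d" and ?Q = "Q_functor n b c d"
  let ?G = "gr ?L :: (_, (_, ((((gvar list \<Rightarrow> 'k) set \<times> nat) set \<times> 'u) \<Rightarrow>\<^sub>0 int) set) garr) cat"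
  obtain e :: "'k \<Rightarrow> 'u" where e: "inj e" using universe by blast
  have lift: "\<exists>K'. is_bounded_complex grB K' \<and> isomorphic (Db ?G) (fob (complexes_map ?Q) K') K"
    if K: "K \<in> obj (Db ?G)" for K
  proof -
    have "is_bounded_complex ?G K" using K by (simp add: Db_def loc_cat_def complexes_def)
    then have "\<exists>K'. is_bounded_complex grB K' \<and> isomorphic (complexes ?G) (fob (complexes_map ?Q) K') K"
      using graded_localization.exists_lattice_complex[OF graded_localization_B _ infinite_UNIV_char_0 B_lepoll e]
      unfolding grB B_loc_def Q_functor_def by blast
    then show ?thesis
      unfolding Db_def using isomorphic_loc_cat[OF category.category_complexes[OF category_gr]] by blast
  qed
  have "dense (Db grB) (Db ?G) (Db_map ?G ?Q)"
    unfolding dense_def using lift by (simp add: Db_def Db_map_def loc_induced_def loc_cat_def complexes_def)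
  moreover have "dense (Db (Qgr ?R)) (Db ?G) (Db_map ?G \<psi>)"
    if \<psi>: "ftor_eq_on grB (ftor_comp \<psi> (Qgr_proj ?R)) ?Q" for \<psi>
    unfolding dense_def
  proof
    fix K assume "K \<in> obj (Db ?G)"
    then obtain K' where K': "is_bounded_complex grB K'"
      "isomorphic (Db ?G) (fob (complexes_map ?Q) K') K" using lift by blast
    let ?\<pi>K = "\<lparr>cob = cob K', cdf = (\<lambda>i. far (Qgr_proj ?R) (cdf K' i))\<rparr>"
    have "is_bounded_complex (Qgr ?R) ?\<pi>K"
      using category.is_bounded_complex_loc_functor[OF category_gr] K'(1)
      unfolding Qgr_def Qgr_proj_def serre_quotient_def serre_functor_def grB by blast
    moreover have "fob (complexes_map \<psi>) ?\<pi>K = fob (complexes_map ?Q) K'"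
    proof -
      have "cob K' i \<in> obj grB" "cdf K' i \<in> arr grB" for i
        using K'(1) by (auto simp: is_bounded_complex_def)
      then have "fob \<psi> (cob K' i) = fob ?Q (cob K' i)" "far \<psi> (far (Qgr_proj ?R) (cdf K' i)) = far ?Q (cdf K' i)" for i
        using \<psi> by (simp_all add: ftor_eq_on_def ftor_comp_def Qgr_proj_def serre_functor_def loc_functor_def)
      then show ?thesis by (simp add: complexes_map_def)
    qed
    ultimately show "\<exists>x\<in>obj (Db (Qgr ?R)). isomorphic (Db ?G) (fob (Db_map ?G \<psi>) x) K"
      using K'(2) by (intro bexI[of _ ?\<pi>K]) (simp_all add: Db_def Db_map_def loc_induced_def loc_cat_def complexes_def)
  qed
  ultimately show ?thesis by blast
qed

end
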